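(* Let $F$ be a finite-mean distribution on the positive real line with mean $\mu$, whose right tail satisfies $\bar F(x)=1-F(x)\sim 2C_1/(xL(x))$ as $x\to\infty$, where $C_1=1/\pi$ and the slowly varying function $L$ is $$L(x)=\begin{cases}(\beta_0\log x)^{\delta+1}\,e^{(\beta_1\log x)^{\gamma}} & \beta_1>0,\\ (\beta_0\log x)^{\delta+1} & \beta_1=0,\end{cases}$$ with $\beta_0>0$ and either $\beta_1>0$, $0<\gamma<1$ ($\delta$ real), or $\beta_1=0$, $\delta>0$ (in which case $\gamma=0$). Let $L^\dagger$ be the de Bruijn conjugate of $L$, let $K_{\delta,\gamma,\beta_1}=2C_1/(\beta_1^\gamma\gamma)$ if $\beta_1,\gamma>0$ and $K_{\delta,0,0}=2C_1/\delta$, and let $\bar X_n$ be the average of $n$ independent random variables with distribution $F$. Then the distribution of the sample average for large $n$ is $$\frac{\bar X_n-\mu}{L^\dagger(n)}=-K_{\delta,\gamma,\beta_1}(\log n)^{1-\gamma}+\varepsilon+o_p(1),$$ where $\varepsilon$ has the Cauchy limit law with skewness $\beta=1$. Given the right-tail behaviour of this limit law, $$\mathbb{P}(\bar X_n>\mu)\sim\frac{2}{\pi}K_{\delta,\gamma,\beta_1}^{-1}(\log n)^{\gamma-1},$$ which tends to zero at rate $\beta_1^\gamma\gamma(\log n)^{\gamma-1}$ if $\beta_1,\gamma>0$, or $\delta/\log n$ if $\beta_1=0$.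
   Context: $a\sim b$ means $a/b\to1$. The formula for $L$ is used for large $x$. The de Bruijn conjugate $L^\dagger$ of a slowly varying function $L$ is the slowly varying function, unique up to asymptotic equivalence, such that $L(xL^\dagger(x))L^\dagger(x)\to1$ and $L^\dagger(xL(x))L(x)\to1$ as $x\to\infty$. The Cauchy limit law with skewness $\beta=1$ (the maximally skew stable law of index $\alpha=1$) is the distribution with log characteristic function $\log\psi(t)=-|t|-2it\log|t|/\pi$; its right tail satisfies $\mathbb{P}(\varepsilon>x)\sim 2/(\pi x)$ as $x\to\infty$. The first display is an equality in the sense of distribution, and $o_p(1)$ denotes a term converging to $0$ in probability.
   Formalization: The first display, false for an arbitrary version of the de Bruijn conjugate (it is fixed only up to asymptotic equivalence), is proved exactly for some version, possibly depending on F, and for every version with centring -K(log n)^{1-γ}(1+r_n), where r_n→0 is deterministic. *)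

theory Defs
  imports "HOL-Probability.Probability" "HOL-Library.Landau_Symbols"
begin

text \<open>Slow variation at infinity. As usual the function only has to be positive and measurable
  on some half-line; its values elsewhere are irrelevant.\<close>

definition slowly_varying :: "(real \<Rightarrow> real) \<Rightarrow> bool" where
  "slowly_varying L \<longleftrightarrow>
     (\<exists>x0. L \<in> borel_measurable (restrict_space borel {x0..}) \<and> (\<forall>x\<ge>x0. 0 < L x)) \<and>
     (\<forall>c>0. ((\<lambda>x. L (c * x) / L x) \<longlongrightarrow> 1) at_top)"

text \<open>The conjugate is determined by these conditions only up to asymptotic equivalence, so it is
  a relation: \<open>Ld\<close> is a version of the de Bruijn conjugate of \<open>L\<close>.\<close>

definition de_bruijn_conjugate :: "(real \<Rightarrow> real) \<Rightarrow> (real \<Rightarrow> real) \<Rightarrow> bool" where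
  "de_bruijn_conjugate L Ld \<longleftrightarrow>
     slowly_varying Ld \<and>
     ((\<lambda>x. L (x * Ld x) * Ld x) \<longlongrightarrow> 1) at_top \<and>
     ((\<lambda>x. Ld (x * L x) * L x) \<longlongrightarrow> 1) at_top"

definition C1 :: real where
  "C1 = 1 / pi"

text \<open>Only the values for large \<open>x\<close> are meaningful.\<close>

definition tail_L :: "real \<Rightarrow> real \<Rightarrow> real \<Rightarrow> real \<Rightarrow> real \<Rightarrow> real" where
  "tail_L \<beta>0 \<beta>1 \<delta> \<gamma> x =
     (if \<beta>1 > 0 then (\<beta>0 * ln x) powr (\<delta> + 1) * exp ((\<beta>1 * ln x) powr \<gamma>)
      else (\<beta>0 * ln x) powr (\<delta> + 1))"

definition K_const :: "real \<Rightarrow> real \<Rightarrow> real \<Rightarrow> real" where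
  "K_const \<delta> \<gamma> \<beta>1 =
     (if \<beta>1 > 0 \<and> \<gamma> > 0 then 2 * C1 / (\<beta>1 powr \<gamma> * \<gamma>) else 2 * C1 / \<delta>)"

text \<open>The stable law of index 1 with skewness 1. At \<open>t = 0\<close> the convention \<open>ln 0 = 0\<close> is
  harmless because of the factor \<open>t\<close>.\<close>

definition cauchy_limit_law :: "real measure \<Rightarrow> bool" where
  "cauchy_limit_law S \<longleftrightarrow>
     real_distribution S \<and>
     (\<forall>t. char S t =
        exp (- complex_of_real \<bar>t\<bar> - 2 * \<i> * complex_of_real (t * ln \<bar>t\<bar>) / complex_of_real pi))"

definition tends_to_zero_in_prob :: "'a measure \<Rightarrow> (nat \<Rightarrow> 'a \<Rightarrow> real) \<Rightarrow> bool" where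
  "tends_to_zero_in_prob N R \<longleftrightarrow>
     (\<forall>n. R n \<in> borel_measurable N) \<and>
     (\<forall>e>0. (\<lambda>n. measure N {\<omega> \<in> space N. \<bar>R n \<omega>\<bar> > e}) \<longlonglongrightarrow> 0)"

text \<open>\<open>Y n = c n + \<epsilon> + o\<^sub>p(1)\<close> as an equality in distribution, for large \<open>n\<close>, where \<open>\<epsilon>\<close> has the
  Cauchy limit law and \<open>c n\<close> is deterministic. The variable \<open>\<epsilon>\<close> and the remainders live on a
  probability space of their own.\<close>

definition eq_in_distr_cauchy_op ::
    "'a measure \<Rightarrow> (nat \<Rightarrow> 'a \<Rightarrow> real) \<Rightarrow> (nat \<Rightarrow> real) \<Rightarrow> bool" where
  "eq_in_distr_cauchy_op M Y c \<longleftrightarrow>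
     (\<exists>(N :: real measure) \<epsilon> R.
        prob_space N \<and>
        \<epsilon> \<in> borel_measurable N \<and>
        cauchy_limit_law (distr N borel \<epsilon>) \<and>
        tends_to_zero_in_prob N R \<and>
        (\<forall>\<^sub>F n in sequentially.
           distr M borel (Y n) = distr N borel (\<lambda>\<omega>. c n + \<epsilon> \<omega> + R n \<omega>)))"

definition sample_mean :: "(nat \<Rightarrow> 'a \<Rightarrow> real) \<Rightarrow> nat \<Rightarrow> 'a \<Rightarrow> real" where
  "sample_mean X n \<omega> = (\<Sum>i<n. X i \<omega>) / real n"

end

theory Submission
  imports Defs "HOL-Real_Asymp.Real_Asymp"
begin

text \<open>
  Write \<open>g x = x * L x\<close>, so that the tail of \<open>F\<close> is asymptotic to \<open>(2/pi) / g x\<close>, and let \<open>s n\<close> be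
  the solution of \<open>g (s n) = n\<close>. Then \<open>n * P(X > s n * y)\<close> tends to \<open>(2/pi) / y\<close> and \<open>x \<mapsto> g\<^sup>-\<^sup>1 x / x\<close> is a
  de Bruijn conjugate of \<open>L\<close>; it is unique up to asymptotic equivalence because \<open>g\<close> is regularly
  varying and monotone (lemmas \<open>conjugateI\<close>, \<open>conjugate_unique\<close>).

  What matters about \<open>L\<close> is its logarithmic derivative \<open>e x = x * L' x / L x\<close>: it is about
  \<open>\<kappa> * (ln x) powr (\<gamma> - 1)\<close>, up to a term that integration by parts absorbs. Hence the integral of
  \<open>1 / g\<close> over \<open>[x, \<infinity>)\<close> is asymptotic to \<open>(ln x) powr (1 - \<gamma>) / (\<kappa> * L x)\<close> (lemma \<open>integrated_tail\<close>). Divided by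
  \<open>s n / n\<close>, the contribution of the summands beyond \<open>s n\<close> to the mean is therefore about
  \<open>K * (ln n) powr (1 - \<gamma>)\<close> with \<open>K = 2 / (pi * \<kappa>)\<close>. This diverges: the sample mean is typically too
  small, since it has not yet seen the large observations that \<open>\<mu>\<close> accounts for.

  Limit law. Centre each summand \<open>X / s n\<close> by \<open>m n = E (sin (X / s n))\<close>. For a bounded smooth \<open>H\<close> vanishing to
  second order at 0, \<open>n * E (H (X / s n))\<close> tends to \<open>(2/pi)\<close> times the integral of \<open>H' y / y\<close>
  (lemma \<open>scaled_expectation_limit\<close>). For \<open>H x = cos (t x) - 1\<close> this is the sine integral and gives
  \<open>-|t|\<close>; for \<open>H x = sin (t x) - t sin x\<close> it is a Frullani integral and gives
  \<open>-(2/pi) t ln |t|\<close>. So the characteristic function of the centred sum \<open>W n\<close> converges to the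
  Cauchy limit law without any shift. The law itself is obtained as a weak limit, by tightness, and
  Skorohod's representation turns weak convergence into an equality in distribution with a
  remainder that vanishes in probability (lemmas \<open>W_limit_law\<close>, \<open>eq_in_distr_of_weak_conv\<close>). The
  centring \<open>c n\<close> that relates \<open>W n\<close> to the sample mean is only asymptotically equal to
  \<open>K * (ln n) powr (1 - \<gamma>)\<close>; a conjugate is free up to a factor tending to 1, and this factor makes the
  centring exact for a suitable conjugate, whereas a general one leaves the relative error \<open>r n\<close>.

  Probability of exceeding the mean. As the centring diverges, weak convergence does not give this
  asymptotics; a large-deviation argument does. With \<open>T n = s n * K * (ln (s n)) powr (1 - \<gamma>)\<close>, the sum exceeds
  \<open>n \<mu>\<close> essentially only if a single summand makes up for the deficit \<open>T n\<close>, which has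
  probability about \<open>n * P(X > T n)\<close>. Chebyshev's inequality for summands truncated at \<open>\<eta> * T n\<close> bounds
  everything else by about \<open>C * \<eta>\<close> times this probability, and \<open>\<eta>\<close> is arbitrary
  (lemmas \<open>sum_excess_upper\<close>, \<open>sum_excess_lower\<close>, \<open>exceed_mean_asymp\<close>). The deficit moves the argument of \<open>L\<close> only
  by a power of a logarithm, which leaves \<open>L\<close> asymptotically unchanged (lemma \<open>L_ratio_tendsto_1\<close>).
\<close>

section \<open>Slowly varying functions with a given logarithmic derivative\<close>

text \<open>Here \<open>e\<close> is the logarithmic derivative \<open>x * L' x / L x\<close>. The combination in \<open>e_lim\<close> is the one that
  arises when \<open>ln x powr (1 - \<gamma>) / L x\<close> is differentiated, so that this function is an asymptotic
  antiderivative of \<open>- \<kappa> / (x * L x)\<close>; \<open>D_lim\<close> says that it vanishes at infinity.\<close>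

locale slow_variation =
  fixes L e :: "real \<Rightarrow> real" and \<gamma> \<kappa> x0 :: real
  assumes gamma: "0 \<le> \<gamma>" "\<gamma> < 1"
    and kappa: "\<kappa> > 0"
    and x0: "x0 > 1"
    and L_pos: "x \<ge> x0 \<Longrightarrow> L x > 0"
    and L_deriv: "x \<ge> x0 \<Longrightarrow> (L has_real_derivative L x * e x / x) (at x)"
    and L_meas [measurable]: "L \<in> borel_measurable borel"
    and e_meas [measurable]: "e \<in> borel_measurable borel"
    and e_lim: "((\<lambda>x. e x * ln x powr (1 - \<gamma>) - (1 - \<gamma>) * ln x powr (- \<gamma>)) \<longlongrightarrow> \<kappa>) at_top"
    and D_lim: "((\<lambda>x. ln x powr (1 - \<gamma>) / L x) \<longlongrightarrow> 0) at_top"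
begin

definition g :: "real \<Rightarrow> real" where "g x = x * L x"

text \<open>The asymptotic antiderivative: the integral of \<open>1 / g\<close> over \<open>[x, \<infinity>)\<close> is about \<open>tail_D x / \<kappa>\<close>.\<close>

definition tail_D :: "real \<Rightarrow> real" where "tail_D x = ln x powr (1 - \<gamma>) / L x"

lemma e_bound: "\<exists>C>0. \<exists>x1\<ge>x0. \<forall>x\<ge>x1. \<bar>e x\<bar> \<le> C * ln x powr (\<gamma> - 1)"
proof -
  have "eventually (\<lambda>x. \<bar>e x * ln x powr (1 - \<gamma>) - (1 - \<gamma>) * ln x powr (- \<gamma>) - \<kappa>\<bar> < 1) at_top"
    using tendstoD[OF e_lim, of 1] by (simp add: dist_real_def)
  moreover have "eventually (\<lambda>x::real. ln x \<ge> 1) at_top" by real_asymp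
  ultimately have "eventually (\<lambda>x. x \<ge> x0 \<and> \<bar>e x\<bar> \<le> (\<kappa> + 2) * ln x powr (\<gamma> - 1)) at_top"
    using eventually_ge_at_top[of x0]
  proof eventually_elim
    case (elim x)
    have "ln x powr (-\<gamma>) \<le> ln x powr 0" using elim gamma by (intro powr_mono) auto
    hence "\<bar>(1 - \<gamma>) * ln x powr (- \<gamma>)\<bar> \<le> 1" using elim gamma
      by (auto simp: abs_mult intro!: mult_le_one)
    hence *: "\<bar>e x * ln x powr (1 - \<gamma>)\<bar> \<le> \<kappa> + 2" using elim kappa by linarith
    have "e x = (e x * ln x powr (1 - \<gamma>)) * ln x powr (\<gamma> - 1)"
      using elim by (simp flip: powr_add add: mult.assoc)
    hence "\<bar>e x\<bar> = \<bar>e x * ln x powr (1 - \<gamma>)\<bar> * ln x powr (\<gamma> - 1)"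
      by (metis abs_mult abs_of_nonneg powr_ge_zero)
    also have "\<dots> \<le> (\<kappa> + 2) * ln x powr (\<gamma> - 1)" by (intro mult_right_mono *) auto
    finally show ?case using elim by auto
  qed
  then obtain x1 where "\<And>x. x \<ge> x1 \<Longrightarrow> x \<ge> x0 \<and> \<bar>e x\<bar> \<le> (\<kappa> + 2) * ln x powr (\<gamma> - 1)"
    by (auto simp: eventually_at_top_linorder)
  thus ?thesis using kappa by (intro exI[of _ "\<kappa>+2"] conjI exI[of _ "max x0 x1"]) auto
qed

lemma ln_L_deriv: "x \<ge> x0 \<Longrightarrow> ((\<lambda>x. ln (L x)) has_real_derivative e x / x) (at x)"
  using L_pos[of x] x0 by (auto intro!: derivative_eq_intros L_deriv simp: field_simps)

text \<open>Integrating the logarithmic derivative: on the scale \<open>ln (y / x)\<close> the function \<open>ln L\<close> is Lipschitz with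
  the constant \<open>C * ln x powr (\<gamma> - 1)\<close>, since \<open>ln u powr (\<gamma> - 1)\<close> is decreasing in \<open>u\<close>.\<close>

lemma ln_L_variation: "\<exists>C>0. \<exists>x1\<ge>x0. \<forall>x\<ge>x1. \<forall>y\<ge>x. \<bar>ln (L y) - ln (L x)\<bar> \<le> C * ln x powr (\<gamma> - 1) * ln (y / x)"
proof -
  obtain C x1 where C: "C > 0" "x1 \<ge> x0" "\<And>x. x \<ge> x1 \<Longrightarrow> \<bar>e x\<bar> \<le> C * ln x powr (\<gamma> - 1)"
    using e_bound by blast
  have "\<bar>ln (L y) - ln (L x)\<bar> \<le> C * ln x powr (\<gamma> - 1) * ln (y / x)" if xy: "x \<ge> x1" "y \<ge> x" for x y
  proof -
    define c where "c = C * ln x powr (\<gamma> - 1)"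
    have b: "\<bar>e u\<bar> \<le> c" if "x \<le> u" for u
    proof -
      have "\<bar>e u\<bar> \<le> C * ln u powr (\<gamma> - 1)" using C that xy by auto
      also have "\<dots> \<le> c" unfolding c_def using C that xy x0 gamma
        by (intro mult_left_mono powr_mono2') auto
      finally show ?thesis .
    qed
    have "(\<lambda>u. ln (L u) + c * ln u) x \<le> (\<lambda>u. ln (L u) + c * ln u) y"
    proof (rule DERIV_nonneg_imp_nondecreasing[OF xy(2)])
      fix u assume u: "x \<le> u" "u \<le> y"
      have "((\<lambda>u. ln (L u) + c * ln u) has_real_derivative e u / u + c * (1 / u)) (at u)"
        using u xy C x0 by (intro derivative_intros ln_L_deriv DERIV_cmult DERIV_ln_divide) auto
      hence "((\<lambda>u. ln (L u) + c * ln u) has_real_derivative (e u + c) / u) (at u)"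
        by (simp add: add_divide_distrib)
      moreover have "(e u + c) / u \<ge> 0" using b[of u] u xy C x0 by auto
      ultimately show "\<exists>y. ((\<lambda>u. ln (L u) + c * ln u) has_real_derivative y) (at u) \<and> 0 \<le> y" by blast
    qed
    moreover have "(\<lambda>u. ln (L u) - c * ln u) y \<le> (\<lambda>u. ln (L u) - c * ln u) x"
    proof (rule DERIV_nonpos_imp_nonincreasing[OF xy(2)])
      fix u assume u: "x \<le> u" "u \<le> y"
      have "((\<lambda>u. ln (L u) - c * ln u) has_real_derivative e u / u - c * (1 / u)) (at u)"
        using u xy C x0 by (intro derivative_intros ln_L_deriv DERIV_cmult DERIV_ln_divide) auto
      hence "((\<lambda>u. ln (L u) - c * ln u) has_real_derivative (e u - c) / u) (at u)"
        by (simp add: diff_divide_distrib)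
      moreover have "(e u - c) / u \<le> 0" using b[of u] u xy C x0 by (intro divide_nonpos_pos) auto
      ultimately show "\<exists>y. ((\<lambda>u. ln (L u) - c * ln u) has_real_derivative y) (at u) \<and> y \<le> 0" by blast
    qed
    moreover have "ln (y / x) = ln y - ln x" using xy C x0 by (intro ln_divide_pos) auto
    ultimately show ?thesis unfolding c_def[symmetric] by (auto simp: right_diff_distrib abs_le_iff)
  qed
  thus ?thesis using C by blast
qed

text \<open>A uniform form of slow variation. It covers factors \<open>w / z\<close> that are powers of \<open>ln z\<close>, as they occur
  in the large-deviation estimate, and not only constant factors. When \<open>w\<close> is the smaller one,
  \<open>lim\<close> still gives \<open>ln w \<ge> ln z / 2\<close>, so the Lipschitz constants at \<open>w\<close> and \<open>z\<close> are comparable.\<close>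

lemma L_ratio_tendsto_1:
  assumes z: "filterlim z at_top F" and w: "filterlim w at_top F"
    and lim: "((\<lambda>i. ln (w i / z i) * ln (z i) powr (\<gamma> - 1)) \<longlongrightarrow> 0) F"
  shows "((\<lambda>i. L (w i) / L (z i)) \<longlongrightarrow> 1) F"
proof -
  obtain C x1 where C: "C > 0" "x1 \<ge> x0"
    "\<And>x y. x \<ge> x1 \<Longrightarrow> y \<ge> x \<Longrightarrow> \<bar>ln (L y) - ln (L x)\<bar> \<le> C * ln x powr (\<gamma> - 1) * ln (y / x)"
    using ln_L_variation by blast
  have zb: "eventually (\<lambda>i. z i \<ge> max x1 (exp 2)) F" using z unfolding filterlim_at_top by blast
  have wb: "eventually (\<lambda>i. w i \<ge> max x1 (exp 2)) F" using w unfolding filterlim_at_top by blast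
  have small: "eventually (\<lambda>i. \<bar>ln (w i / z i) * ln (z i) powr (\<gamma> - 1)\<bar> < 1/2) F"
    using tendstoD[OF lim, of "1/2"] by (simp add: dist_real_def)
  have "eventually (\<lambda>i. norm (ln (L (w i) / L (z i))) \<le> C * 2 * \<bar>ln (w i / z i) * ln (z i) powr (\<gamma> - 1)\<bar>) F"
    using zb wb small
  proof eventually_elim
    case (elim i)
    have l2: "ln (z i) \<ge> 2" "ln (w i) \<ge> 2" 

      using elim exp_gt_zero[of "2::real"] by (metis ln_ge_iff less_le_trans max.bounded_iff)+
    have p: "z i > 0" "w i > 0" using elim C x0 by auto
    have lnq: "ln (w i / z i) = ln (w i) - ln (z i)" "ln (z i / w i) = ln (z i) - ln (w i)" using p by (auto intro!: ln_divide_pos)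
    have LL: "ln (L (w i) / L (z i)) = ln (L (w i)) - ln (L (z i))"
      using elim C L_pos by (intro ln_divide_pos) auto
    show ?case
    proof (cases "z i \<le> w i")
      case True
      have "\<bar>ln (L (w i)) - ln (L (z i))\<bar> \<le> C * ln (z i) powr (\<gamma> - 1) * ln (w i / z i)"
        using C True elim by auto
      moreover have "0 \<le> C * \<bar>ln (w i / z i) * ln (z i) powr (\<gamma> - 1)\<bar>" using C by auto
      moreover have "C * ln (z i) powr (\<gamma> - 1) * ln (w i / z i) \<le> C * \<bar>ln (w i / z i) * ln (z i) powr (\<gamma> - 1)\<bar>"
        using C by (simp add: mult.assoc mult.commute[of "ln (z i) powr _"])
      ultimately show ?thesis by (simp add: LL)
    next
      case False
      have "ln (z i) powr (\<gamma> - 1) = ln (z i) powr (-1) * ln (z i) powr \<gamma>" using powr_add[of "ln (z i)" "-1" \<gamma>] by (simp add: algebra_simps)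
      moreover have "ln (z i) powr \<gamma> \<ge> 1" using l2 gamma by (intro ge_one_powr_ge_zero) auto
      ultimately have "ln (z i) powr (-1) \<le> ln (z i) powr (\<gamma> - 1)"
        using mult_left_mono[of 1 "ln (z i) powr \<gamma>" "ln (z i) powr (-1)"] by auto
      hence "\<bar>ln (w i / z i)\<bar> * ln (z i) powr (-1) \<le> \<bar>ln (w i / z i)\<bar> * ln (z i) powr (\<gamma> - 1)"
        by (intro mult_left_mono) auto
      also have "\<dots> < 1/2" using elim by (simp add: abs_mult)
      finally have "\<bar>ln (w i / z i)\<bar> < ln (z i) / 2" using l2 by (simp add: powr_minus_divide field_simps)
      hence h: "ln (w i) \<ge> ln (z i) / 2" unfolding lnq by linarith
      have "ln (w i) powr (\<gamma> - 1) \<le> (ln (z i) / 2) powr (\<gamma> - 1)"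
        using h l2 gamma by (intro powr_mono2') auto
      also have "\<dots> = ln (z i) powr (\<gamma> - 1) * 2 powr (1 - \<gamma>)"
        using l2 by (simp add: powr_divide powr_diff field_simps)
      also have "\<dots> \<le> ln (z i) powr (\<gamma> - 1) * 2 powr 1" using gamma by (intro mult_left_mono powr_mono) auto
      finally have h2: "ln (w i) powr (\<gamma> - 1) \<le> 2 * ln (z i) powr (\<gamma> - 1)" by simp
      have lz: "ln (z i / w i) = \<bar>ln (w i / z i)\<bar>" using False p unfolding lnq by (auto simp: ln_less_cancel_iff)
      have "\<bar>ln (L (w i)) - ln (L (z i))\<bar> \<le> C * ln (w i) powr (\<gamma> - 1) * ln (z i / w i)"
        using C(3)[of "w i" "z i"] False elim by (auto simp: abs_minus_commute)
      also have "\<dots> \<le> C * (2 * ln (z i) powr (\<gamma> - 1)) * ln (z i / w i)"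
        using C h2 lz by (intro mult_right_mono mult_left_mono) auto
      finally show ?thesis unfolding LL lz by (simp add: abs_mult mult_ac)
    qed
  qed
  moreover have "((\<lambda>i. C * 2 * \<bar>ln (w i / z i) * ln (z i) powr (\<gamma> - 1)\<bar>) \<longlongrightarrow> 0) F"
    using tendsto_mult[OF tendsto_const[of "C * 2"] tendsto_rabs_zero[OF lim]] by simp
  ultimately have "((\<lambda>i. ln (L (w i) / L (z i))) \<longlongrightarrow> 0) F" by (rule Lim_null_comparison)
  hence "((\<lambda>i. exp (ln (L (w i) / L (z i)))) \<longlongrightarrow> exp 0) F" by (rule tendsto_exp)
  moreover have "eventually (\<lambda>i. exp (ln (L (w i) / L (z i))) = L (w i) / L (z i)) F"
    using zb wb by eventually_elim (use C in \<open>auto intro!: exp_ln divide_pos_pos L_pos\<close>)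
  ultimately have "((\<lambda>i. L (w i) / L (z i)) \<longlongrightarrow> exp 0) F" by (rule Lim_transform_eventually)
  thus ?thesis by simp
qed

lemma L_ratio_const_tendsto_1:
  assumes z: "filterlim z at_top F" and lim: "((\<lambda>i. w i / z i) \<longlongrightarrow> c) F" and c: "c > 0"
  shows "((\<lambda>i. L (w i) / L (z i)) \<longlongrightarrow> 1) F"
proof (rule L_ratio_tendsto_1[OF z])
  show "filterlim w at_top F"
  proof (rule filterlim_at_top_mono[OF filterlim_tendsto_pos_mult_at_top[OF tendsto_const[of "c/2"] _ z]])
    have "eventually (\<lambda>i. w i / z i > c/2) F" using order_tendstoD(1)[OF lim, of "c/2"] c by auto
    moreover have "eventually (\<lambda>i. z i > 0) F" using z by (simp add: filterlim_at_top_dense)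
    ultimately show "eventually (\<lambda>i. c/2 * z i \<le> w i) F" by eventually_elim (auto simp: field_simps)
  qed (use c in auto)
  have "((\<lambda>x::real. ln x powr (\<gamma> - 1)) \<longlongrightarrow> 0) at_top" using gamma by real_asymp
  from filterlim_compose[OF this z] have "((\<lambda>i. ln (z i) powr (\<gamma> - 1)) \<longlongrightarrow> 0) F" .
  moreover have "((\<lambda>i. ln (w i / z i)) \<longlongrightarrow> ln c) F" using c by (intro tendsto_ln lim) auto
  ultimately show "((\<lambda>i. ln (w i / z i) * ln (z i) powr (\<gamma> - 1)) \<longlongrightarrow> 0) F"
    using tendsto_mult by fastforce
qed

text \<open>Far out \<open>ln L\<close> is Lipschitz in \<open>ln x\<close> with constant 1/2. This makes both \<open>x * L x\<close> and \<open>x / L x\<close> grow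
  at least like a square root.\<close>

lemma sqrt_growth: "\<exists>x1\<ge>x0. \<forall>x\<ge>x1. \<forall>y\<ge>x. g y \<ge> sqrt (y / x) * g x \<and> y / L y \<ge> sqrt (y / x) * (x / L x)"
proof -
  obtain C x1 where C: "C > 0" "x1 \<ge> x0"
    "\<And>x y. x \<ge> x1 \<Longrightarrow> y \<ge> x \<Longrightarrow> \<bar>ln (L y) - ln (L x)\<bar> \<le> C * ln x powr (\<gamma> - 1) * ln (y / x)"
    using ln_L_variation by blast
  have "((\<lambda>x::real. C * ln x powr (\<gamma> - 1)) \<longlongrightarrow> 0) at_top" using gamma by real_asymp
  hence "eventually (\<lambda>x. C * ln x powr (\<gamma> - 1) < 1/2) at_top" by (rule order_tendstoD) auto
  then obtain x2 where x2: "\<And>x. x \<ge> x2 \<Longrightarrow> C * ln x powr (\<gamma> - 1) < 1/2" by (auto simp: eventually_at_top_linorder)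
  have "g y \<ge> sqrt (y / x) * g x \<and> y / L y \<ge> sqrt (y / x) * (x / L x)" if "x \<ge> max x1 x2" "y \<ge> x" for x y
  proof -
    have p: "x > 0" "y > 0" "L x > 0" "L y > 0" using that C x0 L_pos by auto
    have l0: "ln (y/x) \<ge> 0" using that p by simp
    have "\<bar>ln (L y) - ln (L x)\<bar> \<le> C * ln x powr (\<gamma> - 1) * ln (y / x)" using C that by auto
    also have "\<dots> \<le> 1/2 * ln (y/x)" using x2[of x] that l0 by (intro mult_right_mono) auto
    finally have *: "\<bar>ln (L y) - ln (L x)\<bar> \<le> 1/2 * ln (y/x)" .
    hence hh: "ln (L y) - ln (L x) \<le> 1/2 * ln (y/x)" "ln (L x) - ln (L y) \<le> 1/2 * ln (y/x)" by linarith+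
    have s: "ln (sqrt (y/x)) = 1/2 * ln (y/x)" using p by (simp add: ln_sqrt)
    have yx: "ln (y/x) = ln y - ln x" using p by (simp add: ln_divide_pos)
    have "ln (sqrt (y / x) * g x) \<le> ln (g y)"
      using p by (simp add: g_def ln_mult_pos s) (use hh yx in linarith)
    moreover have "ln (sqrt (y / x) * (x / L x)) \<le> ln (y / L y)"
      proof -
      have "ln (sqrt (y / x) * (x / L x)) = 1/2 * (ln y - ln x) + (ln x - ln (L x))"
        using p by (subst ln_mult_pos) (auto simp: s yx ln_divide_pos)
      moreover have "ln (y / L y) = ln y - ln (L y)" using p by (simp add: ln_divide_pos)
      ultimately show ?thesis using hh yx by argo
    qed
    ultimately show ?thesis using p by (subst (asm) (1 2) ln_le_cancel_iff) (auto simp: g_def)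
  qed
  thus ?thesis using C(2) by (intro exI[of _ "max x1 x2"]) auto
qed

section \<open>The function g, its inverse and the de Bruijn conjugate\<close>

definition mono_from :: real where
  "mono_from = (SOME mono_from. mono_from \<ge> x0 \<and> (\<forall>x\<ge>mono_from. \<forall>y\<ge>x. g y \<ge> sqrt (y / x) * g x \<and> y / L y \<ge> sqrt (y / x) * (x / L x)))"

lemma mono_from: "mono_from \<ge> x0" "mono_from > 1" "x \<ge> mono_from \<Longrightarrow> y \<ge> x \<Longrightarrow> g y \<ge> sqrt (y / x) * g x"
  "x \<ge> mono_from \<Longrightarrow> y \<ge> x \<Longrightarrow> y / L y \<ge> sqrt (y / x) * (x / L x)"
proof -
  have "mono_from \<ge> x0 \<and> (\<forall>x\<ge>mono_from. \<forall>y\<ge>x. g y \<ge> sqrt (y / x) * g x \<and> y / L y \<ge> sqrt (y / x) * (x / L x))"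
    unfolding mono_from_def by (rule someI_ex[OF sqrt_growth])
  thus "mono_from \<ge> x0" "mono_from > 1" "x \<ge> mono_from \<Longrightarrow> y \<ge> x \<Longrightarrow> g y \<ge> sqrt (y / x) * g x"
    "x \<ge> mono_from \<Longrightarrow> y \<ge> x \<Longrightarrow> y / L y \<ge> sqrt (y / x) * (x / L x)"
    using x0 by auto
qed

lemma g_pos: "x \<ge> x0 \<Longrightarrow> g x > 0" using L_pos[of x] x0 by (simp add: g_def)

lemma g_strict_mono: "x \<ge> mono_from \<Longrightarrow> x < y \<Longrightarrow> g x < g y"
proof -
  assume as: "x \<ge> mono_from" "x < y"
  have "1 * g x < sqrt (y / x) * g x" using as mono_from g_pos[of x] by (intro mult_strict_right_mono) auto
  also have "\<dots> \<le> g y" using as mono_from by auto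
  finally show ?thesis by simp
qed

lemma g_less_iff: "x \<ge> mono_from \<Longrightarrow> y \<ge> mono_from \<Longrightarrow> g x < g y \<longleftrightarrow> x < y"
  using g_strict_mono[of x y] g_strict_mono[of y x] by (metis less_asym linorder_neqE)

lemma scaled_sqrt_at_top: "c > 0 \<Longrightarrow> d > 0 \<Longrightarrow> filterlim (\<lambda>y. sqrt (y / d) * c) at_top at_top" for c d :: real
  by real_asymp

lemma g_at_top: "filterlim g at_top at_top"
proof (rule filterlim_at_top_mono)
  show "eventually (\<lambda>y. sqrt (y / mono_from) * g mono_from \<le> g y) at_top"
    using eventually_ge_at_top[of mono_from] by eventually_elim (use mono_from in auto)
  have "g mono_from > 0" "mono_from > 0" using g_pos[of mono_from] mono_from by auto
  thus "filterlim (\<lambda>y. sqrt (y / mono_from) * g mono_from) at_top at_top" using scaled_sqrt_at_top by blast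
qed

lemma x_div_L_at_top: "filterlim (\<lambda>y. y / L y) at_top at_top"
proof (rule filterlim_at_top_mono)
  show "eventually (\<lambda>y. sqrt (y / mono_from) * (mono_from / L mono_from) \<le> y / L y) at_top"
    using eventually_ge_at_top[of mono_from] by eventually_elim (use mono_from in auto)
  have "mono_from / L mono_from > 0" "mono_from > 0" using L_pos[of mono_from] mono_from by auto
  thus "filterlim (\<lambda>y. sqrt (y / mono_from) * (mono_from / L mono_from)) at_top at_top" using scaled_sqrt_at_top by blast
qed

lemma L_continuous: "continuous_on {x0..} L"
  using L_deriv by (intro continuous_at_imp_continuous_on) (auto intro: DERIV_isCont)

lemma ex_inverse: "t \<ge> g mono_from \<Longrightarrow> \<exists>y\<ge>mono_from. g y = t"
proof -
  assume t: "t \<ge> g mono_from"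
  have "eventually (\<lambda>y. g y \<ge> t \<and> y \<ge> mono_from) at_top"
    using g_at_top by (auto simp: filterlim_at_top eventually_ge_at_top intro!: eventually_conj)
  then obtain y where y: "g y \<ge> t" "y \<ge> mono_from" by (auto simp: eventually_at_top_linorder)
  have "continuous_on {mono_from..y} g" unfolding g_def
    using mono_from by (intro continuous_intros continuous_on_subset[OF L_continuous]) auto
  from IVT'[OF t y this] show ?thesis by auto
qed

text \<open>The inverse of \<open>g\<close> on its monotone branch \<open>[mono_from, \<infinity>)\<close>. The value below the range of that branch
  makes the function monotone, hence measurable, on the whole line.\<close>

definition g_inv :: "real \<Rightarrow> real" where "g_inv t = (if t \<ge> g mono_from then SOME y. y \<ge> mono_from \<and> g y = t else mono_from)"

lemma g_inv: "g_inv t \<ge> mono_from" "t \<ge> g mono_from \<Longrightarrow> g (g_inv t) = t"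
  using someI_ex[OF ex_inverse[of t, unfolded Bex_def]] unfolding g_inv_def by auto

lemma g_inv_g: "y \<ge> mono_from \<Longrightarrow> g_inv (g y) = y"
proof -
  assume y: "y \<ge> mono_from"
  have "g y \<ge> g mono_from" using y g_strict_mono[of mono_from y] by (cases "y = mono_from") auto
  hence "g (g_inv (g y)) = g y" by (rule g_inv)
  thus ?thesis using g_less_iff[of y "g_inv (g y)"] g_less_iff[of "g_inv (g y)" y] y g_inv by fastforce
qed

lemma g_inv_mono: "mono g_inv"
proof
  fix s t :: real assume st: "s \<le> t"
  show "g_inv s \<le> g_inv t"
  proof (cases "s \<ge> g mono_from")
    case True
    hence "g (g_inv s) = s" "g (g_inv t) = t" using st g_inv by auto
    thus ?thesis using g_less_iff[of "g_inv t" "g_inv s"] st g_inv by fastforce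
  qed (use g_inv in \<open>auto simp: g_inv_def\<close>)
qed

lemma g_inv_measurable [measurable]: "g_inv \<in> borel_measurable borel"
  using g_inv_mono by (rule borel_measurable_mono)

lemma g_inv_at_top: "filterlim g_inv at_top at_top"
  unfolding filterlim_at_top
proof
  fix Z
  show "eventually (\<lambda>t. Z \<le> g_inv t) at_top"
    using eventually_ge_at_top[of "g (max Z mono_from)"]
  proof eventually_elim
    case (elim t)
    have "g_inv (g (max Z mono_from)) = max Z mono_from" by (rule g_inv_g) auto
    thus ?case using monoD[OF g_inv_mono elim] by auto
  qed
qed

lemma g_ratio:
  assumes v: "filterlim v at_top F" and "((\<lambda>i. w i / v i) \<longlongrightarrow> c) F" "c > 0"
  shows "((\<lambda>i. g (w i) / g (v i)) \<longlongrightarrow> c) F"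
proof -
  have "((\<lambda>i. (w i / v i) * (L (w i) / L (v i))) \<longlongrightarrow> c * 1) F"
    using assms by (intro tendsto_mult L_ratio_const_tendsto_1) auto
  thus ?thesis by (simp add: g_def field_simps)
qed

text \<open>Regular variation with index 1 passes to the inverse: \<open>u \<ge> d * v\<close> would force
  \<open>g u \<ge> g (d * v)\<close>, which is about \<open>d * g v\<close>.\<close>

lemma ratio_of_g_ratio:
  assumes u: "filterlim u at_top F" and v: "filterlim v at_top F"
    and lim: "((\<lambda>i. g (u i) / g (v i)) \<longlongrightarrow> c) F" and c: "c > 0"
  shows "((\<lambda>i. u i / v i) \<longlongrightarrow> c) F"
proof (rule order_tendstoI)
  have vp: "eventually (\<lambda>i. v i \<ge> mono_from) F" "eventually (\<lambda>i. u i \<ge> mono_from) F" using u v by (auto simp: filterlim_at_top)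
  have big: "eventually (\<lambda>i. d * v i \<ge> mono_from) F" if "d > 0" for d
    using filterlim_tendsto_pos_mult_at_top[OF tendsto_const that v] by (auto simp: filterlim_at_top)
  have d: "((\<lambda>i. g (d * v i) / g (v i)) \<longlongrightarrow> d) F" if "d > 0" for d
    using that v by (intro g_ratio tendsto_eventually) 
      (auto intro: eventually_mono[OF vp(1)] simp: mono_from intro!: eventually_mono[OF vp(1)] dest!: order_trans[OF less_imp_le[OF mono_from(2)]])
  {
    fix d assume "d > c"
    hence "eventually (\<lambda>i. g (u i) / g (v i) < (c + d) / 2) F" "eventually (\<lambda>i. g (d * v i) / g (v i) > (c + d)/2) F"
      using c \<open>d > c\<close> by (intro order_tendstoD[OF lim] order_tendstoD[OF d]; simp)+
    moreover have "eventually (\<lambda>i. d * v i \<ge> mono_from) F" using \<open>d > c\<close> c by (intro big) auto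
    ultimately show "eventually (\<lambda>i. u i / v i < d) F" using vp
    proof eventually_elim
      case (elim i)
      have gp: "g (v i) > 0" using elim mono_from g_pos by auto
      have "g (u i) / g (v i) < g (d * v i) / g (v i)" using elim(1,2) by (rule less_trans)
      hence "u i < d * v i" using gp g_less_iff elim by (simp add: divide_less_cancel)
      thus ?case using elim mono_from by (simp add: divide_less_eq)
    qed
  }
  fix d assume "d < c"
  show "eventually (\<lambda>i. u i / v i > d) F"
  proof (cases "d > 0")
    case True
    have "eventually (\<lambda>i. g (u i) / g (v i) > (c + d) / 2) F" "eventually (\<lambda>i. g (d * v i) / g (v i) < (c + d)/2) F"
      using c True \<open>d < c\<close> by (intro order_tendstoD[OF lim] order_tendstoD[OF d]; simp)+
    with vp big[OF True] show ?thesis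
    proof eventually_elim
      case (elim i)
      have gp: "g (v i) > 0" using elim mono_from g_pos by auto
      have "g (d * v i) / g (v i) < g (u i) / g (v i)" using elim by (meson less_trans)
      hence "d * v i < u i" using gp g_less_iff elim by (simp add: divide_less_cancel)
      thus ?case using elim mono_from by (simp add: less_divide_eq)
    qed
  next
    case False
    show ?thesis using vp by eventually_elim (use False mono_from in \<open>auto intro!: le_less_trans[OF _ divide_pos_pos]\<close>)
  qed
qed

lemma e_lim_0: "(e \<longlongrightarrow> 0) at_top"
proof -
  obtain C z where C: "C > 0" "z \<ge> x0" "\<And>x. x \<ge> z \<Longrightarrow> \<bar>e x\<bar> \<le> C * ln x powr (\<gamma> - 1)"
    using e_bound by blast
  have "eventually (\<lambda>x. norm (e x) \<le> C * ln x powr (\<gamma> - 1)) at_top"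
    using eventually_ge_at_top[of z] by eventually_elim (use C in auto)
  moreover have "((\<lambda>x::real. C * ln x powr (\<gamma> - 1)) \<longlongrightarrow> 0) at_top" using gamma by real_asymp
  ultimately show ?thesis by (rule Lim_null_comparison)
qed

lemma ln_g_ratio: "((\<lambda>x. ln (g x) / ln x) \<longlongrightarrow> 1) at_top"
proof -
  have "((\<lambda>x. ln (L x) / ln x) \<longlongrightarrow> 0) at_top"
  proof (rule lhospital_at_top_at_top)
    show "filterlim (ln :: real \<Rightarrow> real) at_top at_top" by (rule ln_at_top)
    show "eventually (\<lambda>x. 1 / x \<noteq> (0::real)) at_top" using eventually_gt_at_top[of 0] by eventually_elim auto
    show "eventually (\<lambda>x. ((\<lambda>x. ln (L x)) has_real_derivative e x / x) (at x)) at_top"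
      using eventually_ge_at_top[of x0] by eventually_elim (rule ln_L_deriv)
    show "eventually (\<lambda>x. (ln has_real_derivative 1 / x) (at x)) at_top"
      using eventually_gt_at_top[of 0] by eventually_elim (auto intro!: derivative_eq_intros)
    have "eventually (\<lambda>x. e x = e x / x / (1 / x)) at_top"
      using eventually_gt_at_top[of 0] by eventually_elim auto
    thus "((\<lambda>x. e x / x / (1 / x)) \<longlongrightarrow> 0) at_top" using e_lim_0 by (rule Lim_transform_eventually[rotated])
  qed
  hence "((\<lambda>x. 1 + ln (L x) / ln x) \<longlongrightarrow> 1 + 0) at_top" by (intro tendsto_intros)
  moreover have "eventually (\<lambda>x. 1 + ln (L x) / ln x = ln (g x) / ln x) at_top"
    using eventually_ge_at_top[of x0]
  proof eventually_elim
    case (elim x)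
    have "ln (g x) = ln x + ln (L x)" using elim x0 L_pos[of x] by (simp add: g_def ln_mult_pos)
    thus ?case using elim x0 by (simp add: field_simps)
  qed
  ultimately show ?thesis by (auto dest: Lim_transform_eventually)
qed

lemma ln_g_inv_ratio: "((\<lambda>t. ln (g_inv t) / ln t) \<longlongrightarrow> 1) at_top"
proof -
  have "((\<lambda>t. ln (g (g_inv t)) / ln (g_inv t)) \<longlongrightarrow> 1) at_top"
    by (rule filterlim_compose[OF ln_g_ratio g_inv_at_top])
  hence "((\<lambda>t. inverse (ln (g (g_inv t)) / ln (g_inv t))) \<longlongrightarrow> inverse 1) at_top" by (rule tendsto_inverse) auto
  moreover have "eventually (\<lambda>t. inverse (ln (g (g_inv t)) / ln (g_inv t)) = ln (g_inv t) / ln t) at_top"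
    using eventually_ge_at_top[of "g mono_from"] by eventually_elim (simp add: g_inv)
  ultimately have "((\<lambda>t. ln (g_inv t) / ln t) \<longlongrightarrow> inverse 1) at_top" by (rule Lim_transform_eventually)
  thus ?thesis by simp
qed

text \<open>The direct half of Karamata's theorem: the derivative \<open>(1 - e u) / L u\<close> of \<open>u / L u\<close> is at least
  \<open>1 / (2 * L u)\<close> once \<open>e u < 1/2\<close>.\<close>

lemma karamata_truncated:
  "\<exists>x3\<ge>mono_from. \<forall>z\<ge>x3. (\<integral>\<^sup>+u. ennreal (1 / L u) * indicator {x3..z} u \<partial>lborel) \<le> ennreal (2 * (z / L z))"
proof -
  have "eventually (\<lambda>x. e x < 1/2) at_top" by (rule order_tendstoD(2)[OF e_lim_0]) auto
  then obtain y where y: "\<And>x. x \<ge> y \<Longrightarrow> e x < 1/2" by (auto simp: eventually_at_top_linorder)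
  define x3 where "x3 = max y mono_from"
  have x3: "x3 \<ge> mono_from" "\<And>x. x \<ge> x3 \<Longrightarrow> e x < 1/2" using y by (auto simp: x3_def)
  have "(\<integral>\<^sup>+u. ennreal (1 / L u) * indicator {x3..z} u \<partial>lborel) \<le> ennreal (2 * (z / L z))" if z: "z \<ge> x3" for z
  proof -
    have "(\<integral>\<^sup>+u. ennreal (1 / L u) * indicator {x3..z} u \<partial>lborel) \<le>
      (\<integral>\<^sup>+u. ennreal (2 * ((1 - e u) / L u)) * indicator {x3..z} u \<partial>lborel)"
    proof (intro nn_integral_mono)
      fix u
      show "ennreal (1 / L u) * indicator {x3..z} u \<le> ennreal (2 * ((1 - e u) / L u)) * indicator {x3..z} u"
      proof (cases "u \<in> {x3..z}")
        case True
        hence "L u > 0" "e u < 1/2" using x3 mono_from by (auto intro!: L_pos)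
        hence "1 / L u \<le> 2 * ((1 - e u) / L u)" by (simp add: field_simps)
        thus ?thesis using True by (auto intro!: ennreal_leI)
      qed auto
    qed
    also have "\<dots> = ennreal (2 * (z / L z) - 2 * (x3 / L x3))"
    proof (rule nn_integral_FTC_Icc[where F = "\<lambda>u. 2 * (u / L u)"])
      fix u assume "u \<in> {x3..z}" hence u: "x3 \<le> u" "u \<le> z" by auto
      have Lu: "L u > 0" "e u < 1/2" "u > 0" using u x3 mono_from by (auto intro!: L_pos) 
      have "((\<lambda>u. u / L u) has_real_derivative (1 * L u - u * (L u * e u / u)) / (L u * L u)) (at u)"
        using u x3 mono_from Lu by (intro DERIV_divide L_deriv DERIV_ident) auto
      also have "(1 * L u - u * (L u * e u / u)) / (L u * L u) = (1 - e u) / L u"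
        using Lu by (simp add: field_simps)
      finally have "((\<lambda>u. 2 * (u / L u)) has_real_derivative 2 * ((1 - e u) / L u)) (at u)" by (rule DERIV_cmult)
      thus "((\<lambda>u. 2 * (u / L u)) has_real_derivative 2 * ((1 - e u) / L u)) (at u)" .
      show "0 \<le> 2 * ((1 - e u) / L u)" using Lu by auto
    qed (use z in auto)
    also have "\<dots> \<le> ennreal (2 * (z / L z))" 
      using x3 mono_from L_pos[of x3] by (intro ennreal_leI) auto
    finally show ?thesis .
  qed
  thus ?thesis using x3 by blast
qed

text \<open>The function that is integrated is \<open>- c\<close> times the derivative of \<open>tail_D\<close>.\<close>

lemma nn_integral_tail_D_deriv:
  "eventually (\<lambda>z. (\<integral>\<^sup>+u. ennreal (c * ((e u * ln u powr (1 - \<gamma>) - (1 - \<gamma>) * ln u powr (- \<gamma>)) / g u)) * indicator {z..} u \<partial>lborel)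
     = ennreal (c * tail_D z)) at_top" if c: "c \<ge> 0"
proof -
  define q where "q u = e u * ln u powr (1 - \<gamma>) - (1 - \<gamma>) * ln u powr (- \<gamma>)" for u
  have "eventually (\<lambda>u. q u > 0) at_top" unfolding q_def using kappa by (intro order_tendstoD(1)[OF e_lim]) auto
  then obtain y where y: "\<And>x. x \<ge> y \<Longrightarrow> q x > 0" by (auto simp: eventually_at_top_linorder)
  have "(\<integral>\<^sup>+u. ennreal (c * (q u / g u)) * indicator {z..} u \<partial>lborel) = ennreal (c * tail_D z)" if z: "z \<ge> max y x0" for z
  proof -
    have "(\<integral>\<^sup>+u. ennreal (c * (q u / g u)) * indicator {z..} u \<partial>lborel) = ennreal (0 - (- (c * tail_D z)))"
    proof (rule nn_integral_FTC_atLeast)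
      show "(\<lambda>u. c * (q u / g u)) \<in> borel_measurable borel" unfolding q_def g_def by measurable
      fix u assume "z \<le> u"
      hence u: "u \<ge> x0" "q u > 0" "L u > 0" "u > 0" "ln u > 0" using z y x0 L_pos by auto
      have "((\<lambda>u. ln u powr (1 - \<gamma>) / L u) has_real_derivative
         (((1 - \<gamma>) * ln u powr (1 - \<gamma> - 1) * (1 / u)) * L u - ln u powr (1 - \<gamma>) * (L u * e u / u)) / (L u * L u)) (at u)"
      proof (intro DERIV_divide L_deriv)
        show "((\<lambda>u. ln u powr (1 - \<gamma>)) has_real_derivative (1 - \<gamma>) * ln u powr (1 - \<gamma> - 1) * (1 / u)) (at u)"
          
          by (rule DERIV_chain2[OF has_real_derivative_powr DERIV_ln_divide]) (use u in auto)
      qed (use u in auto)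
      also have "(((1 - \<gamma>) * ln u powr (1 - \<gamma> - 1) * (1 / u)) * L u - ln u powr (1 - \<gamma>) * (L u * e u / u)) / (L u * L u) = - (q u / g u)"
        using u by (simp add: q_def g_def divide_simps) (simp add: algebra_simps)
      finally have "((\<lambda>u. c * tail_D u) has_real_derivative c * (- (q u / g u))) (at u)" unfolding tail_D_def by (rule DERIV_cmult)
      from DERIV_minus[OF this]
      show "((\<lambda>u. - (c * tail_D u)) has_real_derivative c * (q u / g u)) (at u)" by simp
      show "0 \<le> c * (q u / g u)" using u c g_pos[of u] by auto
    next
      show "((\<lambda>u. - (c * tail_D u)) \<longlongrightarrow> 0) at_top"
        using tendsto_minus[OF tendsto_mult[OF tendsto_const[of c] D_lim]] by (simp add: tail_D_def)
    qed
    thus ?thesis by simp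
  qed
  thus ?thesis unfolding q_def eventually_at_top_linorder by blast
qed

text \<open>A nonnegative \<open>f\<close> asymptotic to \<open>b / g\<close> is squeezed between multiples of the derivative of \<open>tail_D\<close> with
  factors close to \<open>b / \<kappa>\<close>; integrating the bounds gives the claim.\<close>

lemma integrated_tail:
  fixes f I :: "real \<Rightarrow> real"
  assumes f_nonneg: "\<And>u. f u \<ge> 0"
    and f_lim: "((\<lambda>u. f u * g u) \<longlongrightarrow> b) at_top" and b: "b > 0"
    and I: "eventually (\<lambda>z. I z \<ge> 0 \<and> ennreal (I z) = (\<integral>\<^sup>+u. ennreal (f u) * indicator {z..} u \<partial>lborel)) at_top"
  shows "((\<lambda>z. I z / tail_D z) \<longlongrightarrow> b / \<kappa>) at_top"
proof -
  define q where "q u = e u * ln u powr (1 - \<gamma>) - (1 - \<gamma>) * ln u powr (- \<gamma>)" for u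
  have q_lim: "(q \<longlongrightarrow> \<kappa>) at_top" unfolding q_def by (rule e_lim)
  have q_pos: "eventually (\<lambda>u. q u > 0 \<and> u \<ge> x0) at_top"
    using kappa by (intro eventually_conj order_tendstoD(1)[OF q_lim] eventually_ge_at_top) auto
  have lim: "((\<lambda>u. f u * g u / q u) \<longlongrightarrow> b / \<kappa>) at_top"
    using kappa by (intro tendsto_divide f_lim q_lim) auto
  have D_pos: "eventually (\<lambda>z. tail_D z > 0) at_top"
    using eventually_ge_at_top[of x0] by eventually_elim (use x0 L_pos in \<open>auto simp: tail_D_def\<close>)
  have aux: "eventually (\<lambda>z. (\<integral>\<^sup>+u. ennreal (c * (q u / g u)) * indicator {z..} u \<partial>lborel) = ennreal (c * tail_D z)) at_top"
    if "c \<ge> 0" for c unfolding q_def by (rule nn_integral_tail_D_deriv[OF that])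
  show ?thesis
  proof (rule order_tendstoI)
    fix c assume c: "c > b / \<kappa>"
    define d where "d = (c + b / \<kappa>) / 2"
    have d: "d < c" "d > b / \<kappa>" "d > 0" using c b kappa by (auto simp: d_def add_pos_pos field_simps intro: less_trans)
    have "eventually (\<lambda>u. f u \<le> d * (q u / g u)) at_top"
      using order_tendstoD(2)[OF lim d(2)] q_pos
      by eventually_elim (use g_pos in \<open>auto simp: field_simps dest!: less_imp_le\<close>)
    then obtain y where y: "\<And>u. u \<ge> y \<Longrightarrow> f u \<le> d * (q u / g u)" by (auto simp: eventually_at_top_linorder)
    have "0 \<le> d" using d by simp
    show "eventually (\<lambda>z. I z / tail_D z < c) at_top"
      using eventually_ge_at_top[of y] aux[OF \<open>0 \<le> d\<close>] I D_pos
    proof eventually_elim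
      case (elim z)
      have "ennreal (I z) \<le> (\<integral>\<^sup>+u. ennreal (d * (q u / g u)) * indicator {z..} u \<partial>lborel)"
        unfolding conjunct2[OF elim(3)] using y elim(1)
        by (intro nn_integral_mono) (auto simp: indicator_def intro!: ennreal_leI)
      hence "I z \<le> d * tail_D z" using elim d unfolding elim(2) by (subst (asm) ennreal_le_iff) auto
      also have "\<dots> < c * tail_D z" using d elim by simp
      finally show ?case using elim by (simp add: field_simps)
    qed
  next
    fix c assume c: "c < b / \<kappa>"
    show "eventually (\<lambda>z. I z / tail_D z > c) at_top"
    proof (cases "c < 0")
      case True
      show ?thesis using I D_pos by eventually_elim (use True in \<open>auto intro!: less_le_trans[OF _ divide_nonneg_pos]\<close>)
    next
      case False
      define d where "d = (c + b / \<kappa>) / 2"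
      have d: "d > c" "d < b / \<kappa>" "d > 0" using c False unfolding d_def by argo+
      have "eventually (\<lambda>u. d * (q u / g u) \<le> f u) at_top"
        using order_tendstoD(1)[OF lim d(2)] q_pos
        by eventually_elim (use g_pos in \<open>auto simp: field_simps dest!: less_imp_le\<close>)
      then obtain y where y: "\<And>u. u \<ge> y \<Longrightarrow> d * (q u / g u) \<le> f u" by (auto simp: eventually_at_top_linorder)
      have "0 \<le> d" using d by simp
      show ?thesis
        using eventually_ge_at_top[of y] aux[OF \<open>0 \<le> d\<close>] I D_pos
      proof eventually_elim
        case (elim z)
        have "ennreal (I z) \<ge> (\<integral>\<^sup>+u. ennreal (d * (q u / g u)) * indicator {z..} u \<partial>lborel)"
          unfolding conjunct2[OF elim(3)] using y elim(1)
          by (intro nn_integral_mono) (auto simp: indicator_def intro!: ennreal_leI)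
        hence "I z \<ge> d * tail_D z" using elim d unfolding elim(2) by (subst (asm) ennreal_le_iff) auto
        moreover have "d * tail_D z > c * tail_D z" using d elim by simp
        ultimately have "c * tail_D z < I z" by linarith
        thus ?case using elim by (simp add: field_simps)
      qed
    qed
  qed
qed

lemma bounded_g: "\<exists>B. \<forall>y\<in>{x0..Y}. g y \<le> B"
proof (cases "x0 \<le> Y")
  case True
  have "continuous_on {x0..Y} g" unfolding g_def
    by (intro continuous_intros continuous_on_subset[OF L_continuous]) auto
  from continuous_attains_sup[OF compact_Icc _ this] True show ?thesis by fastforce
qed auto

text \<open>From \<open>g (b x) \<longrightarrow> \<infinity>\<close> alone one cannot conclude that \<open>b x\<close> is large, because \<open>L\<close> may be unbounded near 1.
  But if \<open>b x\<close> were small for some large \<open>x\<close>, then \<open>b (2 ^ k * x)\<close> would grow with \<open>k\<close> by factors between 3/2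
  and 3, and would have to visit a compact interval on which \<open>g\<close> is bounded.\<close>

lemma doubling_at_top:
  fixes b :: "real \<Rightarrow> real"
  assumes pos: "eventually (\<lambda>x. b x > 0) at_top"
    and dbl: "((\<lambda>x. b (2 * x) / b x) \<longlongrightarrow> 2) at_top"
    and gb: "filterlim (\<lambda>x. g (b x)) at_top at_top"
  shows "filterlim b at_top at_top"
  unfolding filterlim_at_top
proof
  fix Z :: real
  define Y where "Y = max Z x0"
  obtain B where B: "\<And>y. x0 \<le> y \<Longrightarrow> y \<le> 3 * Y \<Longrightarrow> g y \<le> B" using bounded_g[of "3*Y"] by (metis atLeastAtMost_iff)
  have Y: "Y \<ge> x0" "Y \<ge> Z" "Y > 0" using x0 by (auto simp: Y_def)
  have "eventually (\<lambda>x. b x > 0 \<and> b (2*x) / b x > 3/2 \<and> b (2*x) / b x < 3 \<and> g (b x) > B \<and> x > 0) at_top"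
    using gb by (intro eventually_conj pos order_tendstoD[OF dbl] eventually_gt_at_top)
     (auto simp: filterlim_at_top_dense)
  then obtain X where X: "\<And>x. x \<ge> X \<Longrightarrow> b x > 0 \<and> b (2*x) / b x > 3/2 \<and> b (2*x) / b x < 3 \<and> g (b x) > B \<and> x > 0"
    by (auto simp: eventually_at_top_linorder)
  have "b x \<ge> Z" if x: "x \<ge> X" for x
  proof (rule ccontr)
    assume "\<not> b x \<ge> Z"
    hence "b x \<le> 3 * Y" using Y by linarith
    hence 0: "b x < x0" using B[of "b x"] X[OF x] by force
    \<comment> \<open>\<open>b\<close> stays below \<open>x0\<close> along the doubling sequence, as it cannot jump over \<open>[x0, 3 * Y]\<close>.\<close>
    have step: "2 ^ k * x \<ge> X \<and> b (2 ^ k * x) < x0 \<and> b (2 ^ k * x) \<ge> (3/2) ^ k * b x" for k :: nat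
    proof (induction k)
      case (Suc k)
      define y where "y = 2 ^ k * x"
      have y: "y \<ge> X" "b y < x0" "b y \<ge> (3/2) ^ k * b x" using Suc by (auto simp: y_def)
      have y2: "2 * y \<ge> X" using y X[of y] by auto
      have "b (2 * y) < 3 * b y" "b (2 * y) > 3/2 * b y" using X[OF y(1)] by (auto simp: field_simps)
      moreover have "b (2 * y) < x0"
      proof (rule ccontr)
        assume "\<not> b (2 * y) < x0"
        hence "g (b (2 * y)) \<le> B" using \<open>b (2 * y) < 3 * b y\<close> y Y by (intro B) auto
        thus False using X[OF y2] by auto
      qed
      moreover have "3/2 * b y \<ge> (3/2) ^ Suc k * b x" using y by (simp add: mult_ac)
      ultimately show ?case using y2 unfolding y_def by (simp add: mult_ac)
    qed (use x 0 in auto)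
    have "filterlim (\<lambda>k. (3/2) ^ k * b x :: real) at_top sequentially"
      by (rule filterlim_at_top_mult_tendsto_pos[OF tendsto_const]) (use X[OF x] in blast, real_asymp)
    hence "eventually (\<lambda>k. (3/2) ^ k * b x \<ge> x0) sequentially" by (auto simp: filterlim_at_top)
    then obtain k where "(3/2) ^ k * b x \<ge> x0" by (auto simp: eventually_sequentially)
    thus False using step[of k] by auto
  qed
  thus "eventually (\<lambda>x. Z \<le> b x) at_top" unfolding eventually_at_top_linorder by blast
qed

text \<open>With \<open>b x = x * Ld x\<close>, the defining property of the conjugate reads \<open>g (b x) \<sim> x = g (g_inv x)\<close>.\<close>

lemma conjugate_unique:
  assumes "de_bruijn_conjugate L Ld"
  shows "((\<lambda>x. (g_inv x / x) / Ld x) \<longlongrightarrow> 1) at_top"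
proof -
  obtain y where y: "\<And>x. x \<ge> y \<Longrightarrow> Ld x > 0"
    using assms by (auto simp: de_bruijn_conjugate_def slowly_varying_def)
  hence Ld_pos: "eventually (\<lambda>x. Ld x > 0) at_top" by (auto simp: eventually_at_top_linorder)
  have sv: "((\<lambda>x. Ld (2 * x) / Ld x) \<longlongrightarrow> 1) at_top" and lim: "((\<lambda>x. L (x * Ld x) * Ld x) \<longlongrightarrow> 1) at_top"
    using assms by (auto simp: de_bruijn_conjugate_def slowly_varying_def)
  define b where "b x = x * Ld x" for x
  have gb: "g (b x) = x * (L (x * Ld x) * Ld x)" for x by (simp add: g_def b_def)
  have gb_top: "filterlim (\<lambda>x. g (b x)) at_top at_top" unfolding gb
    by (rule filterlim_at_top_mult_tendsto_pos[OF lim]) (auto simp: filterlim_ident)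
  have b_top: "filterlim b at_top at_top"
  proof (rule doubling_at_top[OF _ _ gb_top])
    show "eventually (\<lambda>x. b x > 0) at_top" using Ld_pos eventually_gt_at_top[of 0]
      by eventually_elim (auto simp: b_def)
    have "((\<lambda>x. 2 * (Ld (2 * x) / Ld x)) \<longlongrightarrow> 2 * 1) at_top" by (intro tendsto_intros sv)
    moreover have "eventually (\<lambda>x. 2 * (Ld (2 * x) / Ld x) = b (2 * x) / b x) at_top"
      using eventually_gt_at_top[of 0] by eventually_elim (auto simp: b_def)
    ultimately show "((\<lambda>x. b (2 * x) / b x) \<longlongrightarrow> 2) at_top" by (auto dest: Lim_transform_eventually)
  qed
  have "((\<lambda>x. b x / g_inv x) \<longlongrightarrow> 1) at_top"
  proof (rule ratio_of_g_ratio[OF b_top g_inv_at_top])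
    have "eventually (\<lambda>x. L (x * Ld x) * Ld x = g (b x) / g (g_inv x)) at_top"
      using eventually_ge_at_top[of "g mono_from"] eventually_gt_at_top[of 0]
      by eventually_elim (simp add: g_inv gb)
    thus "((\<lambda>x. g (b x) / g (g_inv x)) \<longlongrightarrow> 1) at_top" using lim by (auto dest: Lim_transform_eventually)
  qed auto
  hence "((\<lambda>x. inverse (b x / g_inv x)) \<longlongrightarrow> inverse 1) at_top" by (rule tendsto_inverse) auto
  thus ?thesis by (simp add: b_def field_simps)
qed

text \<open>Everything asymptotically equivalent to \<open>g_inv x / x\<close> is a conjugate. The freedom is used to absorb
  the error of the centring.\<close>

lemma conjugateI:
  assumes meas: "Ld \<in> borel_measurable borel"
    and lim: "((\<lambda>x. Ld x / (g_inv x / x)) \<longlongrightarrow> 1) at_top"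
  shows "de_bruijn_conjugate L Ld"
proof -
  have ap: "g_inv x > 0" for x using g_inv(1)[of x] mono_from(2) by linarith
  have "eventually (\<lambda>x. Ld x / (g_inv x / x) > 0 \<and> x > 0) at_top" using order_tendstoD(1)[OF lim, of 0] eventually_gt_at_top by (intro eventually_conj) auto
  then obtain y where "\<And>x. x \<ge> y \<Longrightarrow> Ld x / (g_inv x / x) > 0 \<and> x > 0" by (auto simp: eventually_at_top_linorder)
  hence y: "\<And>x. x \<ge> y \<Longrightarrow> Ld x > 0" using ap by (metis divide_pos_pos zero_less_divide_iff less_asym)
  have sv: "((\<lambda>x. Ld (c * x) / Ld x) \<longlongrightarrow> 1) at_top" if c: "c > 0" for c
  proof -
    have cx: "filterlim (\<lambda>x. c * x) at_top at_top" using c by real_asymp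
    have "((\<lambda>x. g_inv (c * x) / g_inv x) \<longlongrightarrow> c) at_top"
    proof (rule ratio_of_g_ratio[OF filterlim_compose[OF g_inv_at_top cx] g_inv_at_top _ c])
      have "eventually (\<lambda>x. c * x \<ge> g mono_from) at_top" using cx unfolding filterlim_at_top by blast
      hence "eventually (\<lambda>x. c = g (g_inv (c * x)) / g (g_inv x)) at_top"
        using eventually_ge_at_top[of "g mono_from"] eventually_gt_at_top[of 0] by eventually_elim (simp add: g_inv)
      thus "((\<lambda>x. g (g_inv (c * x)) / g (g_inv x)) \<longlongrightarrow> c) at_top" by (rule Lim_transform_eventually[rotated]) auto
    qed
    hence "((\<lambda>x. (Ld (c * x) / (g_inv (c * x) / (c * x))) / (Ld x / (g_inv x / x)) * (g_inv (c * x) / g_inv x / c)) \<longlongrightarrow> 1 / 1 * (c / c)) at_top"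
      using c by (intro tendsto_intros filterlim_compose[OF lim cx] lim) auto
    moreover have "eventually (\<lambda>x. (Ld (c * x) / (g_inv (c * x) / (c * x))) / (Ld x / (g_inv x / x)) * (g_inv (c * x) / g_inv x / c) = Ld (c * x) / Ld x) at_top"
      using eventually_gt_at_top[of 0] 
    proof eventually_elim
      case (elim x)
      have "g_inv x \<noteq> 0" "g_inv (c * x) \<noteq> 0" using ap[of x] ap[of "c*x"] by auto
      thus ?case using elim c by simp
    qed
    ultimately show ?thesis using c by (auto dest: Lim_transform_eventually)
  qed
  have L1: "((\<lambda>x. L (x * Ld x) / L (g_inv x)) \<longlongrightarrow> 1) at_top"
    by (rule L_ratio_const_tendsto_1[OF g_inv_at_top, of _ 1]) (use lim in \<open>simp_all add: field_simps\<close>)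
  have "((\<lambda>x. (L (x * Ld x) / L (g_inv x)) * (Ld x / (g_inv x / x))) \<longlongrightarrow> 1 * 1) at_top"
    by (intro tendsto_mult L1 lim)
  moreover have "eventually (\<lambda>x. (L (x * Ld x) / L (g_inv x)) * (Ld x / (g_inv x / x)) = L (x * Ld x) * Ld x) at_top"
    using eventually_ge_at_top[of "g mono_from"] eventually_gt_at_top[of 0]
  proof eventually_elim
    case (elim x)
    have "x = g_inv x * L (g_inv x)" using g_inv(2)[OF elim(1)] by (simp add: g_def)
    moreover have "L (g_inv x) > 0" using g_inv(1)[of x] mono_from(1) by (intro L_pos) auto
    ultimately show ?case using ap[of x] elim by (simp add: field_simps)
  qed
  ultimately have c1: "((\<lambda>x. L (x * Ld x) * Ld x) \<longlongrightarrow> 1) at_top" by (auto dest: Lim_transform_eventually)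
  have "((\<lambda>x. Ld (g x) / (g_inv (g x) / g x)) \<longlongrightarrow> 1) at_top" by (rule filterlim_compose[OF lim g_at_top])
  moreover have "eventually (\<lambda>x. Ld (g x) / (g_inv (g x) / g x) = Ld (x * L x) * L x) at_top"
    using eventually_ge_at_top[of mono_from]
  proof eventually_elim
    case (elim x)
    thus ?case using g_inv_g[OF elim] mono_from by (simp add: g_def field_simps)
  qed
  ultimately have c2: "((\<lambda>x. Ld (x * L x) * L x) \<longlongrightarrow> 1) at_top" by (auto dest: Lim_transform_eventually)
  show ?thesis unfolding de_bruijn_conjugate_def slowly_varying_def
    using c1 c2 sv y meas by (auto intro: measurable_restrict_space1)
qed

end

section \<open>Tail integrals and truncated moments\<close>

lemma (in real_distribution) layer_cake_nn:
  fixes h :: "real \<Rightarrow> ennreal"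
  assumes [measurable]: "h \<in> borel_measurable borel"
  shows "(\<integral>\<^sup>+x. (\<integral>\<^sup>+y. h y * indicator {..<x} y \<partial>lborel) \<partial>M) = (\<integral>\<^sup>+y. h y * emeasure M {y<..} \<partial>lborel)"
proof -
  interpret P: pair_sigma_finite M lborel ..
  have [measurable]: "(\<lambda>p. h (snd p) * indicator {p. snd p < fst p} p) \<in> borel_measurable (M \<Otimes>\<^sub>M lborel)"
    by measurable
  have eq: "h y * indicator {..<x} y = h (snd (x, y)) * indicator {p. snd p < fst p} (x, y)" for x y
    by (auto simp: indicator_def)
  have "(\<integral>\<^sup>+x. (\<integral>\<^sup>+y. h y * indicator {..<x} y \<partial>lborel) \<partial>M) = (\<integral>\<^sup>+y. (\<integral>\<^sup>+x. h y * indicator {..<x} y \<partial>M) \<partial>lborel)"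
    unfolding eq by (rule P.Fubini'[symmetric]) measurable
  also have "\<dots> = (\<integral>\<^sup>+y. h y * emeasure M {y<..} \<partial>lborel)"
  proof (intro nn_integral_cong)
    fix y
    have "(\<integral>\<^sup>+x. h y * indicator {..<x} y \<partial>M) = (\<integral>\<^sup>+x. h y * indicator {y<..} x \<partial>M)"
      by (intro nn_integral_cong) (auto simp: indicator_def)
    also have "\<dots> = h y * emeasure M {y<..}" by (simp add: nn_integral_cmult)
    finally show "(\<integral>\<^sup>+x. h y * indicator {..<x} y \<partial>M) = h y * emeasure M {y<..}" .
  qed
  finally show ?thesis .
qed

text \<open>The signed version of the layer cake formula, for the increment of \<open>H\<close> across a window \<open>[l, u]\<close>. The
  inner integrals agree with the fundamental theorem of calculus up to the single point \<open>x / s\<close>.\<close>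

lemma (in real_distribution) layer_cake_interval:
  fixes H h :: "real \<Rightarrow> real"
  assumes deriv: "\<And>x. x \<in> {l..u} \<Longrightarrow> (H has_real_derivative h x) (at x)"
    and cont: "\<And>x. x \<in> {l..u} \<Longrightarrow> isCont h x" and lu: "l \<le> u" and [measurable]: "h \<in> borel_measurable borel"
    and s: "s > 0"
  shows "(LINT x|M. H (min (x / s) u) - H (min (x / s) l)) =
    (LBINT y. indicator {l..u} y * h y * measure M {s * y<..})"
proof -
  interpret P: pair_sigma_finite M lborel ..
  have "compact (h ` {l..u})" using cont by (intro compact_continuous_image continuous_at_imp_continuous_on) auto
  hence "bounded (h ` {l..u})" by (rule compact_imp_bounded)
  then obtain B where B: "\<And>y. y \<in> {l..u} \<Longrightarrow> \<bar>h y\<bar> \<le> B" unfolding bounded_iff by (metis imageI real_norm_def)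
  let ?k = "\<lambda>x y. indicator {l..u} y * h y * indicator {p. s * snd p < fst p} (x, y) :: real"
  have inner: "H (min (x / s) u) - H (min (x / s) l) = (LBINT y. ?k x y)" for x
  proof (cases "x / s \<le> l")
    case True
    have "?k x y = 0" for y
    proof (cases "l \<le> y")
      case lt: True
      have "x \<le> s * l" using True s by (simp add: field_simps)
      also have "s * l \<le> s * y" using lt s by (intro mult_left_mono) auto
      finally show ?thesis by (simp add: indicator_def)
    qed (simp add: indicator_def)
    hence "(LBINT y. ?k x y) = (LBINT y::real. 0)" by (intro Bochner_Integration.integral_cong) auto
    thus ?thesis using True lu by simp
  next
    case False
    define m where "m = min (x / s) u"
    have m: "l \<le> m" "m \<le> u" using False lu by (auto simp: m_def)
    have "(LBINT y. ?k x y) = (LBINT y. h y * indicator {l..m} y)"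
    proof (rule integral_cong_AE)
      show "AE y in lborel. ?k x y = h y * indicator {l..m} y"
        using AE_lborel_singleton[of "x / s"] 
        by eventually_elim (use s in \<open>auto simp: indicator_def m_def field_simps\<close>)
    qed measurable
    also have "\<dots> = H m - H l" by (rule integral_FTC_Icc_real) (use m deriv cont in auto)
    finally show ?thesis using False by (simp add: m_def)
  qed
  have int: "integrable (M \<Otimes>\<^sub>M lborel) (\<lambda>p. indicator (UNIV \<times> {l..u}) p *\<^sub>R (h (snd p) * indicator {p. s * snd p < fst p} p))"
  proof (rule integrableI_bounded_set_indicator[where B = B])
    show "emeasure (M \<Otimes>\<^sub>M lborel) (UNIV \<times> {l..u}) < \<infinity>"
      using lu emeasure_space_1 by (subst lborel.emeasure_pair_measure_Times) (auto simp: emeasure_lborel_Icc_eq)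
    show "AE p in M \<Otimes>\<^sub>M lborel. p \<in> UNIV \<times> {l..u} \<longrightarrow> norm (h (snd p) * indicator {p. s * snd p < fst p} p) \<le> B"
      using B order_trans[OF abs_ge_zero B[of l]] lu by (intro AE_I2) (auto simp: indicator_def)
  qed (measurable)
  have k_eq: "?k x y = indicator (UNIV \<times> {l..u}) (x, y) *\<^sub>R (h (snd (x, y)) * indicator {p. s * snd p < fst p} (x, y))" for x y
    by (auto simp: indicator_def)
  have "(LINT x|M. H (min (x / s) u) - H (min (x / s) l)) = (LINT x|M. (LBINT y. ?k x y))"
    by (simp only: inner)
  also have "\<dots> = (LBINT y. (LINT x|M. ?k x y))"
    unfolding k_eq by (rule P.Fubini_integral[symmetric]) (use int in \<open>simp add: split_beta'\<close>)
  also have "\<dots> = (LBINT y. indicator {l..u} y * h y * measure M {s * y<..})"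
  proof (rule Bochner_Integration.integral_cong)
    fix y
    have "(LINT x|M. ?k x y) = (LINT x|M. (indicator {l..u} y * h y) * indicator {s * y<..} x)"
      by (intro Bochner_Integration.integral_cong) (auto simp: indicator_def)
    also have "\<dots> = indicator {l..u} y * h y * measure M {s * y<..}" by simp
    finally show "(LINT x|M. ?k x y) = indicator {l..u} y * h y * measure M {s * y<..}" .
  qed auto
  finally show ?thesis .
qed

text \<open>The distribution of one observation. Its tail is normalised as for the Cauchy limit law.\<close>

locale heavy_tail = slow_variation L e \<gamma> \<kappa> x0 + F: real_distribution F
  for L e \<gamma> \<kappa> x0 F +
  assumes pos: "AE x in F. 0 < x"
    and integ: "integrable F (\<lambda>x. x)"
    and tail: "((\<lambda>x. measure F {x<..} * g x) \<longlongrightarrow> 2 / pi) at_top"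
begin

abbreviation Fbar :: "real \<Rightarrow> real" where "Fbar x \<equiv> measure F {x<..}"
definition trunc_square :: "real \<Rightarrow> real" where "trunc_square z = (LINT x|F. (min x z)\<^sup>2)"
definition excess :: "real \<Rightarrow> real" where "excess z = (LINT x|F. max 0 (x - z))"
definition K :: real where "K = 2 / (pi * \<kappa>)"

lemma K_pos: "K > 0" using kappa by (simp add: K_def)

lemma Fbar_antimono: "x \<le> y \<Longrightarrow> Fbar y \<le> Fbar x" by (intro F.finite_measure_mono) auto

lemma Fbar_measurable [measurable]: "Fbar \<in> borel_measurable borel"
proof -
  have "mono (\<lambda>x. - Fbar x)" by (intro monoI) (simp add: Fbar_antimono)
  hence "(\<lambda>x. - Fbar x) \<in> borel_measurable borel" by (rule borel_measurable_mono)
  hence "(\<lambda>x. - (- Fbar x)) \<in> borel_measurable borel" by (rule borel_measurable_uminus)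
  thus ?thesis by simp
qed

lemma excess_nonneg: "excess z \<ge> 0" unfolding excess_def by (intro integral_nonneg_AE) auto

lemma excess_integrable: "integrable F (\<lambda>x. max 0 (x - z))"
  by (intro integrable_max integ Bochner_Integration.integrable_diff) auto

text \<open>The layer cake formula with the indicator function of \<open>[z, \<infinity>)\<close> as the weight.\<close>

lemma excess_eq: "ennreal (excess z) = (\<integral>\<^sup>+u. ennreal (Fbar u) * indicator {z..} u \<partial>lborel)"
proof -
  have "ennreal (excess z) = (\<integral>\<^sup>+x. ennreal (max 0 (x - z)) \<partial>F)"
    unfolding excess_def by (intro nn_integral_eq_integral[symmetric] excess_integrable) auto
  also have "\<dots> = (\<integral>\<^sup>+x. (\<integral>\<^sup>+y. indicator {z..} y * indicator {..<x} y \<partial>lborel) \<partial>F)"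
  proof (intro nn_integral_cong)
    fix x
    have "(\<integral>\<^sup>+y. indicator {z..} y * indicator {..<x} y \<partial>lborel) = (\<integral>\<^sup>+y. indicator {z..<x} y \<partial>lborel)"
      by (intro nn_integral_cong) (auto simp: indicator_def)
    also have "\<dots> = ennreal (max 0 (x - z))" by (cases "z \<le> x") auto
    finally show "ennreal (max 0 (x - z)) = (\<integral>\<^sup>+y. indicator {z..} y * indicator {..<x} y \<partial>lborel)" by simp
  qed
  also have "\<dots> = (\<integral>\<^sup>+y. indicator {z..} y * emeasure F {y<..} \<partial>lborel)"
    by (rule F.layer_cake_nn) auto
  finally show ?thesis by (simp add: F.emeasure_eq_measure mult.commute)
qed

lemma excess_asymp: "((\<lambda>z. excess z / tail_D z) \<longlongrightarrow> K) at_top"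
  using integrated_tail[of Fbar "2/pi" excess] tail excess_nonneg excess_eq by (simp add: K_def)

lemma min_sq_integrable: "integrable F (\<lambda>x. (min x z)\<^sup>2)" if "z \<ge> 0" 
proof (rule F.integrable_const_bound[where B = "z\<^sup>2"])
  show "AE x in F. norm ((min x z)\<^sup>2) \<le> z\<^sup>2" using pos by eventually_elim (use that in \<open>auto intro!: power_mono\<close>)
qed auto

text \<open>By the layer cake formula the truncated second moment is the integral of \<open>2 * y * Fbar y\<close>, and
  \<open>y * Fbar y\<close> is at most \<open>1 / L y\<close> far out, since \<open>2 / pi < 1\<close>; the rest is Karamata's theorem.\<close>

lemma trunc_square_bound: "\<exists>C>0. eventually (\<lambda>z. trunc_square z \<le> C * (z / L z)) at_top"
proof -
  obtain x3 where x3: "x3 \<ge> mono_from"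
    "\<And>z. z \<ge> x3 \<Longrightarrow> (\<integral>\<^sup>+u. ennreal (1 / L u) * indicator {x3..z} u \<partial>lborel) \<le> ennreal (2 * (z / L z))"
    using karamata_truncated by blast
  have "eventually (\<lambda>x. Fbar x * g x < 1) at_top" 
    using pi_gt3 by (intro order_tendstoD(2)[OF tail]) (simp add: field_simps)
  then obtain y where y: "\<And>x. x \<ge> y \<Longrightarrow> Fbar x * g x < 1" by (auto simp: eventually_at_top_linorder)
  define w where "w = max y x3"
  have w: "w \<ge> x0" "w > 1" "w \<ge> y" "w \<ge> x3" using mono_from x3 by (auto simp: w_def)
  have main: "trunc_square z \<le> w\<^sup>2 + 4 * (z / L z)" if z: "z \<ge> w" for z
  proof -
    have Lz: "L z > 0" using z w by (auto intro: L_pos)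
    have "ennreal (trunc_square z) = (\<integral>\<^sup>+x. ennreal ((min x z)\<^sup>2) \<partial>F)"
      unfolding trunc_square_def using z w by (intro nn_integral_eq_integral[symmetric] min_sq_integrable) auto
    also have "\<dots> \<le> (\<integral>\<^sup>+x. ennreal (w\<^sup>2) + (\<integral>\<^sup>+y. (ennreal (2 * y) * indicator {w..z} y) * indicator {..<x} y \<partial>lborel) \<partial>F)"
    proof (rule nn_integral_mono_AE, use pos in eventually_elim)
      case (elim x)
      show "ennreal ((min x z)\<^sup>2) \<le> ennreal (w\<^sup>2) + (\<integral>\<^sup>+y. (ennreal (2 * y) * indicator {w..z} y) * indicator {..<x} y \<partial>lborel)"
      proof (cases "x \<le> w")
        case True
        hence "(min x z)\<^sup>2 \<le> w\<^sup>2" using elim z by (intro power_mono) auto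
        hence "ennreal ((min x z)\<^sup>2) \<le> ennreal (w\<^sup>2)" by (rule ennreal_leI)
        thus ?thesis by (rule order_trans) auto
      next
        case False
        define m where "m = min x z"
        have m: "w \<le> m" using False z by (auto simp: m_def)
        have "(\<integral>\<^sup>+y. ennreal (2 * y) * indicator {w..m} y \<partial>lborel) = ennreal (m\<^sup>2 - w\<^sup>2)"
          by (rule nn_integral_FTC_Icc) (use m w in \<open>auto intro!: derivative_eq_intros\<close>)
        moreover have "(\<integral>\<^sup>+y. (ennreal (2 * y) * indicator {w..z} y) * indicator {..<x} y \<partial>lborel) = (\<integral>\<^sup>+y. ennreal (2 * y) * indicator {w..m} y \<partial>lborel)"
        proof (rule nn_integral_cong_AE)
          show "AE y in lborel. (ennreal (2 * y) * indicator {w..z} y) * indicator {..<x} y = ennreal (2 * y) * indicator {w..m} y"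
            using AE_lborel_singleton[of x] by eventually_elim (auto simp: indicator_def m_def)
        qed
        ultimately show ?thesis using m w by (simp add: m_def[symmetric] ennreal_plus[symmetric] del: ennreal_plus)
      qed
    qed
    also have "\<dots> = ennreal (w\<^sup>2) + (\<integral>\<^sup>+y. (ennreal (2 * y) * indicator {w..z} y) * emeasure F {y<..} \<partial>lborel)"
    proof (subst nn_integral_add)
      show "(\<lambda>x. \<integral>\<^sup>+ y. ennreal (2 * y) * indicator {w..z} y * indicator {..<x} y \<partial>lborel) \<in> borel_measurable F"
      proof -
        have "ennreal (2 * y) * indicator {w..z} y * indicator {..<x} y = 
          (\<lambda>p. ennreal (2 * snd p) * indicator {w..z} (snd p) * indicator {p. snd p < fst p} p) (x, y)" for x y :: real
          by (auto simp: indicator_def)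
        thus ?thesis by simp
      qed
    qed (auto simp: F.layer_cake_nn F.emeasure_space_1[simplified])
    finally have step1: "ennreal (trunc_square z) \<le> ennreal (w\<^sup>2) + (\<integral>\<^sup>+y. (ennreal (2 * y) * indicator {w..z} y) * emeasure F {y<..} \<partial>lborel)" .
    have "(\<integral>\<^sup>+y. (ennreal (2 * y) * indicator {w..z} y) * emeasure F {y<..} \<partial>lborel) \<le>
      (\<integral>\<^sup>+y. ennreal 2 * (ennreal (1 / L y) * indicator {x3..z} y) \<partial>lborel)"
    proof (intro nn_integral_mono)
      fix u
      show "(ennreal (2 * u) * indicator {w..z} u) * emeasure F {u<..} \<le> ennreal 2 * (ennreal (1 / L u) * indicator {x3..z} u)"
      proof (cases "u \<in> {w..z}")
        case True
        have "L u > 0" using True w by (intro L_pos) auto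
        hence "2 * u * Fbar u \<le> 2 * (1 / L u)" using y[of u] True w by (simp add: g_def field_simps)
        hence "ennreal (2 * u * Fbar u) \<le> ennreal (2 * (1 / L u))" by (rule ennreal_leI)
        thus ?thesis using True w \<open>L u > 0\<close> by (simp add: F.emeasure_eq_measure ennreal_mult[symmetric] del: ennreal_numeral)
      qed auto
    qed
    also have "\<dots> = ennreal 2 * (\<integral>\<^sup>+y. (ennreal (1 / L y) * indicator {x3..z} y) \<partial>lborel)"
      by (rule nn_integral_cmult) measurable
    also have "\<dots> \<le> ennreal 2 * ennreal (2 * (z / L z))" using x3 z w by (intro mult_left_mono) auto
    finally have "ennreal (trunc_square z) \<le> ennreal (w\<^sup>2) + ennreal 2 * ennreal (2 * (z / L z))"
      using step1 add_left_mono order_trans by metis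
    also have "ennreal (w\<^sup>2) + ennreal 2 * ennreal (2 * (z / L z)) = ennreal (w\<^sup>2 + 4 * (z / L z))"
      using Lz z w by (simp add: ennreal_mult[symmetric] ennreal_plus[symmetric] del: ennreal_numeral ennreal_plus)
    finally show ?thesis using Lz z w by (subst (asm) ennreal_le_iff) auto
  qed
  have "eventually (\<lambda>z. z / L z \<ge> w\<^sup>2) at_top" using x_div_L_at_top by (simp add: filterlim_at_top)
  hence "eventually (\<lambda>z. trunc_square z \<le> 5 * (z / L z)) at_top"
    using eventually_ge_at_top[of w] by eventually_elim (use main in force)
  thus ?thesis by (intro exI[of _ 5]) auto
qed

lemma scaled_tail:
  assumes z: "filterlim z at_top Fi" and lim: "((\<lambda>i. t i / g (z i)) \<longlongrightarrow> c) Fi"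
  shows "((\<lambda>i. t i * Fbar (z i)) \<longlongrightarrow> c * (2 / pi)) Fi"
proof -
  have "((\<lambda>i. (t i / g (z i)) * (Fbar (z i) * g (z i))) \<longlongrightarrow> c * (2 / pi)) Fi"
    by (intro tendsto_mult lim filterlim_compose[OF tail z])
  moreover have "eventually (\<lambda>i. z i \<ge> x0) Fi" using z by (simp add: filterlim_at_top)
  hence "eventually (\<lambda>i. (t i / g (z i)) * (Fbar (z i) * g (z i)) = t i * Fbar (z i)) Fi"
    by eventually_elim (use g_pos in force)
  ultimately show ?thesis by (auto dest: Lim_transform_eventually)
qed

text \<open>The norming sequence: \<open>g (s n) = n\<close> for large \<open>n\<close>, so \<open>n * Fbar (s n)\<close> tends to \<open>2 / pi\<close>.\<close>

definition s :: "nat \<Rightarrow> real" where "s n = g_inv (real n)"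

lemma s_pos: "s n > 0" "s n > 1" using g_inv(1)[of n] mono_from(2) by (auto simp: s_def)

lemma s_at_top: "filterlim s at_top sequentially"
  unfolding s_def by (rule filterlim_compose[OF g_inv_at_top filterlim_real_sequentially])

lemma eventually_g_s: "eventually (\<lambda>n. g (s n) = real n) sequentially"
proof -
  have "eventually (\<lambda>n. real n \<ge> g mono_from) sequentially"
    using filterlim_real_sequentially by (simp add: filterlim_at_top)
  thus ?thesis by eventually_elim (simp add: s_def g_inv)
qed

lemma n_over_g:
  assumes "((\<lambda>n. w n / s n) \<longlongrightarrow> c) sequentially" "c > 0"
  shows "((\<lambda>n. real n / g (w n)) \<longlongrightarrow> 1 / c) sequentially"
proof -
  have "((\<lambda>n. inverse (g (w n) / g (s n))) \<longlongrightarrow> inverse c) sequentially"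
    using assms by (intro tendsto_inverse g_ratio s_at_top) auto
  moreover have "eventually (\<lambda>n. inverse (g (w n) / g (s n)) = real n / g (w n)) sequentially"
    using eventually_g_s by eventually_elim simp
  ultimately have "((\<lambda>n. real n / g (w n)) \<longlongrightarrow> inverse c) sequentially" by (rule Lim_transform_eventually)
  thus ?thesis by (simp add: inverse_eq_divide)
qed

lemma scale_const_at_top: "y > 0 \<Longrightarrow> filterlim (\<lambda>n. s n * y) at_top sequentially"
  by (rule filterlim_at_top_mult_tendsto_pos[OF tendsto_const _ s_at_top])

lemma n_Fbar_s: "y > 0 \<Longrightarrow> (\<lambda>n. real n * Fbar (s n * y)) \<longlonglongrightarrow> 1 / y * (2 / pi)"
proof (rule scaled_tail[OF scale_const_at_top])
  assume "y > 0"
  have "s n * y / s n = y" for n using s_pos(1)[of n] by simp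
  thus "(\<lambda>n. real n / g (s n * y)) \<longlonglongrightarrow> 1 / y" using \<open>y > 0\<close> by (intro n_over_g) auto
qed 

text \<open>At a scale \<open>v\<close> where \<open>t n * Fbar (v n * y)\<close> is about \<open>(2 / pi) / y\<close>, observations below \<open>v n * y\<close> contribute at
  most a multiple of \<open>y\<close> to the normalised variance. The constant must not depend on \<open>y\<close>, because
  \<open>y\<close> will tend to 0.\<close>

lemma scaled_trunc_square:
  assumes v: "filterlim v at_top sequentially" and t: "\<And>n. t n \<ge> 0"
    and lim: "\<And>y. y > 0 \<Longrightarrow> (\<lambda>n. t n / g (v n * y)) \<longlonglongrightarrow> 1 / y"
  shows "\<exists>C>0. \<forall>y>0. eventually (\<lambda>n. t n * trunc_square (v n * y) / (v n)\<^sup>2 \<le> C * y) sequentially"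
proof -
  obtain C where C: "C > 0" "eventually (\<lambda>z. trunc_square z \<le> C * (z / L z)) at_top" using trunc_square_bound by blast
  have "eventually (\<lambda>n. t n * trunc_square (v n * y) / (v n)\<^sup>2 \<le> (2 * C) * y) sequentially" if y: "y > 0" for y
  proof -
    have vy: "filterlim (\<lambda>n. v n * y) at_top sequentially"
      by (rule filterlim_at_top_mult_tendsto_pos[OF tendsto_const y v])
    have "eventually (\<lambda>n. trunc_square (v n * y) \<le> C * (v n * y / L (v n * y))) sequentially"
      using C(2) vy by (auto simp: filterlim_iff)
    moreover have "eventually (\<lambda>n. t n / g (v n * y) < 2 / y) sequentially"
      using y by (intro order_tendstoD(2)[OF lim]) (auto simp: field_simps)
    moreover have "eventually (\<lambda>n. v n * y \<ge> x0) sequentially" using vy by (simp add: filterlim_at_top)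
    ultimately show ?thesis
    proof eventually_elim
      case (elim n)
      have Lp: "L (v n * y) > 0" using elim by (intro L_pos)
      have "v n * y > 0" using elim x0 by linarith
      hence vp: "v n > 0" using y by (simp add: zero_less_mult_iff)
      have "t n * trunc_square (v n * y) / (v n)\<^sup>2 \<le> t n * (C * (v n * y / L (v n * y))) / (v n)\<^sup>2"
        using elim t[of n] by (intro divide_right_mono mult_left_mono) auto
      also have "\<dots> = C * y^2 * (t n / g (v n * y))"
        using vp Lp y by (simp add: g_def field_simps power2_eq_square)
      also have "\<dots> \<le> C * y^2 * (2 / y)" using elim C y by (intro mult_left_mono) auto
      also have "\<dots> = 2 * C * y" using y by (simp add: power2_eq_square)
      finally show ?case .
    qed
  qed
  thus ?thesis using C(1) by (intro exI[of _ "2 * C"]) auto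
qed

lemma n_trunc_square_s: "\<exists>C>0. \<forall>y>0. eventually (\<lambda>n. real n * trunc_square (s n * y) / (s n)\<^sup>2 \<le> C * y) sequentially"
proof (rule scaled_trunc_square[OF s_at_top])
  fix y :: real assume "y > 0"
  moreover have "s n * y / s n = y" for n using s_pos(1)[of n] by simp
  ultimately show "(\<lambda>n. real n / g (s n * y)) \<longlonglongrightarrow> 1 / y" by (intro n_over_g) auto
qed simp

end

section \<open>The Frullani integral of the cosine\<close>

text \<open>Adding \<open>1 / x\<close> makes \<open>R\<close> decreasing, subtracting it makes \<open>R\<close> increasing; so \<open>R\<close> is monotone and bounded
  up to a vanishing term.\<close>

lemma tendsto_at_top_of_deriv_bound:
  fixes R r :: "real \<Rightarrow> real"
  assumes deriv: "\<And>x. x \<ge> 1 \<Longrightarrow> (R has_real_derivative r x) (at x)"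
    and bound: "\<And>x. x \<ge> 1 \<Longrightarrow> \<bar>r x\<bar> \<le> 1 / x\<^sup>2"
  shows "\<exists>l. (R \<longlongrightarrow> l) at_top"
proof -
  have dec: "R y + 1 / y \<le> R x + 1 / x" if "1 \<le> x" "x \<le> y" for x y
  proof (rule DERIV_nonpos_imp_nonincreasing[OF that(2)])
    fix u assume u: "x \<le> u" "u \<le> y"
    have "((\<lambda>u. R u + 1 / u) has_real_derivative r u + (- (1 / u\<^sup>2))) (at u)"
      using u that by (intro DERIV_add deriv) (auto intro!: derivative_eq_intros simp: power2_eq_square)
    moreover have "r u + (- (1 / u\<^sup>2)) \<le> 0" using bound[of u] u that by auto
    ultimately show "\<exists>y. ((\<lambda>u. R u + 1 / u) has_real_derivative y) (at u) \<and> y \<le> 0" by blast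
  qed
  have inc: "R x - 1 / x \<le> R y - 1 / y" if "1 \<le> x" "x \<le> y" for x y
  proof (rule DERIV_nonneg_imp_nondecreasing[OF that(2)])
    fix u assume u: "x \<le> u" "u \<le> y"
    have "((\<lambda>u. R u - 1 / u) has_real_derivative r u - (- (1 / u\<^sup>2))) (at u)"
      using u that by (intro DERIV_diff deriv) (auto intro!: derivative_eq_intros simp: power2_eq_square)
    moreover have "r u - (- (1 / u\<^sup>2)) \<ge> 0" using bound[of u] u that by auto
    ultimately show "\<exists>y. ((\<lambda>u. R u - 1 / u) has_real_derivative y) (at u) \<and> y \<ge> 0" by blast
  qed
  define S where "S x = - (R (max 1 x) + 1 / max 1 x)" for x
  have "mono S" 
  proof (rule monoI)
    fix x y :: real assume "x \<le> y"
    thus "S x \<le> S y" using dec[of "max 1 x" "max 1 y"] unfolding S_def by linarith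
  qed
  have "S x \<le> - (R 1 - 1)" for x
  proof -
    have "R 1 - 1 / 1 \<le> R (max 1 x) - 1 / max 1 x" by (intro inc) auto
    moreover have "1 / max 1 x \<ge> 0" by auto
    ultimately show ?thesis unfolding S_def by linarith
  qed
  hence "bdd_above (range S)" by (intro bdd_aboveI) auto
  have "(S \<longlongrightarrow> (SUP x. S x)) at_top"
  proof (rule order_tendstoI)
    fix c assume "c < (SUP x. S x)"
    then obtain x where x: "c < S x" using \<open>bdd_above (range S)\<close> by (subst (asm) less_cSUP_iff) auto
    show "eventually (\<lambda>x. c < S x) at_top"
      using eventually_ge_at_top[of x] by eventually_elim (meson x \<open>mono S\<close> monoD less_le_trans)
  next
    fix c assume "c > (SUP x. S x)"
    moreover have "S x \<le> (SUP x. S x)" for x by (rule cSUP_upper[OF _ \<open>bdd_above (range S)\<close>]) auto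
    ultimately have "S x < c" for x using le_less_trans by blast
    thus "eventually (\<lambda>x. S x < c) at_top" by auto
  qed
  moreover have "((\<lambda>x::real. 1 / x) \<longlongrightarrow> 0) at_top" by real_asymp
  ultimately have "((\<lambda>x. - S x - 1 / x) \<longlongrightarrow> - (SUP x. S x) - 0) at_top" by (intro tendsto_intros)
  moreover have "eventually (\<lambda>x. - S x - 1 / x = R x) at_top"
    using eventually_ge_at_top[of 1] by eventually_elim (auto simp: S_def max_def)
  ultimately have "(R \<longlongrightarrow> - (SUP x. S x) - 0) at_top" by (rule Lim_transform_eventually)
  thus ?thesis by blast
qed

lemma sin_approx: "\<bar>sin x - x\<bar> \<le> x\<^sup>2 / 2" for x :: real
proof -
  have "cmod (iexp x - (1 + \<i> * x)) \<le> x\<^sup>2 / 2"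
    using iexp_approx1[of x 1] by (simp add: power2_eq_square)
  moreover have "\<bar>Im (iexp x - (1 + \<i> * x))\<bar> \<le> cmod (iexp x - (1 + \<i> * x))" by (rule abs_Im_le_cmod)
  ultimately show ?thesis by (simp add: Im_exp)
qed

lemma cos_approx: "\<bar>cos x - 1\<bar> \<le> x\<^sup>2 / 2" for x :: real
proof -
  have "cmod (iexp x - (1 + \<i> * x)) \<le> x\<^sup>2 / 2"
    using iexp_approx1[of x 1] by (simp add: power2_eq_square)
  moreover have "\<bar>Re (iexp x - (1 + \<i> * x))\<bar> \<le> cmod (iexp x - (1 + \<i> * x))" by (rule abs_Re_le_cmod)
  ultimately show ?thesis by (simp add: Re_exp)
qed

text \<open>The antiderivative \<open>Q\<close> of \<open>cos x / x\<close> is the cosine integral up to a constant. At infinity \<open>Q\<close> converges,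
  as \<open>Q x - sin x / x\<close> has the derivative \<open>sin x / x\<^sup>2\<close>; near 0 it behaves like \<open>ln\<close>, as \<open>(cos x - 1) / x\<close> is
  bounded by 1. Together this is the Frullani integral of \<open>(cos (t * x) - cos x) / x\<close>, which is \<open>- ln t\<close>.\<close>

lemma cos_integral:
  obtains Q :: "real \<Rightarrow> real" where "\<And>x. x > 0 \<Longrightarrow> (Q has_real_derivative cos x / x) (at x)"
    "\<And>t. t > 0 \<Longrightarrow> ((\<lambda>x. Q (t * x) - Q x) \<longlongrightarrow> 0) at_top"
    "\<And>t. t > 0 \<Longrightarrow> ((\<lambda>x. Q (t * x) - Q x) \<longlongrightarrow> ln t) (at_right 0)"
proof -
  have "\<exists>Q. \<forall>x. 0 < ereal x \<longrightarrow> ereal x < \<infinity> \<longrightarrow> (Q has_vector_derivative cos x / x) (at x)"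
    by (rule einterval_antiderivative) (auto intro!: continuous_intros)
  then obtain Q :: "real \<Rightarrow> real" where Q: "\<And>x. x > 0 \<Longrightarrow> (Q has_real_derivative cos x / x) (at x)"
    by (auto simp: has_real_derivative_iff_has_vector_derivative)
  have "\<exists>l. ((\<lambda>x. Q x - sin x / x) \<longlongrightarrow> l) at_top"
  proof (rule tendsto_at_top_of_deriv_bound)
    fix x :: real assume x: "x \<ge> 1"
    have "((\<lambda>x. Q x - sin x / x) has_real_derivative cos x / x - (cos x * x - sin x * 1) / (x * x)) (at x)"
      using x by (intro DERIV_diff Q DERIV_divide DERIV_sin DERIV_ident) auto
    also have "cos x / x - (cos x * x - sin x * 1) / (x * x) = sin x / x\<^sup>2"
      using x by (simp add: field_simps power2_eq_square)
    finally show "((\<lambda>x. Q x - sin x / x) has_real_derivative sin x / x\<^sup>2) (at x)" .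
    show "\<bar>sin x / x\<^sup>2\<bar> \<le> 1 / x\<^sup>2" using x by (auto simp: abs_divide intro!: divide_right_mono)
  qed
  then obtain l where "((\<lambda>x. Q x - sin x / x) \<longlongrightarrow> l) at_top" ..
  moreover have "((\<lambda>x::real. sin x / x) \<longlongrightarrow> 0) at_top" by real_asymp
  ultimately have "((\<lambda>x. (Q x - sin x / x) + sin x / x) \<longlongrightarrow> l + 0) at_top" by (rule tendsto_add)
  hence l: "(Q \<longlongrightarrow> l) at_top" by simp
  have 1: "((\<lambda>x. Q (t * x) - Q x) \<longlongrightarrow> 0) at_top" if "t > 0" for t
  proof -
    have "filterlim (\<lambda>x. t * x) at_top at_top" using that by real_asymp
    from tendsto_diff[OF filterlim_compose[OF l this] l] show ?thesis by simp
  qed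
  have 2: "((\<lambda>x. Q (t * x) - Q x) \<longlongrightarrow> ln t) (at_right 0)" if t: "t > 0" for t
  proof -
    \<comment> \<open>\<open>S\<close> is 1-Lipschitz, so its increment over \<open>[x, t * x]\<close> vanishes with \<open>x\<close>.\<close>
    define S where "S x = Q x - ln x" for x
    have lip: "\<bar>S y - S x\<bar> \<le> \<bar>y - x\<bar>" if xy: "x > 0" "y > 0" for x y
    proof -
      have "norm (S y - S x) \<le> 1 * norm (y - x)"
      proof (rule field_differentiable_bound[where S = "{0<..}" and f' = "\<lambda>x. (cos x - 1) / x"])
        fix u :: real assume "u \<in> {0<..}"
        hence u: "u > 0" by simp
        have "(S has_real_derivative cos u / u - 1 / u) (at u)"
          unfolding S_def using u by (intro DERIV_diff Q DERIV_ln_divide) auto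
        thus "(S has_field_derivative (cos u - 1) / u) (at u within {0<..})"
          by (simp add: diff_divide_distrib has_field_derivative_at_within)
        have "\<bar>cos u - 1\<bar> \<le> u"
        proof (cases "u \<le> 2")
          case True
          have "u\<^sup>2 / 2 \<le> u" using True u by (simp add: power2_eq_square field_simps)
          thus ?thesis using cos_approx[of u] by linarith
        next
          case False
          thus ?thesis using cos_le_one[of u] cos_ge_minus_one[of u] by linarith
        qed
        thus "norm ((cos u - 1) / u) \<le> 1" using u by (simp add: abs_divide field_simps)
      qed (use xy in auto)
      thus ?thesis by simp
    qed
    have "((\<lambda>x. S (t * x) - S x) \<longlongrightarrow> 0) (at_right 0)"
    proof (rule Lim_null_comparison)
      show "eventually (\<lambda>x. norm (S (t * x) - S x) \<le> \<bar>t * x - x\<bar>) (at_right 0)"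
        using eventually_at_right_less[of 0] by eventually_elim (use lip t in auto)
      have "((\<lambda>x. \<bar>t * x - x\<bar>) \<longlongrightarrow> \<bar>t * 0 - 0\<bar>) (at_right 0)" by (intro tendsto_intros)
      thus "((\<lambda>x. \<bar>t * x - x\<bar>) \<longlongrightarrow> 0) (at_right 0)" by simp
    qed
    hence "((\<lambda>x. (S (t * x) - S x) + ln t) \<longlongrightarrow> 0 + ln t) (at_right 0)" by (intro tendsto_intros)
    hence "((\<lambda>x. (S (t * x) - S x) + ln t) \<longlongrightarrow> ln t) (at_right 0)" by simp
    moreover have "eventually (\<lambda>x. (S (t * x) - S x) + ln t = Q (t * x) - Q x) (at_right 0)"
      using eventually_at_right_less[of 0] by eventually_elim (use t in \<open>simp add: S_def ln_mult_pos\<close>)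
    ultimately show ?thesis by (rule Lim_transform_eventually)
  qed
  show ?thesis by (rule that[OF Q 1 2])
qed

section \<open>The characteristic function of a centred observation\<close>

context heavy_tail
begin

text \<open>In a window away from 0 and infinity, \<open>n * Fbar (s n * y)\<close> converges to \<open>(2 / pi) / y\<close> and is bounded by its
  value at the left end, so dominated convergence applies. \<open>\<Phi>\<close> is the antiderivative of \<open>h y / y\<close>.\<close>

lemma scaled_expectation_window:
  assumes deriv: "\<And>x. x > 0 \<Longrightarrow> (H has_real_derivative h x) (at x)"
    and cont: "\<And>x. x > 0 \<Longrightarrow> isCont h x" and [measurable]: "h \<in> borel_measurable borel"
    and Phi: "\<And>x. x > 0 \<Longrightarrow> (\<Phi> has_real_derivative h x / x) (at x)"
    and lu: "0 < l" "l \<le> u"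
  shows "(\<lambda>n. real n * (LINT x|F. H (min (x / s n) u) - H (min (x / s n) l))) \<longlonglongrightarrow> 2 / pi * (\<Phi> u - \<Phi> l)"
proof -
  have "compact (h ` {l..u})" using cont lu by (intro compact_continuous_image continuous_at_imp_continuous_on) auto
  hence "bounded (h ` {l..u})" by (rule compact_imp_bounded)
  then obtain B where B: "\<And>y. y \<in> {l..u} \<Longrightarrow> \<bar>h y\<bar> \<le> B" unfolding bounded_iff by (metis imageI real_norm_def)
  have "Bseq (\<lambda>n. real n * Fbar (s n * l))" by (rule convergent_imp_Bseq) (use n_Fbar_s[OF lu(1)] in \<open>auto simp: convergent_def\<close>)
  then obtain A where A: "\<And>n. \<bar>real n * Fbar (s n * l)\<bar> \<le> A" by (auto simp: Bseq_def)
  have "(\<lambda>n. LBINT y. indicator {l..u} y * h y * (real n * Fbar (s n * y))) \<longlonglongrightarrow> 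
      (LBINT y. indicator {l..u} y * h y * (1 / y * (2 / pi)))"
  proof (rule integral_dominated_convergence[where w = "\<lambda>y. indicator {l..u} y * (B * A)"])
    show "AE y in lborel. (\<lambda>n. indicator {l..u} y * h y * (real n * Fbar (s n * y))) \<longlonglongrightarrow> indicator {l..u} y * h y * (1 / y * (2 / pi))"
    proof (rule AE_I2)
      fix y
      show "(\<lambda>n. indicator {l..u} y * h y * (real n * Fbar (s n * y))) \<longlonglongrightarrow> indicator {l..u} y * h y * (1 / y * (2 / pi))"
      proof (cases "y \<in> {l..u}")
        case True
        have "(\<lambda>n. h y * (real n * Fbar (s n * y))) \<longlonglongrightarrow> h y * (1 / y * (2 / pi))"
          using True lu by (intro tendsto_mult n_Fbar_s tendsto_const) auto
        thus ?thesis using True by simp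
      qed simp
    qed
    fix n
    show "AE y in lborel. norm (indicator {l..u} y * h y * (real n * Fbar (s n * y))) \<le> indicator {l..u} y * (B * A)"
    proof (rule AE_I2)
      fix y
      show "norm (indicator {l..u} y * h y * (real n * Fbar (s n * y))) \<le> indicator {l..u} y * (B * A)"
      proof (cases "y \<in> {l..u}")
        case True
        have "s n * l \<le> s n * y" using True s_pos(1)[of n] by (intro mult_left_mono) auto
        hence "real n * Fbar (s n * y) \<le> real n * Fbar (s n * l)" by (rule mult_left_mono[OF Fbar_antimono]) auto
        also have "\<dots> \<le> A" using A[of n] by linarith
        finally have "\<bar>h y\<bar> * (real n * Fbar (s n * y)) \<le> B * A" using B[OF True]
          by (intro mult_mono) (auto intro: order_trans)
        thus ?thesis using True by (simp add: abs_mult)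
      qed auto
    qed
  qed (use lu in \<open>measurable, auto simp: emeasure_lborel_Icc_eq intro!: integrable_mult_left integrable_real_indicator\<close>)
  also have "(LBINT y. indicator {l..u} y * h y * (1 / y * (2 / pi))) = 2 / pi * (LBINT y. (h y / y) * indicator {l..u} y)"
    by (subst integral_mult_right_zero[symmetric]) (intro Bochner_Integration.integral_cong, auto simp: mult_ac)
  also have "(LBINT y. (h y / y) * indicator {l..u} y) = \<Phi> u - \<Phi> l"
    by (rule integral_FTC_Icc_real) (use lu Phi cont in \<open>auto intro!: continuous_intros\<close>)
  finally have *: "(\<lambda>n. LBINT y. indicator {l..u} y * h y * (real n * Fbar (s n * y))) \<longlonglongrightarrow> 2 / pi * (\<Phi> u - \<Phi> l)" .
  have "(LBINT y. indicator {l..u} y * h y * (real n * Fbar (s n * y))) = real n * (LINT x|F. H (min (x / s n) u) - H (min (x / s n) l))" for n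
  proof -
    have "(LINT x|F. H (min (x / s n) u) - H (min (x / s n) l)) = (LBINT y. indicator {l..u} y * h y * Fbar (s n * y))"
      by (rule F.layer_cake_interval) (use lu deriv cont s_pos in auto)
    thus ?thesis by (subst integral_mult_right_zero[symmetric]) (simp add: mult_ac)
  qed
  thus ?thesis using * by simp
qed

text \<open>The window is opened up to the whole half-line. Above \<open>u\<close> the boundedness of \<open>H\<close> costs
  \<open>2 * B * n * Fbar (s n * u)\<close>, about \<open>1 / u\<close>; below \<open>l\<close> the quadratic bound on \<open>H\<close> costs a truncated second moment,
  about \<open>l\<close>. So the integral of \<open>h y / y\<close> may converge conditionally.\<close>

lemma scaled_expectation_limit:
  assumes deriv: "\<And>x. x > 0 \<Longrightarrow> (H has_real_derivative h x) (at x)"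
    and cont: "\<And>x. x > 0 \<Longrightarrow> isCont h x" and h_meas: "h \<in> borel_measurable borel"
    and [measurable]: "H \<in> borel_measurable borel"
    and Phi: "\<And>x. x > 0 \<Longrightarrow> (\<Phi> has_real_derivative h x / x) (at x)"
    and Phi_top: "(\<Phi> \<longlongrightarrow> P) at_top" and Phi_0: "(\<Phi> \<longlongrightarrow> Q) (at_right 0)"
    and H_sq: "\<And>x. x \<ge> 0 \<Longrightarrow> \<bar>H x\<bar> \<le> B * x\<^sup>2" and H_bound: "\<And>x. x \<ge> 0 \<Longrightarrow> \<bar>H x\<bar> \<le> B"
  shows "(\<lambda>n. real n * (LINT x|F. H (x / s n))) \<longlonglongrightarrow> 2 / pi * (P - Q)"
proof (rule LIMSEQ_I)
  fix \<epsilon> :: real assume \<epsilon>: "\<epsilon> > 0"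
  have B: "B \<ge> 0" using H_bound[of 0] by linarith
  obtain C where C: "C > 0" "\<And>y. y > 0 \<Longrightarrow> eventually (\<lambda>n. real n * trunc_square (s n * y) / (s n)\<^sup>2 \<le> C * y) sequentially"
    using n_trunc_square_s by blast
  define d where "d = \<epsilon> / 6"
  have d: "d > 0" using \<epsilon> by (simp add: d_def)
  have lim1: "((\<lambda>u. 2 * B * (1 / u)) \<longlongrightarrow> 0) at_top" by real_asymp
  have "eventually (\<lambda>u. \<bar>\<Phi> u - P\<bar> < d \<and> 2 * B * (1 / u) < d \<and> u \<ge> 1) at_top"
    using tendstoD[OF Phi_top d] by (intro eventually_conj order_tendstoD(2)[OF lim1 d] eventually_ge_at_top) (auto simp: dist_real_def)
  then obtain u where u: "\<bar>\<Phi> u - P\<bar> < d" "2 * B * (1 / u) < d" "u \<ge> 1" by (auto simp: eventually_at_top_linorder)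
  have "((\<lambda>l. B * (C * l)) \<longlongrightarrow> B * (C * 0)) (at_right 0)" by (intro tendsto_intros)
  hence "eventually (\<lambda>l. B * (C * l) < d) (at_right 0)" using d by (intro order_tendstoD) auto
  moreover have "eventually (\<lambda>l. \<bar>\<Phi> l - Q\<bar> < d) (at_right 0)" using tendstoD[OF Phi_0 d] by (auto simp: dist_real_def)
  moreover have "eventually (\<lambda>l::real. l < 1) (at_right 0)" by (rule eventually_at_right_real[THEN eventually_mono, of 0 1]) auto
  ultimately have "eventually (\<lambda>l. B * (C * l) < d \<and> \<bar>\<Phi> l - Q\<bar> < d \<and> l < 1 \<and> l > 0) (at_right 0)"
    using eventually_at_right_less[of 0] by eventually_elim auto
  then obtain l where l: "B * (C * l) < d" "\<bar>\<Phi> l - Q\<bar> < d" "l < 1" "l > 0"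
    using eventually_happens'[OF trivial_limit_at_right_real] by blast
  have up: "u > 0" using u by simp
  define T where "T n = real n * (LINT x|F. H (min (x / s n) u) - H (min (x / s n) l))" for n
  have T: "T \<longlonglongrightarrow> 2 / pi * (\<Phi> u - \<Phi> l)" unfolding T_def
    by (rule scaled_expectation_window[OF deriv cont h_meas Phi]) (use l u in auto)
  have c1: "2 / pi \<le> (1::real)" using pi_gt3 by (simp add: field_simps)
  have "(\<lambda>n. 2 * B * (real n * Fbar (s n * u))) \<longlonglongrightarrow> 2 * B * (1 / u * (2 / pi))" by (intro tendsto_intros n_Fbar_s up)
  moreover have "2 * B * (1 / u * (2 / pi)) < d"
  proof -
    have "2 * B * (1 / u * (2 / pi)) \<le> 2 * B * (1 / u * 1)" using B up c1 by (intro mult_left_mono) auto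
    thus ?thesis using u by simp
  qed
  ultimately have "eventually (\<lambda>n. 2 * B * (real n * Fbar (s n * u)) < d) sequentially" by (rule order_tendstoD(2))
  moreover have "eventually (\<lambda>n. \<bar>T n - 2 / pi * (\<Phi> u - \<Phi> l)\<bar> < d) sequentially"
    using tendstoD[OF T d] by (simp add: dist_real_def)
  ultimately have "eventually (\<lambda>n. norm (real n * (LINT x|F. H (x / s n)) - 2 / pi * (P - Q)) < \<epsilon>) sequentially"
    using C(2)[OF l(4)]
  proof eventually_elim
    case (elim n)
    have sp: "s n > 0" by (rule s_pos)
    have int: "integrable F (\<lambda>x. H (x / s n))" "integrable F (\<lambda>x. H (min (x / s n) u))" "integrable F (\<lambda>x. H (min (x / s n) l))"
    proof -
      have bounded_integrable: "integrable F f" if "f \<in> borel_measurable borel" "\<And>x. x > 0 \<Longrightarrow> \<bar>f x\<bar> \<le> B" for f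
      proof (rule F.integrable_const_bound[where B = B])
        show "AE x in F. norm (f x) \<le> B" using pos by eventually_elim (use that in auto)
      qed (use that in auto)
      show "integrable F (\<lambda>x. H (x / s n))" "integrable F (\<lambda>x. H (min (x / s n) u))" "integrable F (\<lambda>x. H (min (x / s n) l))"
        by (rule bounded_integrable; use H_bound l u sp in force)+
    qed
    have e1: "(LINT x|F. H (x / s n)) - (LINT x|F. H (min (x / s n) u) - H (min (x / s n) l)) =
       (LINT x|F. H (x / s n) - H (min (x / s n) u)) + (LINT x|F. H (min (x / s n) l))"
      using int by simp
    have b1: "\<bar>LINT x|F. H (x / s n) - H (min (x / s n) u)\<bar> \<le> 2 * B * Fbar (s n * u)"
    proof -
      have "norm (LINT x|F. H (x / s n) - H (min (x / s n) u)) \<le> (LINT x|F. 2 * B * indicator {s n * u<..} x)"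
      proof (rule integral_norm_bound[THEN order_trans], rule integral_mono)
        fix x
        show "norm (H (x / s n) - H (min (x / s n) u)) \<le> 2 * B * indicator {s n * u<..} x"
        proof (cases "x / s n \<le> u")
          case False
          hence "x > s n * u" using sp by (simp add: field_simps)
          moreover have "\<bar>H (x / s n)\<bar> \<le> B" "\<bar>H u\<bar> \<le> B" using False u by (auto intro!: H_bound)
          ultimately show ?thesis using False by auto
        qed (use B in auto)
      next
        show "integrable F (\<lambda>x. norm (H (x / s n) - H (min (x / s n) u)))"
          using int by (intro integrable_norm Bochner_Integration.integrable_diff)
        show "integrable F (\<lambda>x. 2 * B * indicator {s n * u<..} x)"
          by (intro integrable_mult_right integrable_real_indicator) (auto simp: F.emeasure_eq_measure)
      qed
      thus ?thesis by simp
    qed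
    have b2: "\<bar>LINT x|F. H (min (x / s n) l)\<bar> \<le> B * (trunc_square (s n * l) / (s n)\<^sup>2)"
    proof -
      have "norm (LINT x|F. H (min (x / s n) l)) \<le> (LINT x|F. B * ((min x (s n * l))\<^sup>2 / (s n)\<^sup>2))"
      proof (rule Bochner_Integration.integral_norm_bound[THEN order_trans], rule integral_mono_AE)
        show "AE x in F. norm (H (min (x / s n) l)) \<le> B * ((min x (s n * l))\<^sup>2 / (s n)\<^sup>2)"
          using pos
        proof eventually_elim
          case (elim x)
          have "min (x / s n) l = min x (s n * l) / s n" using sp by (auto simp: min_def field_simps)
          thus ?case using H_sq[of "min (x / s n) l"] elim l sp by (simp add: power_divide)
        qed
      qed (use int l sp in \<open>auto intro!: integrable_mult_right integrable_divide min_sq_integrable\<close>)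
      thus ?thesis by (simp add: trunc_square_def)
    qed
    have "real n * (LINT x|F. H (x / s n)) - T n = real n * ((LINT x|F. H (x / s n) - H (min (x / s n) u)) + (LINT x|F. H (min (x / s n) l)))"
      unfolding T_def e1[symmetric] by (simp add: algebra_simps)
    hence "\<bar>real n * (LINT x|F. H (x / s n)) - T n\<bar> = real n * \<bar>(LINT x|F. H (x / s n) - H (min (x / s n) u)) + (LINT x|F. H (min (x / s n) l))\<bar>"
      by (simp add: abs_mult)
    also have "\<dots> \<le> real n * (2 * B * Fbar (s n * u) + B * (trunc_square (s n * l) / (s n)\<^sup>2))"
      using b1 b2 by (intro mult_left_mono) auto
    also have "\<dots> = 2 * B * (real n * Fbar (s n * u)) + B * (real n * trunc_square (s n * l) / (s n)\<^sup>2)" by (simp add: algebra_simps)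
    also have "\<dots> \<le> d + B * (C * l)" using elim B by (intro add_mono mult_left_mono) auto
    also have "\<dots> < 2 * d" using l by simp
    finally have f1: "\<bar>real n * (LINT x|F. H (x / s n)) - T n\<bar> < 2 * d" .
    have "\<bar>2 / pi * (\<Phi> u - \<Phi> l) - 2 / pi * (P - Q)\<bar> = 2 / pi * \<bar>(\<Phi> u - P) - (\<Phi> l - Q)\<bar>"
    proof -
      have "2 / pi * (\<Phi> u - \<Phi> l) - 2 / pi * (P - Q) = 2 / pi * ((\<Phi> u - P) - (\<Phi> l - Q))"
        unfolding right_diff_distrib by linarith
      thus ?thesis by (simp only: abs_mult) simp
    qed
    also have "\<dots> \<le> 1 * (2 * d)" using u l by (intro mult_mono c1) auto
    finally have "\<bar>2 / pi * (\<Phi> u - \<Phi> l) - 2 / pi * (P - Q)\<bar> \<le> 2 * d" by simp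
    moreover have "\<bar>T n - 2 / pi * (\<Phi> u - \<Phi> l)\<bar> < d" using elim by simp
    ultimately show ?case using f1 \<epsilon> unfolding d_def real_norm_def by linarith
  qed
  thus "\<exists>no. \<forall>n\<ge>no. norm (real n * (LINT x|F. H (x / s n)) - 2 / pi * (P - Q)) < \<epsilon>"
    by (simp add: eventually_sequentially)
qed

text \<open>The derivative of \<open>cos (t * x) - 1\<close> divided by \<open>x\<close> integrates to the sine integral \<open>Si\<close>, whose limit is \<open>pi / 2\<close>.\<close>

lemma cos_limit: "(\<lambda>n. real n * (LINT x|F. cos (t * (x / s n)) - 1)) \<longlonglongrightarrow> - \<bar>t\<bar>"
proof -
  have pos_case: "(\<lambda>n. real n * (LINT x|F. cos (t * (x / s n)) - 1)) \<longlonglongrightarrow> - t" if t: "t > 0" for t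
  proof -
    have "(\<lambda>n. real n * (LINT x|F. (\<lambda>x. cos (t * x) - 1) (x / s n))) \<longlonglongrightarrow> 2 / pi * (- t * (pi / 2) - 0)"
    proof (rule scaled_expectation_limit[where h = "\<lambda>x. - t * sin (t * x)" and \<Phi> = "\<lambda>x. - t * Si (t * x)" and B = "2 + t\<^sup>2"])
      fix x :: real assume x: "x > 0"
      show "((\<lambda>x. cos (t * x) - 1) has_real_derivative - t * sin (t * x)) (at x)"
        by (auto intro!: derivative_eq_intros)
      show "isCont (\<lambda>x. - t * sin (t * x)) x" by (intro continuous_intros)
      have "((\<lambda>x. Si (t * x)) has_real_derivative sinc (t * x) * t) (at x)"
        by (rule DERIV_chain2[OF DERIV_Si]) (auto intro!: derivative_eq_intros)
      from DERIV_cmult[OF this, of "- t"] x t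
      show "((\<lambda>x. - t * Si (t * x)) has_real_derivative - t * sin (t * x) / x) (at x)" by (simp add: field_simps)
    next
      have "filterlim (\<lambda>x. t * x) at_top at_top" using t by real_asymp
      from filterlim_compose[OF Si_at_top this]
      show "((\<lambda>x. - t * Si (t * x)) \<longlongrightarrow> - t * (pi / 2)) at_top" by (intro tendsto_intros)
      have "isCont (\<lambda>x. - t * Si (t * x)) 0" by (intro continuous_intros isCont_o2[OF _ isCont_Si])
      hence "((\<lambda>x. - t * Si (t * x)) \<longlongrightarrow> - t * Si (t * 0)) (at 0)" by (simp add: isCont_def)
      moreover have "Si 0 = 0" using Si_neg[of 0] by simp
      ultimately show "((\<lambda>x. - t * Si (t * x)) \<longlongrightarrow> 0) (at_right 0)" by (auto intro: tendsto_mono[OF at_le])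
    next
      fix x :: real
      have "\<bar>cos (t * x) - 1\<bar> \<le> (t * x)\<^sup>2 / 2" by (rule cos_approx)
      also have "\<dots> \<le> (2 + t\<^sup>2) * x\<^sup>2" by (simp add: power_mult_distrib algebra_simps)
      finally show "\<bar>cos (t * x) - 1\<bar> \<le> (2 + t\<^sup>2) * x\<^sup>2" .
      show "\<bar>cos (t * x) - 1\<bar> \<le> 2 + t\<^sup>2" 
        using cos_le_one[of "t * x"] cos_ge_minus_one[of "t * x"] zero_le_power2[of t] by linarith
    qed measurable
    thus ?thesis using t by simp
  qed
  consider "t > 0" | "t = 0" | "t < 0" by linarith
  thus ?thesis
  proof cases
    case 3
    have "cos (- t * (x / s n)) = cos (t * (x / s n))" for x n by simp
    thus ?thesis using pos_case[of "- t"] 3 by simp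
  qed (use pos_case in auto)
qed

text \<open>Subtracting \<open>t * sin x\<close> removes the linear term, whose expectation times \<open>n\<close> diverges, and leaves a Frullani
  integral without additional constants.\<close>

lemma sin_limit: "(\<lambda>n. real n * (LINT x|F. sin (t * (x / s n)) - t * sin (x / s n))) \<longlonglongrightarrow> - (2 / pi * (t * ln \<bar>t\<bar>))"
proof -
  obtain Q :: "real \<Rightarrow> real" where Q: "\<And>x. x > 0 \<Longrightarrow> (Q has_real_derivative cos x / x) (at x)"
    "\<And>t. t > 0 \<Longrightarrow> ((\<lambda>x. Q (t * x) - Q x) \<longlongrightarrow> 0) at_top"
    "\<And>t. t > 0 \<Longrightarrow> ((\<lambda>x. Q (t * x) - Q x) \<longlongrightarrow> ln t) (at_right 0)"
    using cos_integral by blast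
  have pos_case: "(\<lambda>n. real n * (LINT x|F. sin (t * (x / s n)) - t * sin (x / s n))) \<longlonglongrightarrow> - (2 / pi * (t * ln t))" if t: "t > 0" for t
  proof -
    have "(\<lambda>n. real n * (LINT x|F. (\<lambda>x. sin (t * x) - t * sin x) (x / s n))) \<longlonglongrightarrow> 2 / pi * (t * 0 - t * ln t)"
    proof (rule scaled_expectation_limit[where h = "\<lambda>x. t * (cos (t * x) - cos x)" and \<Phi> = "\<lambda>x. t * (Q (t * x) - Q x)" and B = "1 + t + t\<^sup>2"])
      fix x :: real assume x: "x > 0"
      show "((\<lambda>x. sin (t * x) - t * sin x) has_real_derivative t * (cos (t * x) - cos x)) (at x)"
        by (auto intro!: derivative_eq_intros simp: algebra_simps)
      show "isCont (\<lambda>x. t * (cos (t * x) - cos x)) x" by (intro continuous_intros)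
      have "((\<lambda>x. Q (t * x)) has_real_derivative cos (t * x) / (t * x) * t) (at x)"
        by (rule DERIV_chain2[OF Q(1)]) (use x t in \<open>auto intro!: derivative_eq_intros\<close>)
      from DERIV_cmult[OF DERIV_diff[OF this Q(1)[OF x]], of t] x t
      show "((\<lambda>x. t * (Q (t * x) - Q x)) has_real_derivative t * (cos (t * x) - cos x) / x) (at x)" by (simp add: field_simps)
    next
      show "((\<lambda>x. t * (Q (t * x) - Q x)) \<longlongrightarrow> t * 0) at_top" by (intro tendsto_intros Q t)
      show "((\<lambda>x. t * (Q (t * x) - Q x)) \<longlongrightarrow> t * ln t) (at_right 0)" by (intro tendsto_intros Q t)
    next
      fix x :: real
      have "\<bar>sin (t * x) - t * x\<bar> \<le> (t * x)\<^sup>2 / 2" by (rule sin_approx)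
      moreover have "\<bar>t * (sin x - x)\<bar> \<le> t * (x\<^sup>2 / 2)" using t by (simp only: abs_mult abs_of_pos) (intro mult_left_mono sin_approx, auto)
      moreover have "sin (t * x) - t * sin x = (sin (t * x) - t * x) - t * (sin x - x)" by (simp add: algebra_simps)
      ultimately have "\<bar>sin (t * x) - t * sin x\<bar> \<le> (t * x)\<^sup>2 / 2 + t * (x\<^sup>2 / 2)" by linarith
      also have "\<dots> = (t\<^sup>2 / 2 + t / 2) * x\<^sup>2" by (simp add: power_mult_distrib algebra_simps)
      also have "\<dots> \<le> (1 + t + t\<^sup>2) * x\<^sup>2" using t zero_le_power2[of t] by (intro mult_right_mono[OF _ zero_le_power2]) linarith
      finally show "\<bar>sin (t * x) - t * sin x\<bar> \<le> (1 + t + t\<^sup>2) * x\<^sup>2" .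
      have "\<bar>t * sin x\<bar> \<le> t * 1" using t by (simp only: abs_mult abs_of_pos) (intro mult_left_mono, auto)
      moreover have "\<bar>sin (t * x)\<bar> \<le> 1" by simp
      ultimately have "\<bar>sin (t * x) - t * sin x\<bar> \<le> 1 + t" by linarith
      thus "\<bar>sin (t * x) - t * sin x\<bar> \<le> 1 + t + t\<^sup>2" by (rule order_trans) simp
    qed measurable
    thus ?thesis by simp
  qed
  consider "t > 0" | "t = 0" | "t < 0" by linarith
  thus ?thesis
  proof cases
    case 3
    have "(LINT x|F. sin (t * (x / s n)) - t * sin (x / s n)) = - (LINT x|F. sin ((- t) * (x / s n)) - (- t) * sin (x / s n))" for n
      by (subst integral_minus[symmetric]) (intro Bochner_Integration.integral_cong, auto)
    thus ?thesis using tendsto_minus[OF pos_case[of "- t"]] 3 by simp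
  qed (use pos_case in auto)
qed

text \<open>Centring by the sine instead of a truncated mean: see \<open>sin_limit\<close>.\<close>

definition m :: "nat \<Rightarrow> real" where "m n = (LINT x|F. sin (x / s n))"

lemma n_m_sq: "(\<lambda>n. real n * (m n)\<^sup>2) \<longlonglongrightarrow> 0"
proof -
  define \<mu> where "\<mu> = (LINT x|F. x)"
  have bound: "\<bar>m n\<bar> \<le> \<mu> / s n" for n
  proof -
    have "\<bar>m n\<bar> \<le> (LINT x|F. \<bar>sin (x / s n)\<bar>)" unfolding m_def using integral_norm_bound[of F "\<lambda>x. sin (x / s n)"] by simp
    also have "\<dots> \<le> (LINT x|F. x / s n)"
    proof (rule integral_mono_AE)
      show "AE x in F. \<bar>sin (x / s n)\<bar> \<le> x / s n"
        using pos by eventually_elim (use s_pos[of n] in \<open>auto intro!: abs_sin_x_le_abs_x[THEN order_trans]\<close>)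
      show "integrable F (\<lambda>x. \<bar>sin (x / s n)\<bar>)" by (rule F.integrable_const_bound[where B = 1]) auto
      show "integrable F (\<lambda>x. x / s n)" by (rule integrable_divide_zero) (rule integ)
    qed
    finally show ?thesis by (simp add: \<mu>_def)
  qed
  have lim: "(\<lambda>n. \<mu>\<^sup>2 * inverse (s n / L (s n))) \<longlonglongrightarrow> \<mu>\<^sup>2 * 0"
    by (intro tendsto_mult tendsto_const filterlim_compose[OF tendsto_inverse_0_at_top[OF x_div_L_at_top] s_at_top])
  show ?thesis
  proof (rule Lim_null_comparison)
    show "(\<lambda>n. \<mu>\<^sup>2 * inverse (s n / L (s n))) \<longlonglongrightarrow> 0" using lim by simp
    show "eventually (\<lambda>n. norm (real n * (m n)\<^sup>2) \<le> \<mu>\<^sup>2 * inverse (s n / L (s n))) sequentially"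
      using eventually_g_s
    proof eventually_elim
      case (elim n)
      have "(m n)\<^sup>2 \<le> (\<mu> / s n)\<^sup>2" using power_mono[OF bound[of n], of 2] by simp
      hence "real n * (m n)\<^sup>2 \<le> real n * (\<mu> / s n)\<^sup>2" by (intro mult_left_mono) auto
      also have "\<dots> = \<mu>\<^sup>2 * inverse (s n / L (s n))" unfolding elim[symmetric] g_def using s_pos[of n]
        by (simp add: field_simps power2_eq_square)
      finally show ?case by (simp add: abs_mult)
    qed
  qed
qed

definition summand_char :: "nat \<Rightarrow> real \<Rightarrow> complex" where "summand_char n t = (CLINT x|F. iexp (t * (x / s n - m n)))"

text \<open>The logarithm of the characteristic function of the Cauchy limit law.\<close>

definition log_char :: "real \<Rightarrow> complex" where "log_char t = - complex_of_real \<bar>t\<bar> - 2 * \<i> * complex_of_real (t * ln \<bar>t\<bar>) / complex_of_real pi"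

text \<open>Multiplication by \<open>exp (- i t m n)\<close> differs from subtraction of \<open>i t m n\<close> only by a term of order
  \<open>(m n)\<^sup>2\<close>, and \<open>n * (m n)\<^sup>2\<close> vanishes because \<open>m n\<close> is at most \<open>\<mu> / s n\<close>.\<close>

lemma summand_char_limit: "(\<lambda>n. of_nat n * (summand_char n t - 1)) \<longlonglongrightarrow> log_char t"
proof -
  define \<psi> where "\<psi> n = (CLINT x|F. iexp (t * (x / s n)))" for n
  have int: "complex_integrable F (\<lambda>x. iexp (t * (x / s n)))" for n
    by (rule F.integrable_const_bound[where B = 1]) auto
  have ic: "integrable F (\<lambda>x. cos (t * (x / s n)))" "integrable F (\<lambda>x. sin (t * (x / s n)))" "integrable F (\<lambda>x. sin (x / s n))" for n
    by (rule F.integrable_const_bound[where B = 1]; auto)+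
  have re: "Re (\<psi> n) = (LINT x|F. cos (t * (x / s n)))" for n
    unfolding \<psi>_def by (subst integral_Re[symmetric, OF int]) (simp add: Re_exp)
  have im: "Im (\<psi> n) = (LINT x|F. sin (t * (x / s n)))" for n
    unfolding \<psi>_def by (subst integral_Im[symmetric, OF int]) (simp add: Im_exp)
  have "of_nat n * (\<psi> n - 1 - \<i> * of_real (t * m n)) =
     Complex (real n * (LINT x|F. cos (t * (x / s n)) - 1)) (real n * (LINT x|F. sin (t * (x / s n)) - t * sin (x / s n)))" for n
    using ic[of n] F.prob_space by (simp add: complex_eq_iff re im m_def algebra_simps)
  moreover have "(\<lambda>n. Complex (real n * (LINT x|F. cos (t * (x / s n)) - 1)) (real n * (LINT x|F. sin (t * (x / s n)) - t * sin (x / s n))))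
     \<longlonglongrightarrow> Complex (- \<bar>t\<bar>) (- (2 / pi * (t * ln \<bar>t\<bar>)))"
    by (intro tendsto_Complex cos_limit sin_limit)
  moreover have "Complex (- \<bar>t\<bar>) (- (2 / pi * (t * ln \<bar>t\<bar>))) = log_char t"
    by (simp add: log_char_def complex_eq_iff)
  ultimately have l1: "(\<lambda>n. of_nat n * (\<psi> n - 1 - \<i> * of_real (t * m n))) \<longlonglongrightarrow> log_char t" by simp
  have char_eq: "summand_char n t = \<psi> n * iexp (- (t * m n))" for n
  proof -
    have "iexp (t * (x / s n - m n)) = iexp (t * (x / s n)) * iexp (- (t * m n))" for x
      by (subst exp_add[symmetric]) (simp add: algebra_simps)
    thus ?thesis unfolding summand_char_def \<psi>_def by simp
  qed
  have m0: "(\<lambda>n. iexp (- (t * m n))) \<longlonglongrightarrow> 1"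
  proof -
    have "(\<lambda>n. sqrt (real n * (m n)\<^sup>2)) \<longlonglongrightarrow> sqrt 0" by (intro tendsto_intros n_m_sq)
    hence "(\<lambda>n. sqrt (real n) * \<bar>m n\<bar>) \<longlonglongrightarrow> 0" by (simp add: real_sqrt_mult)
    moreover have "eventually (\<lambda>n. norm (m n) \<le> sqrt (real n) * \<bar>m n\<bar>) sequentially"
      using eventually_ge_at_top[of 1] 
    proof eventually_elim
      case (elim n)
      thus ?case using mult_right_mono[of 1 "sqrt (real n)" "\<bar>m n\<bar>"] by simp
    qed
    ultimately have "m \<longlonglongrightarrow> 0" by (rule Lim_null_comparison[rotated])
    hence "(\<lambda>n. iexp (- (t * m n))) \<longlonglongrightarrow> iexp (- (t * 0))" by (intro tendsto_intros)
    thus ?thesis by simp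
  qed
  have l2: "(\<lambda>n. of_nat n * ((1 + \<i> * of_real (t * m n)) * iexp (- (t * m n)) - 1)) \<longlonglongrightarrow> 0"
  proof (rule Lim_null_comparison)
    have "(\<lambda>n. t\<^sup>2 / 2 * (real n * (m n)\<^sup>2)) \<longlonglongrightarrow> t\<^sup>2 / 2 * 0" by (intro tendsto_intros n_m_sq)
    thus "(\<lambda>n. t\<^sup>2 / 2 * (real n * (m n)\<^sup>2)) \<longlonglongrightarrow> 0" by simp
    show "eventually (\<lambda>n. norm (of_nat n * ((1 + \<i> * of_real (t * m n)) * iexp (- (t * m n)) - 1)) \<le> t\<^sup>2 / 2 * (real n * (m n)\<^sup>2)) sequentially"
    proof (rule always_eventually, rule allI)
      fix n
      define y where "y = t * m n"
      have "(1 + \<i> * of_real y) * iexp (- y) - 1 = (1 + \<i> * of_real y - iexp y) * iexp (- y)"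
        by (simp add: algebra_simps exp_minus)
      hence "norm ((1 + \<i> * of_real y) * iexp (- y) - 1) = norm (iexp y - (1 + \<i> * of_real y))"
        by (simp add: norm_mult norm_minus_commute)
      also have "\<dots> \<le> y\<^sup>2 / 2" using iexp_approx1[of y 1] by (simp add: power2_eq_square)
      finally have "norm ((1 + \<i> * of_real y) * iexp (- y) - 1) \<le> y\<^sup>2 / 2" .
      hence "real n * norm ((1 + \<i> * of_real y) * iexp (- y) - 1) \<le> real n * (y\<^sup>2 / 2)" by (intro mult_left_mono) auto
      moreover have "norm (of_nat n * ((1 + \<i> * of_real y) * iexp (- y) - 1)) = real n * norm ((1 + \<i> * of_real y) * iexp (- y) - 1)"
        by (simp only: norm_mult norm_of_nat)
      moreover have "real n * (y\<^sup>2 / 2) = t\<^sup>2 / 2 * (real n * (m n)\<^sup>2)" by (simp add: y_def power_mult_distrib)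
      ultimately show "norm (of_nat n * ((1 + \<i> * of_real (t * m n)) * iexp (- (t * m n)) - 1)) \<le> t\<^sup>2 / 2 * (real n * (m n)\<^sup>2)"
        unfolding y_def by linarith
    qed
  qed
  have "(\<lambda>n. (of_nat n * (\<psi> n - 1 - \<i> * of_real (t * m n))) * iexp (- (t * m n)) + of_nat n * ((1 + \<i> * of_real (t * m n)) * iexp (- (t * m n)) - 1)) \<longlonglongrightarrow> log_char t * 1 + 0"
    by (intro tendsto_add tendsto_mult l1 l2 m0)
  moreover have "(of_nat n * (\<psi> n - 1 - \<i> * of_real (t * m n))) * iexp (- (t * m n)) + of_nat n * ((1 + \<i> * of_real (t * m n)) * iexp (- (t * m n)) - 1) = of_nat n * (summand_char n t - 1)" for n
    unfolding char_eq by (simp add: algebra_simps)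
  ultimately show ?thesis by simp
qed

text \<open>Both bases of the two powers lie in the unit disc, so the \<open>n\<close>-th powers differ by at most \<open>n\<close> times the
  difference of the bases.\<close>

lemma summand_char_power_limit: "(\<lambda>n. summand_char n t ^ n) \<longlonglongrightarrow> exp (log_char t)"
proof -
  have n0: "eventually (\<lambda>n. n > (0::nat)) sequentially" by (rule eventually_gt_at_top)
  have Re0: "Re (log_char t) \<le> 0" by (simp add: log_char_def)
  have "((\<lambda>z. (exp z - 1) / z) \<longlongrightarrow> 1) (at (0::complex))"
    using DERIV_exp[of "0::complex"] by (simp add: has_field_derivative_iff)
  have l: "(\<lambda>n. of_nat n * (exp (log_char t / of_nat n) - 1)) \<longlonglongrightarrow> log_char t"
  proof -
    have "((\<lambda>x. exp (log_char t * x)) has_field_derivative log_char t) (at 0)" by (auto intro!: derivative_eq_intros)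
    hence "((\<lambda>x. (exp (log_char t * x) - 1) / x) \<longlongrightarrow> log_char t) (at 0)" by (simp add: has_field_derivative_iff)
    moreover have "filterlim (\<lambda>n. inverse (of_nat n) :: complex) (at 0) sequentially"
    proof (rule filterlim_atI)
      show "(\<lambda>n. inverse (of_nat n) :: complex) \<longlonglongrightarrow> 0"
        by (rule filterlim_compose[OF tendsto_inverse_0 tendsto_of_nat])
      show "eventually (\<lambda>n. inverse (of_nat n) \<noteq> (0 :: complex)) sequentially"
        using n0 by eventually_elim simp
    qed
    ultimately have "(\<lambda>n. (exp (log_char t * inverse (of_nat n)) - 1) / inverse (of_nat n)) \<longlonglongrightarrow> log_char t"
      by (rule filterlim_compose)
    thus ?thesis by (simp add: field_simps)
  qed
  have "(\<lambda>n. norm (of_nat n * (summand_char n t - 1) - of_nat n * (exp (log_char t / of_nat n) - 1))) \<longlonglongrightarrow> norm (log_char t - log_char t)"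
    by (intro tendsto_norm tendsto_diff summand_char_limit l)
  hence d0: "(\<lambda>n. norm (of_nat n * (summand_char n t - 1) - of_nat n * (exp (log_char t / of_nat n) - 1))) \<longlonglongrightarrow> 0" by simp
  have "(\<lambda>n. summand_char n t ^ n - exp (log_char t / of_nat n) ^ n) \<longlonglongrightarrow> 0"
  proof (rule Lim_null_comparison[OF _ d0], rule always_eventually, rule allI)
    fix n
    have 1: "norm (summand_char n t) \<le> 1"
    proof -
      have "norm (summand_char n t) \<le> (LINT x|F. norm (iexp (t * (x / s n - m n))))" unfolding summand_char_def by (rule integral_norm_bound)
      also have "\<dots> = 1" using F.prob_space by simp
      finally show ?thesis .
    qed
    have 2: "norm (exp (log_char t / of_nat n)) \<le> 1" using Re0 by (simp add: divide_nonpos_nonneg)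
    have "norm (summand_char n t ^ n - exp (log_char t / of_nat n) ^ n) \<le> n * norm (summand_char n t - exp (log_char t / of_nat n))"
      by (rule norm_power_diff[OF 1 2])
    also have "\<dots> = norm (of_nat n * (summand_char n t - 1) - of_nat n * (exp (log_char t / of_nat n) - 1))"
      by (simp add: norm_mult flip: right_diff_distrib)
    finally show "norm (summand_char n t ^ n - exp (log_char t / of_nat n) ^ n) \<le> norm (of_nat n * (summand_char n t - 1) - of_nat n * (exp (log_char t / of_nat n) - 1))" .
  qed
  moreover have "(\<lambda>n. exp (log_char t / of_nat n) ^ n) \<longlonglongrightarrow> exp (log_char t)"
  proof (rule tendsto_eventually, use n0 in eventually_elim)
    case (elim n)
    thus ?case by (simp flip: exp_of_nat_mult)
  qed
  ultimately have "(\<lambda>n. (summand_char n t ^ n - exp (log_char t / of_nat n) ^ n) + exp (log_char t / of_nat n) ^ n) \<longlonglongrightarrow> 0 + exp (log_char t)"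
    by (rule tendsto_add)
  thus ?thesis by simp
qed

end

section \<open>Sums of truncated observations\<close>

lemma (in prob_space) indep_sum_second_moment:
  fixes Y :: "'i \<Rightarrow> 'a \<Rightarrow> real"
  assumes "finite I" "indep_vars (\<lambda>_. borel) Y I"
    and "\<And>i. i \<in> I \<Longrightarrow> integrable M (Y i)" "\<And>i. i \<in> I \<Longrightarrow> integrable M (\<lambda>\<omega>. (Y i \<omega>)\<^sup>2)"
    and "\<And>i. i \<in> I \<Longrightarrow> expectation (Y i) = 0"
  shows "integrable M (\<lambda>\<omega>. (\<Sum>i\<in>I. Y i \<omega>)\<^sup>2) \<and>
    expectation (\<lambda>\<omega>. (\<Sum>i\<in>I. Y i \<omega>)\<^sup>2) = (\<Sum>i\<in>I. expectation (\<lambda>\<omega>. (Y i \<omega>)\<^sup>2))"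
  using assms
proof (induction I rule: finite_induct)
  case (insert i I)
  let ?S = "\<lambda>\<omega>. \<Sum>j\<in>I. Y j \<omega>"
  have IH: "integrable M (\<lambda>\<omega>. (?S \<omega>)\<^sup>2)" "expectation (\<lambda>\<omega>. (?S \<omega>)\<^sup>2) = (\<Sum>i\<in>I. expectation (\<lambda>\<omega>. (Y i \<omega>)\<^sup>2))"
    using insert.IH indep_vars_subset[OF insert.prems(1)] insert.prems by auto
  have ind: "indep_var borel (Y i) borel ?S"
    by (rule indep_vars_sum) (use insert in auto)
  have intS: "integrable M ?S" using insert.prems by (intro Bochner_Integration.integrable_sum) auto
  have intc: "integrable M (\<lambda>\<omega>. Y i \<omega> * ?S \<omega>)"
    by (rule indep_var_integrable[OF ind]) (use insert.prems intS in auto)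
  have cross: "expectation (\<lambda>\<omega>. Y i \<omega> * ?S \<omega>) = 0"
    by (subst indep_var_lebesgue_integral[OF ind]) (use insert.prems intS in auto)
  have eq: "(\<Sum>j\<in>insert i I. Y j \<omega>)\<^sup>2 = (Y i \<omega>)\<^sup>2 + (2 * (Y i \<omega> * ?S \<omega>) + (?S \<omega>)\<^sup>2)" for \<omega>
    using insert by (simp add: power2_sum algebra_simps)
  have int1: "integrable M (\<lambda>\<omega>. (Y i \<omega>)\<^sup>2)" using insert.prems by simp
  have int2: "integrable M (\<lambda>\<omega>. 2 * (Y i \<omega> * ?S \<omega>) + (?S \<omega>)\<^sup>2)"
    using IH(1) intc by (intro Bochner_Integration.integrable_add integrable_mult_right)
  have "integrable M (\<lambda>\<omega>. (\<Sum>j\<in>insert i I. Y j \<omega>)\<^sup>2)"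
    unfolding eq by (intro Bochner_Integration.integrable_add int1 int2)
  moreover have "expectation (\<lambda>\<omega>. (\<Sum>j\<in>insert i I. Y j \<omega>)\<^sup>2) = (\<Sum>j\<in>insert i I. expectation (\<lambda>\<omega>. (Y j \<omega>)\<^sup>2))"
    unfolding eq using int1 int2 intc IH cross insert.hyps by (simp add: Bochner_Integration.integral_add)
  ultimately show ?case ..
qed simp

locale heavy_sample = heavy_tail L e \<gamma> \<kappa> x0 F + prob_space M
  for L e \<gamma> \<kappa> x0 F and M :: "'a measure" +
  fixes X :: "nat \<Rightarrow> 'a \<Rightarrow> real"
  assumes X_indep: "indep_vars (\<lambda>_. borel) X UNIV"
    and X_distr: "\<And>i. distr M borel (X i) = F"
begin

lemma X_meas [measurable]: "X i \<in> borel_measurable M"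
  using X_indep by (auto simp: indep_vars_def)

lemma X_expectation: "f \<in> borel_measurable borel \<Longrightarrow> expectation (\<lambda>\<omega>. f (X i \<omega>)) = (LINT x|F. f x)"
  for f :: "real \<Rightarrow> 'b :: {banach, second_countable_topology}"
  unfolding X_distr[of i, symmetric] by (subst integral_distr) auto

lemma X_integrable: "integrable F f \<Longrightarrow> integrable M (\<lambda>\<omega>. f (X i \<omega>))"
  for f :: "real \<Rightarrow> real"
  unfolding X_distr[of i, symmetric] by (rule integrable_distr[rotated]) auto

lemma X_prob: "A \<in> sets borel \<Longrightarrow> \<P>(\<omega> in M. X i \<omega> \<in> A) = measure F A"
  unfolding X_distr[of i, symmetric] by (subst measure_distr) (auto simp: vimage_def Int_def conj_commute)

definition \<mu> :: real where "\<mu> = (LINT x|F. x)"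
definition trunc_mean :: "real \<Rightarrow> real" where "trunc_mean z = (LINT x|F. min x z)"

lemma min_integrable: "integrable F (\<lambda>x. min x z)"
  by (intro integrable_min integ) auto

lemma trunc_mean_eq: "trunc_mean z = \<mu> - excess z"
proof -
  have "min x z = x - max 0 (x - z)" for x :: real by auto
  thus ?thesis unfolding trunc_mean_def \<mu>_def excess_def using integ excess_integrable by simp
qed

lemma trunc_mean_nonneg: "z \<ge> 0 \<Longrightarrow> trunc_mean z \<ge> 0"
  unfolding trunc_mean_def using pos by (intro integral_nonneg_AE) (auto elim!: eventually_mono)

lemma trunc_square_nonneg: "trunc_square z \<ge> 0" unfolding trunc_square_def by simp

text \<open>Stated for an arbitrary finite index set, because one observation is left out in the large-deviation
  estimates.\<close>

lemma truncated_chebyshev: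
  assumes I: "finite I" and z: "z \<ge> 0" and r: "r > 0"
  shows "\<P>(\<omega> in M. \<bar>(\<Sum>i\<in>I. min (X i \<omega>) z) - card I * trunc_mean z\<bar> \<ge> r) \<le> card I * trunc_square z / r\<^sup>2"
proof -
  define Y where "Y i \<omega> = min (X i \<omega>) z - trunc_mean z" for i \<omega>
  have indep: "indep_vars (\<lambda>_. borel) Y I"
    unfolding Y_def using indep_vars_subset[OF X_indep, of I] by (intro indep_vars_compose2[where Y = "\<lambda>_ x. min x z - trunc_mean z"]) auto
  have sq: "(min x z - trunc_mean z)\<^sup>2 = (min x z)\<^sup>2 - (2 * trunc_mean z * min x z - (trunc_mean z)\<^sup>2)" for x by (simp add: power2_diff)
  have intF: "integrable F (\<lambda>x. (min x z - trunc_mean z)\<^sup>2)" unfolding sq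
    using min_sq_integrable[OF z] min_integrable by (intro Bochner_Integration.integrable_diff integrable_mult_right) auto
  have int1: "integrable M (Y i)" for i unfolding Y_def by (rule X_integrable) (use min_integrable in auto)
  have int2: "integrable M (\<lambda>\<omega>. (Y i \<omega>)\<^sup>2)" for i unfolding Y_def by (rule X_integrable[OF intF])
  have E0: "expectation (Y i) = 0" for i
    unfolding Y_def using X_expectation[of "\<lambda>x. min x z - trunc_mean z" i] min_integrable F.prob_space by (simp add: trunc_mean_def)
  have E2: "expectation (\<lambda>\<omega>. (Y i \<omega>)\<^sup>2) \<le> trunc_square z" for i
  proof -
    have "expectation (\<lambda>\<omega>. (Y i \<omega>)\<^sup>2) = (LINT x|F. (min x z - trunc_mean z)\<^sup>2)"
      unfolding Y_def by (rule X_expectation) auto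
    also have "\<dots> = trunc_square z - (2 * trunc_mean z * trunc_mean z - (trunc_mean z)\<^sup>2)" unfolding sq
      using min_sq_integrable[OF z] min_integrable F.prob_space by (simp add: trunc_square_def trunc_mean_def)
    also have "\<dots> \<le> trunc_square z" by (simp add: power2_eq_square)
    finally show ?thesis .
  qed
  have mom: "integrable M (\<lambda>\<omega>. (\<Sum>i\<in>I. Y i \<omega>)\<^sup>2)"
    "expectation (\<lambda>\<omega>. (\<Sum>i\<in>I. Y i \<omega>)\<^sup>2) = (\<Sum>i\<in>I. expectation (\<lambda>\<omega>. (Y i \<omega>)\<^sup>2))"
    using indep_sum_second_moment[OF I indep int1 int2 E0] by auto
  have ES: "expectation (\<lambda>\<omega>. \<Sum>i\<in>I. Y i \<omega>) = 0" using int1 E0 by simp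
  have Ymeas: "(\<lambda>\<omega>. \<Sum>i\<in>I. Y i \<omega>) \<in> borel_measurable M" unfolding Y_def by measurable
  have eq: "(\<Sum>i\<in>I. min (X i \<omega>) z) - card I * trunc_mean z = (\<Sum>i\<in>I. Y i \<omega>)" for \<omega>
    by (simp add: Y_def sum_subtractf)
  have "\<P>(\<omega> in M. \<bar>(\<Sum>i\<in>I. Y i \<omega>)\<bar> \<ge> r) \<le> expectation (\<lambda>\<omega>. (\<Sum>i\<in>I. Y i \<omega>)\<^sup>2) / r\<^sup>2"
    using Chebyshev_inequality[OF Ymeas mom(1) r] by (simp add: ES)
  also have "\<dots> \<le> card I * trunc_square z / r\<^sup>2" unfolding mom(2) using sum_mono[of I "\<lambda>i. expectation (\<lambda>\<omega>. (Y i \<omega>)\<^sup>2)" "\<lambda>_. trunc_square z"] E2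
    by (intro divide_right_mono) auto
  finally show ?thesis unfolding eq .
qed

text \<open>The normed and centred sum whose law converges.\<close>

definition W :: "nat \<Rightarrow> 'a \<Rightarrow> real" where "W n \<omega> = (\<Sum>i<n. X i \<omega> / s n - m n)"

lemma W_meas [measurable]: "W n \<in> borel_measurable M" unfolding W_def by measurable

lemma char_W: "char (distr M borel (W n)) t = summand_char n t ^ n"
proof -
  have "indep_vars (\<lambda>_. borel) (\<lambda>i \<omega>. X i \<omega> / s n - m n) {..<n}"
    using indep_vars_subset[OF X_indep, of "{..<n}"] by (intro indep_vars_compose2[where Y = "\<lambda>_ x. x / s n - m n"]) auto
  hence "char (distr M borel (W n)) t = (\<Prod>i<n. char (distr M borel (\<lambda>\<omega>. X i \<omega> / s n - m n)) t)"
    unfolding W_def by (rule char_distr_sum)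
  moreover have "char (distr M borel (\<lambda>\<omega>. X i \<omega> / s n - m n)) t = summand_char n t" for i
  proof -
    have "char (distr M borel (\<lambda>\<omega>. X i \<omega> / s n - m n)) t = (CLINT \<omega>|M. iexp (t * (X i \<omega> / s n - m n)))"
      unfolding char_def by (subst integral_distr) auto
    also have "\<dots> = summand_char n t" unfolding summand_char_def by (rule X_expectation) measurable
    finally show ?thesis .
  qed
  ultimately show ?thesis by simp
qed

text \<open>The inequality \<open>|min x R - sin x| \<le> 2 (min x R)\<^sup>2\<close> for \<open>x \<ge> 0\<close> is integrated. Together with
  \<open>n_trunc_square_s\<close> it shows that the two ways of centring one summand differ by \<open>O (1 / n)\<close>.\<close>

lemma sin_centering_error: "\<bar>trunc_mean (s n * R) / s n - m n\<bar> \<le> 2 * trunc_square (s n * R) / (s n)\<^sup>2" if R: "R \<ge> 1"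
proof -
  have sp: "s n > 0" by (rule s_pos)
  have pw: "\<bar>min x (s n * R) / s n - sin (x / s n)\<bar> \<le> 2 * ((min x (s n * R))\<^sup>2 / (s n)\<^sup>2)" if x: "x > 0" for x
  proof -
    have mm: "min x (s n * R) / s n = min (x / s n) R" using sp by (auto simp: min_def field_simps)
    have "\<bar>min (x / s n) R - sin (x / s n)\<bar> \<le> 2 * (min (x / s n) R)\<^sup>2"
    proof (cases "x / s n \<le> R")
      case True
      have "\<bar>sin (x / s n) - x / s n\<bar> \<le> (x / s n)\<^sup>2 / 2" by (rule sin_approx)
      also have "\<dots> \<le> 2 * (x / s n)\<^sup>2" by simp
      finally show ?thesis using True by (simp add: abs_minus_commute)
    next
      case False
      have "\<bar>R - sin (x / s n)\<bar> \<le> R + 1" using R sin_le_one[of "x / s n"] sin_ge_minus_one[of "x / s n"] by linarith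
      also have "\<dots> \<le> 2 * R\<^sup>2" using R mult_left_mono[of 1 R R] unfolding power2_eq_square by linarith
      finally show ?thesis using False by simp
    qed
    thus ?thesis by (simp add: mm[symmetric] power_divide)
  qed
  have int: "integrable F (\<lambda>x. min x (s n * R) / s n)" "integrable F (\<lambda>x. sin (x / s n))"
    using min_integrable by (auto intro!: F.integrable_const_bound[where B = 1])
  have eq: "trunc_mean (s n * R) / s n - m n = (LINT x|F. min x (s n * R) / s n - sin (x / s n))"
    using int by (simp add: trunc_mean_def m_def)
  have "\<bar>trunc_mean (s n * R) / s n - m n\<bar> \<le> (LINT x|F. \<bar>min x (s n * R) / s n - sin (x / s n)\<bar>)"
    unfolding eq by (rule integral_norm_bound[of F "\<lambda>x. min x (s n * R) / s n - sin (x / s n)", unfolded real_norm_def])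
  also have "\<dots> \<le> (LINT x|F. 2 * ((min x (s n * R))\<^sup>2 / (s n)\<^sup>2))"
  proof (rule integral_mono_AE)
    show "AE x in F. \<bar>min x (s n * R) / s n - sin (x / s n)\<bar> \<le> 2 * ((min x (s n * R))\<^sup>2 / (s n)\<^sup>2)"
      using pos by eventually_elim (rule pw)
    show "integrable F (\<lambda>x. \<bar>min x (s n * R) / s n - sin (x / s n)\<bar>)"
      by (intro integrable_abs Bochner_Integration.integrable_diff int)
    show "integrable F (\<lambda>x. 2 * ((min x (s n * R))\<^sup>2 / (s n)\<^sup>2))" 
      using sp R by (intro integrable_mult_right integrable_divide_zero min_sq_integrable) auto
  qed
  finally show ?thesis by (simp add: trunc_square_def)
qed

lemma some_exceeds: "\<P>(\<omega> in M. \<exists>i<n. X i \<omega> > z) \<le> real n * Fbar z"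
proof -
  have "{\<omega> \<in> space M. \<exists>i<n. X i \<omega> > z} = (\<Union>i<n. {\<omega> \<in> space M. X i \<omega> > z})" by auto
  hence "\<P>(\<omega> in M. \<exists>i<n. X i \<omega> > z) \<le> (\<Sum>i<n. \<P>(\<omega> in M. X i \<omega> > z))"
    by (simp only:) (intro finite_measure_subadditive_finite, auto)
  moreover have "\<P>(\<omega> in M. X i \<omega> > z) = Fbar z" for i using X_prob[of "{z<..}" i] by simp
  ultimately show ?thesis by simp
qed

text \<open>Truncation at \<open>s n * R\<close>: for large \<open>n\<close>, all observations stay below this level with probability at least \<open>1 - 1 / R\<close>,
  and the truncated sum has standard deviation of order \<open>s n * sqrt R\<close>.\<close>

lemma W_tight: "\<epsilon> > 0 \<Longrightarrow> \<exists>r. eventually (\<lambda>n. \<P>(\<omega> in M. \<bar>W n \<omega>\<bar> \<ge> r) < \<epsilon>) sequentially"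
proof -
  assume \<epsilon>: "\<epsilon> > 0"
  obtain C where C: "C > 0" "\<And>y. y > 0 \<Longrightarrow> eventually (\<lambda>n. real n * trunc_square (s n * y) / (s n)\<^sup>2 \<le> C * y) sequentially"
    using n_trunc_square_s by blast
  \<comment> \<open>The two error terms below add up to \<open>(1 + C) / R\<close>.\<close>
  define R where "R = max 1 (2 * (1 + C) / \<epsilon>)"
  have R: "R \<ge> 1" "(1 + C) / R < \<epsilon>"
  proof -
    show "R \<ge> 1" by (simp add: R_def)
    have "2 * (1 + C) / \<epsilon> \<le> R" by (simp add: R_def)
    hence "2 * (1 + C) \<le> \<epsilon> * R" using \<epsilon> by (simp add: field_simps)
    moreover have "1 + C < 2 * (1 + C)" using C(1) by simp
    ultimately have "1 + C < \<epsilon> * R" by (rule less_le_trans[rotated])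
    thus "(1 + C) / R < \<epsilon>" using \<open>R \<ge> 1\<close> by (simp add: field_simps)
  qed
  have "1 / R * (2 / pi) < 1 / R" using R pi_gt3 by (simp add: field_simps)
  hence "eventually (\<lambda>n. real n * Fbar (s n * R) < 1 / R) sequentially"
    using n_Fbar_s[of R] R by (intro order_tendstoD(2)) auto
  moreover have "eventually (\<lambda>n. real n * trunc_square (s n * R) / (s n)\<^sup>2 \<le> C * R) sequentially" using C(2)[of R] R by simp
  ultimately have "eventually (\<lambda>n. \<P>(\<omega> in M. \<bar>W n \<omega>\<bar> \<ge> R + 2 * C * R) < \<epsilon>) sequentially"
  proof eventually_elim
    case (elim n)
    have sp: "s n > 0" by (rule s_pos)
    let ?A = "{\<omega> \<in> space M. \<exists>i<n. X i \<omega> > s n * R}"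
    let ?B = "{\<omega> \<in> space M. \<bar>(\<Sum>i<n. min (X i \<omega>) (s n * R)) - card {..<n} * trunc_mean (s n * R)\<bar> \<ge> s n * R}"
    have sub: "{\<omega> \<in> space M. \<bar>W n \<omega>\<bar> \<ge> R + 2 * C * R} \<subseteq> ?A \<union> ?B"
    proof safe
      fix \<omega> assume \<omega>: "\<omega> \<in> space M" "\<bar>W n \<omega>\<bar> \<ge> R + 2 * C * R" "\<not> s n * R \<le> \<bar>(\<Sum>i<n. min (X i \<omega>) (s n * R)) - card {..<n} * trunc_mean (s n * R)\<bar>"
      show "\<exists>i<n. s n * R < X i \<omega>"
      proof (rule ccontr)
        assume "\<not> (\<exists>i<n. s n * R < X i \<omega>)"
        hence "(\<Sum>i<n. min (X i \<omega>) (s n * R)) = (\<Sum>i<n. X i \<omega>)" by (intro sum.cong) auto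
        hence 1: "\<bar>(\<Sum>i<n. X i \<omega>) - n * trunc_mean (s n * R)\<bar> < s n * R" using \<omega> by simp
        have W_eq: "W n \<omega> = ((\<Sum>i<n. X i \<omega>) - n * trunc_mean (s n * R)) / s n + n * (trunc_mean (s n * R) / s n - m n)"
          by (simp add: W_def sum_subtractf sum_divide_distrib[symmetric] diff_divide_distrib algebra_simps)
        have b1: "\<bar>((\<Sum>i<n. X i \<omega>) - n * trunc_mean (s n * R)) / s n\<bar> < R" using 1 sp by (simp add: abs_divide field_simps)
        have b2: "\<bar>n * (trunc_mean (s n * R) / s n - m n)\<bar> \<le> 2 * C * R"
        proof -
          have "\<bar>n * (trunc_mean (s n * R) / s n - m n)\<bar> = n * \<bar>trunc_mean (s n * R) / s n - m n\<bar>" by (simp add: abs_mult)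
          also have "\<dots> \<le> n * (2 * trunc_square (s n * R) / (s n)\<^sup>2)" by (intro mult_left_mono sin_centering_error R) auto
          also have "\<dots> = 2 * (real n * trunc_square (s n * R) / (s n)\<^sup>2)" by simp
          also have "\<dots> \<le> 2 * (C * R)" using elim by linarith
          finally show ?thesis by simp
        qed
        have "\<bar>W n \<omega>\<bar> < R + 2 * C * R"
          unfolding W_eq by (rule le_less_trans[OF abs_triangle_ineq add_less_le_mono[OF b1 b2]])
        thus False using \<omega>(2) by simp
      qed
    qed
    have "\<P>(\<omega> in M. \<bar>W n \<omega>\<bar> \<ge> R + 2 * C * R) \<le> prob (?A \<union> ?B)" by (intro finite_measure_mono sub) measurable
    also have "\<dots> \<le> prob ?A + prob ?B" by (intro measure_Un_le) measurable
    also have "\<dots> \<le> real n * Fbar (s n * R) + card {..<n} * trunc_square (s n * R) / (s n * R)\<^sup>2"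
      using sp R by (intro add_mono some_exceeds truncated_chebyshev) auto
    also have "card {..<n} * trunc_square (s n * R) / (s n * R)\<^sup>2 = (real n * trunc_square (s n * R) / (s n)\<^sup>2) / R\<^sup>2" by (simp add: power_mult_distrib)
    also have "\<dots> \<le> C * R / R\<^sup>2" using elim by (intro divide_right_mono) auto
    also have "\<dots> = C / R" using R by (simp add: power2_eq_square)
    also have "real n * Fbar (s n * R) + C / R \<le> 1 / R + C / R" using elim by simp
    also have "\<dots> < \<epsilon>" using R by (simp add: add_divide_distrib)
    finally show ?case by simp
  qed
  thus ?thesis by blast
qed

end

section \<open>Weak convergence to the Cauchy limit law\<close>

text \<open>The finitely many initial laws are tight individually.\<close>

lemma tight_if_eventually_tight:
  assumes rd: "\<And>n. real_distribution (\<mu> n)"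
    and ev: "\<And>\<epsilon>. \<epsilon> > 0 \<Longrightarrow> \<exists>r. eventually (\<lambda>n. measure (\<mu> n) {x. \<bar>x\<bar> \<ge> r} < \<epsilon>) sequentially"
  shows "tight \<mu>"
  unfolding tight_def
proof (intro conjI allI impI rd)
  fix \<epsilon> :: real assume \<epsilon>: "\<epsilon> > 0"
  interpret real_distribution "\<mu> n" for n by (rule rd)
  obtain r N where r: "\<And>n. n \<ge> N \<Longrightarrow> measure (\<mu> n) {x. \<bar>x\<bar> \<ge> r} < \<epsilon>"
    using ev[OF \<epsilon>] by (auto simp: eventually_sequentially)
  have "\<exists>r. measure (\<mu> n) {x. \<bar>x\<bar> \<ge> r} < \<epsilon>" for n
  proof -
    have "(\<lambda>k. measure (\<mu> n) {x. \<bar>x\<bar> \<ge> real k}) \<longlonglongrightarrow> measure (\<mu> n) (\<Inter>k. {x. \<bar>x\<bar> \<ge> real k})"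
      by (intro finite_Lim_measure_decseq) (auto simp: decseq_def)
    moreover have "(\<Inter>k. {x::real. \<bar>x\<bar> \<ge> real k}) = {}"
    proof safe
      fix x :: real assume "x \<in> (\<Inter>k. {x. \<bar>x\<bar> \<ge> real k})"
      moreover obtain k where "\<bar>x\<bar> < real k" using reals_Archimedean2 by blast
      ultimately show "x \<in> {}" by (auto dest!: spec[of _ k])
    qed
    ultimately have "eventually (\<lambda>k. measure (\<mu> n) {x. \<bar>x\<bar> \<ge> real k} < \<epsilon>) sequentially"
      using \<epsilon> by (intro order_tendstoD(2)[of _ 0]) auto
    thus ?thesis by (auto simp: eventually_sequentially)
  qed
  then obtain q where q: "\<And>n. measure (\<mu> n) {x. \<bar>x\<bar> \<ge> q n} < \<epsilon>" by metis
  define R where "R = Max (insert 1 (insert r (q ` {..<N})))"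
  have R: "R \<ge> 1" "R \<ge> r" "\<And>n. n < N \<Longrightarrow> R \<ge> q n" unfolding R_def by (intro Max_ge; auto)+
  have "measure (\<mu> n) {-R<..R} > 1 - \<epsilon>" for n
  proof -
    define t where "t = (if n < N then q n else r)"
    have t: "measure (\<mu> n) {x. \<bar>x\<bar> \<ge> t} < \<epsilon>" "t \<le> R" using q r R by (auto simp: t_def)
    have "measure (\<mu> n) (UNIV - {-R<..R}) = 1 - measure (\<mu> n) {-R<..R}"
      using prob_compl[of "{-R<..R}" n] by simp
    moreover have "measure (\<mu> n) (UNIV - {-R<..R}) \<le> measure (\<mu> n) {x. \<bar>x\<bar> \<ge> t}"
      using t by (intro finite_measure_mono) auto
    ultimately show ?thesis using t by linarith
  qed
  thus "\<exists>a b. a < b \<and> (\<forall>n. measure (\<mu> n) {a<..b} > 1 - \<epsilon>)" using R by (intro exI[of _ "-R"] exI[of _ R]) auto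
qed

context heavy_sample
begin

text \<open>That the given function is a characteristic function is not presupposed: a limit point of the tight
  sequence has it as its characteristic function, and then Levy's theorem gives convergence of the whole
  sequence.\<close>

lemma W_limit_law: "\<exists>S. cauchy_limit_law S \<and> weak_conv_m (\<lambda>n. distr M borel (W n)) S"
proof -
  define \<nu> where "\<nu> n = distr M borel (W n)" for n
  have rd: "real_distribution (\<nu> n)" for n unfolding \<nu>_def by (rule real_distribution_distr) measurable
  have tight: "tight \<nu>"
  proof (rule tight_if_eventually_tight[OF rd])
    fix \<epsilon> :: real assume "\<epsilon> > 0"
    moreover have "measure (\<nu> n) {x. \<bar>x\<bar> \<ge> r} = \<P>(\<omega> in M. \<bar>W n \<omega>\<bar> \<ge> r)" for n r
      unfolding \<nu>_def by (subst measure_distr) (auto intro!: arg_cong[where f = prob])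
    ultimately show "\<exists>r. eventually (\<lambda>n. measure (\<nu> n) {x. \<bar>x\<bar> \<ge> r} < \<epsilon>) sequentially" using W_tight by simp
  qed
  have char_lim: "(\<lambda>n. char (\<nu> n) t) \<longlonglongrightarrow> exp (log_char t)" for t
    unfolding \<nu>_def char_W by (rule summand_char_power_limit)
  obtain r S where rS: "strict_mono r" "real_distribution S" "weak_conv_m (\<nu> \<circ> id \<circ> r) S"
    using tight_imp_convergent_subsubsequence[OF tight, of id] by (auto simp: strict_mono_id)
  have char_S: "char S t = exp (log_char t)" for t
  proof (rule LIMSEQ_unique)
    show "(\<lambda>n. char ((\<nu> \<circ> id \<circ> r) n) t) \<longlonglongrightarrow> char S t" by (rule levy_continuity1) (use rS rd in \<open>auto simp: comp_def\<close>)
    show "(\<lambda>n. char ((\<nu> \<circ> id \<circ> r) n) t) \<longlonglongrightarrow> exp (log_char t)"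
      using LIMSEQ_subseq_LIMSEQ[OF char_lim rS(1)] by (simp add: comp_def)
  qed
  have "cauchy_limit_law S" unfolding cauchy_limit_law_def using rS char_S by (simp add: log_char_def)
  moreover have "weak_conv_m \<nu> S" by (rule levy_continuity) (use rS rd char_S char_lim in auto)
  ultimately show ?thesis unfolding \<nu>_def by blast
qed

end

lemma (in prob_space) pointwise_tends_to_zero_in_prob:
  assumes [measurable]: "\<And>n. R n \<in> borel_measurable M"
    and lim: "\<And>\<omega>. \<omega> \<in> space M \<Longrightarrow> (\<lambda>n. R n \<omega>) \<longlonglongrightarrow> 0"
  shows "tends_to_zero_in_prob M R"
  unfolding tends_to_zero_in_prob_def
proof (intro conjI allI impI)
  fix e :: real assume e: "e > 0"
  have "(\<lambda>n. LINT \<omega>|M. indicator {\<omega> \<in> space M. \<bar>R n \<omega>\<bar> > e} \<omega> :: real) \<longlonglongrightarrow> (LINT \<omega>|M. 0)"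
  proof (rule integral_dominated_convergence[where w = "\<lambda>_. 1"])
    show "AE \<omega> in M. (\<lambda>n. indicator {\<omega> \<in> space M. \<bar>R n \<omega>\<bar> > e} \<omega> :: real) \<longlonglongrightarrow> 0"
    proof (rule AE_I2)
      fix \<omega> assume "\<omega> \<in> space M"
      hence "eventually (\<lambda>n. \<bar>R n \<omega>\<bar> < e) sequentially" using tendstoD[OF lim e] by (simp add: dist_real_def)
      thus "(\<lambda>n. indicator {\<omega> \<in> space M. \<bar>R n \<omega>\<bar> > e} \<omega> :: real) \<longlonglongrightarrow> 0"
        by (intro tendsto_eventually) (auto elim!: eventually_mono)
    qed
  qed (auto simp: indicator_def)
  thus "(\<lambda>n. measure M {\<omega> \<in> space M. \<bar>R n \<omega>\<bar> > e}) \<longlonglongrightarrow> 0" by simp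
qed measurable

text \<open>Skorohod's theorem provides copies of the \<open>W n\<close> on one probability space that converge pointwise.\<close>

lemma (in prob_space) eq_in_distr_of_weak_conv:
  assumes W [measurable]: "\<And>n. W n \<in> borel_measurable M"
    and S: "cauchy_limit_law S" and conv: "weak_conv_m (\<lambda>n. distr M borel (W n)) S"
    and u: "u \<longlonglongrightarrow> 1"
    and Y: "eventually (\<lambda>n. \<forall>\<omega>\<in>space M. Y n \<omega> = d n + u n * W n \<omega>) sequentially"
  shows "eq_in_distr_cauchy_op M Y d"
proof -
  have "real_distribution (distr M borel (W n))" for n by (rule real_distribution_distr) measurable
  moreover have "real_distribution S" using S by (simp add: cauchy_limit_law_def)
  ultimately obtain N :: "real measure" and Z \<epsilon> where N: "prob_space N" "\<And>n. Z n \<in> measurable N borel"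
    "\<And>n. distr N borel (Z n) = distr M borel (W n)" "\<epsilon> \<in> measurable N lborel" "distr N borel \<epsilon> = S"
    "\<And>x. x \<in> space N \<Longrightarrow> (\<lambda>n. Z n x) \<longlonglongrightarrow> \<epsilon> x"
    using Skorohod[OF _ _ conv] by blast
  interpret N: prob_space N by fact
  note [measurable] = N(2)
  have eps [measurable]: "\<epsilon> \<in> borel_measurable N" using N(4) by simp
  define R where "R n \<omega> = u n * Z n \<omega> - \<epsilon> \<omega>" for n \<omega>
  have "tends_to_zero_in_prob N R"
  proof (rule N.pointwise_tends_to_zero_in_prob)
    show "R n \<in> borel_measurable N" for n unfolding R_def by measurable
    fix \<omega> assume "\<omega> \<in> space N"
    hence "(\<lambda>n. u n * Z n \<omega> - \<epsilon> \<omega>) \<longlonglongrightarrow> 1 * \<epsilon> \<omega> - \<epsilon> \<omega>" by (intro tendsto_intros u N)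
    thus "(\<lambda>n. R n \<omega>) \<longlonglongrightarrow> 0" by (simp add: R_def)
  qed
  moreover have "eventually (\<lambda>n. distr M borel (Y n) = distr N borel (\<lambda>\<omega>. d n + \<epsilon> \<omega> + R n \<omega>)) sequentially"
    using Y
  proof eventually_elim
    case (elim n)
    have "distr M borel (Y n) = distr M borel (\<lambda>\<omega>. d n + u n * W n \<omega>)" using elim by (intro distr_cong) auto
    also have "\<dots> = distr (distr M borel (W n)) borel (\<lambda>x. d n + u n * x)" by (subst distr_distr) (auto simp: comp_def)
    also have "\<dots> = distr (distr N borel (Z n)) borel (\<lambda>x. d n + u n * x)" by (simp add: N)
    also have "\<dots> = distr N borel (\<lambda>\<omega>. d n + u n * Z n \<omega>)" by (subst distr_distr) (auto simp: comp_def)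
    also have "\<dots> = distr N borel (\<lambda>\<omega>. d n + \<epsilon> \<omega> + R n \<omega>)" by (simp add: R_def)
    finally show ?case .
  qed
  ultimately show ?thesis unfolding eq_in_distr_cauchy_op_def using N(1,5) S eps by blast
qed

context heavy_sample
begin

section \<open>Centring at the mean\<close>

text \<open>The centring for which \<open>((\<Sum>i<n. X i \<omega>) - n * \<mu>) / s n = W n \<omega> - c n\<close>.\<close>

definition c :: "nat \<Rightarrow> real" where "c n = real n * (\<mu> / s n - m n)"

text \<open>Up to a bounded error, \<open>c n\<close> is \<open>n * excess (s n) / s n\<close>; here \<open>n / s n = L (s n)\<close> cancels the factor \<open>L\<close> in
  \<open>tail_D (s n)\<close>.\<close>

lemma c_asymp: "(\<lambda>n. c n / (K * ln (real n) powr (1 - \<gamma>))) \<longlonglongrightarrow> 1"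
proof -
  obtain C where C: "C > 0" "\<And>y. y > 0 \<Longrightarrow> eventually (\<lambda>n. real n * trunc_square (s n * y) / (s n)\<^sup>2 \<le> C * y) sequentially"
    using n_trunc_square_s by blast
  define l where "l n = ln (real n) powr (1 - \<gamma>)" for n
  have l_top: "filterlim l at_top sequentially" unfolding l_def using gamma by real_asymp
  have lp: "eventually (\<lambda>n. l n > 0) sequentially" using l_top by (simp add: filterlim_at_top_dense)
  have ratio: "(\<lambda>n. ln (s n) powr (1 - \<gamma>) / l n) \<longlonglongrightarrow> 1"
  proof -
    have "(\<lambda>n. (ln (s n) / ln (real n)) powr (1 - \<gamma>)) \<longlonglongrightarrow> 1 powr (1 - \<gamma>)"
      unfolding s_def by (intro tendsto_powr filterlim_compose[OF ln_g_inv_ratio filterlim_real_sequentially] tendsto_const) auto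
    moreover have "eventually (\<lambda>n. (ln (s n) / ln (real n)) powr (1 - \<gamma>) = ln (s n) powr (1 - \<gamma>) / l n) sequentially"
      using eventually_ge_at_top[of 1] by eventually_elim (use s_pos in \<open>auto simp: l_def intro!: powr_divide\<close>)
    ultimately have "(\<lambda>n. ln (s n) powr (1 - \<gamma>) / l n) \<longlonglongrightarrow> 1 powr (1 - \<gamma>)" by (rule Lim_transform_eventually)
    thus ?thesis by simp
  qed
  have main: "(\<lambda>n. (real n * excess (s n) / s n) / l n) \<longlonglongrightarrow> K"
  proof -
    have "(\<lambda>n. (excess (s n) / tail_D (s n)) * (ln (s n) powr (1 - \<gamma>) / l n)) \<longlonglongrightarrow> K * 1"
      by (intro tendsto_mult ratio filterlim_compose[OF excess_asymp s_at_top])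
    moreover have "eventually (\<lambda>n. s n \<ge> x0) sequentially" using s_at_top by (simp add: filterlim_at_top)
    hence "eventually (\<lambda>n. (excess (s n) / tail_D (s n)) * (ln (s n) powr (1 - \<gamma>) / l n) = (real n * excess (s n) / s n) / l n) sequentially"
      using eventually_g_s
    proof eventually_elim
      case (elim n)
      have "L (s n) > 0" using elim by (intro L_pos)
      moreover have "ln (s n) > 0" using s_pos[of n] by simp
      moreover have "real n = s n * L (s n)" using elim by (simp add: g_def)
      ultimately show ?case using s_pos[of n] by (simp add: tail_D_def)
    qed
    ultimately have "(\<lambda>n. (real n * excess (s n) / s n) / l n) \<longlonglongrightarrow> K * 1" by (rule Lim_transform_eventually)
    thus ?thesis by simp
  qed
  have err: "(\<lambda>n. (c n - real n * excess (s n) / s n) / l n) \<longlonglongrightarrow> 0"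
  proof (rule Lim_null_comparison)
    show "(\<lambda>n. 2 * C * inverse (l n)) \<longlonglongrightarrow> 0"
      using tendsto_mult[OF tendsto_const[of "2 * C"] tendsto_inverse_0_at_top[OF l_top]] by simp
    show "eventually (\<lambda>n. norm ((c n - real n * excess (s n) / s n) / l n) \<le> 2 * C * inverse (l n)) sequentially"
      using C(2)[of 1, simplified] lp
    proof eventually_elim
      case (elim n)
      have "c n - real n * excess (s n) / s n = real n * (trunc_mean (s n * 1) / s n - m n)"
        by (simp add: c_def trunc_mean_eq diff_divide_distrib algebra_simps)
      hence "\<bar>c n - real n * excess (s n) / s n\<bar> = real n * \<bar>trunc_mean (s n * 1) / s n - m n\<bar>" by (simp add: abs_mult)
      also have "\<dots> \<le> real n * (2 * trunc_square (s n * 1) / (s n)\<^sup>2)" by (intro mult_left_mono sin_centering_error) auto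
      also have "\<dots> = 2 * (real n * trunc_square (s n) / (s n)\<^sup>2)" by simp
      also have "\<dots> \<le> 2 * C" using elim by linarith
      finally show ?case using elim by (simp add: abs_divide field_simps)
    qed
  qed
  have "(\<lambda>n. ((real n * excess (s n) / s n) / l n + (c n - real n * excess (s n) / s n) / l n) / K) \<longlonglongrightarrow> (K + 0) / K"
    using K_pos by (intro tendsto_intros main err) auto
  moreover have "(A / l + (d - A) / l) / k = d / (k * l)" for A l d k :: real
    by (simp add: diff_divide_distrib mult.commute)
  ultimately have "(\<lambda>n. c n / (K * l n)) \<longlonglongrightarrow> (K + 0) / K" by (simp only:)
  moreover have "(K + 0) / K = 1" using K_pos by simp
  ultimately show ?thesis unfolding l_def by (simp only:)
qed

lemma sample_mean_W:
  assumes "n \<ge> 1" "v \<noteq> 0"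
  shows "(sample_mean X n \<omega> - \<mu>) / v = - (c n * ((g_inv (real n) / real n) / v)) + (g_inv (real n) / real n) / v * W n \<omega>"
proof -
  have sp: "s n > 0" by (rule s_pos)
  have "W n \<omega> - c n = ((\<Sum>i<n. X i \<omega>) - n * \<mu>) / s n"
    by (simp add: W_def c_def sum_subtractf sum_divide_distrib[symmetric] diff_divide_distrib algebra_simps)
  hence "(s n / real n) * (W n \<omega> - c n) = ((\<Sum>i<n. X i \<omega>) - n * \<mu>) / real n" using sp by simp
  also have "\<dots> = sample_mean X n \<omega> - \<mu>" using assms by (simp add: sample_mean_def diff_divide_distrib)
  finally have "sample_mean X n \<omega> - \<mu> = (s n / real n) * (W n \<omega> - c n)" ..
  hence "(sample_mean X n \<omega> - \<mu>) / v = (g_inv (real n) / real n) / v * (W n \<omega> - c n)" by (simp add: s_def)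
  also have "\<dots> = - (c n * ((g_inv (real n) / real n) / v)) + (g_inv (real n) / real n) / v * W n \<omega>"
    unfolding right_diff_distrib by (simp only: mult.commute[of _ "c n"] diff_conv_add_uminus add.commute)
  finally show ?thesis .
qed

text \<open>The conjugate \<open>g_inv x / x\<close> is multiplied by the ratio of the actual to the desired centring. As only
  integer arguments matter, the ratio can be extended as a step function, which is measurable.\<close>

lemma exists_exact_conjugate:
  "\<exists>Ld. de_bruijn_conjugate L Ld \<and>
        eq_in_distr_cauchy_op M (\<lambda>n \<omega>. (sample_mean X n \<omega> - \<mu>) / Ld (real n)) (\<lambda>n. - K * ln (real n) powr (1 - \<gamma>))"
proof -
  define \<rho> where "\<rho> n = c n / (K * ln (real n) powr (1 - \<gamma>))" for n
  have rho: "\<rho> \<longlonglongrightarrow> 1" unfolding \<rho>_def by (rule c_asymp)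
  define Ld where "Ld x = (g_inv x / x) * \<rho> (nat \<lfloor>x\<rfloor>)" for x
  have conj: "de_bruijn_conjugate L Ld"
  proof (rule conjugateI)
    show "Ld \<in> borel_measurable borel" unfolding Ld_def by measurable
    have "filterlim (\<lambda>x::real. nat \<lfloor>x\<rfloor>) sequentially at_top"
      by (rule filterlim_compose[OF filterlim_nat_sequentially filterlim_floor_sequentially])
    from filterlim_compose[OF rho this] have "((\<lambda>x::real. \<rho> (nat \<lfloor>x\<rfloor>)) \<longlongrightarrow> 1) at_top" .
    moreover have "eventually (\<lambda>x. \<rho> (nat \<lfloor>x\<rfloor>) = Ld x / (g_inv x / x)) at_top"
      using eventually_gt_at_top[of 0]
    proof eventually_elim
      case (elim x)
      have "g_inv x > 0" using g_inv(1)[of x] mono_from(2) by linarith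
      thus ?case using elim by (simp add: Ld_def)
    qed
    ultimately show "((\<lambda>x. Ld x / (g_inv x / x)) \<longlongrightarrow> 1) at_top" by (rule Lim_transform_eventually)
  qed
  obtain S where S: "cauchy_limit_law S" "weak_conv_m (\<lambda>n. distr M borel (W n)) S" using W_limit_law by blast
  have ev: "eventually (\<lambda>n. \<rho> n > 0 \<and> n \<ge> 2) sequentially"
    by (intro eventually_conj order_tendstoD(1)[OF rho] eventually_ge_at_top) auto
  have "eq_in_distr_cauchy_op M (\<lambda>n \<omega>. (sample_mean X n \<omega> - \<mu>) / Ld (real n)) (\<lambda>n. - K * ln (real n) powr (1 - \<gamma>))"
  proof (rule eq_in_distr_of_weak_conv[OF _ S, where u = "\<lambda>n. inverse (\<rho> n)"])
    show "(\<lambda>n. inverse (\<rho> n)) \<longlonglongrightarrow> 1" using tendsto_inverse[OF rho] by simp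
    show "eventually (\<lambda>n. \<forall>\<omega>\<in>space M. (sample_mean X n \<omega> - \<mu>) / Ld (real n) = - K * ln (real n) powr (1 - \<gamma>) + inverse (\<rho> n) * W n \<omega>) sequentially"
      using ev
    proof eventually_elim
      case (elim n)
      have ap: "g_inv (real n) > 0" using s_pos(1)[of n] by (simp add: s_def)
      have Ld_n: "Ld (real n) = g_inv (real n) / real n * \<rho> n" by (simp add: Ld_def)
      have q: "(g_inv (real n) / real n) / Ld (real n) = inverse (\<rho> n)" using ap elim by (simp add: Ld_n field_simps)
      have "c n = \<rho> n * (K * ln (real n) powr (1 - \<gamma>))" using K_pos elim by (simp add: \<rho>_def)
      hence "c n * inverse (\<rho> n) = K * ln (real n) powr (1 - \<gamma>)" using elim by simp
      moreover have "Ld (real n) \<noteq> 0" "1 \<le> n" using Ld_n ap elim by auto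
      ultimately have "(sample_mean X n \<omega> - \<mu>) / Ld (real n) = - (K * ln (real n) powr (1 - \<gamma>)) + inverse (\<rho> n) * W n \<omega>" for \<omega>
        using sample_mean_W[of n "Ld (real n)" \<omega>] unfolding q by metis
      thus ?case by simp
    qed
  qed measurable
  thus ?thesis using conj by blast
qed

lemma every_conjugate:
  assumes "de_bruijn_conjugate L Ld"
  shows "\<exists>r. r \<longlonglongrightarrow> 0 \<and>
           eq_in_distr_cauchy_op M (\<lambda>n \<omega>. (sample_mean X n \<omega> - \<mu>) / Ld (real n))
             (\<lambda>n. - K * ln (real n) powr (1 - \<gamma>) * (1 + r n))"
proof -
  define u where "u n = (g_inv (real n) / real n) / Ld (real n)" for n
  have u: "u \<longlonglongrightarrow> 1" unfolding u_def
    by (rule filterlim_compose[OF conjugate_unique[OF assms] filterlim_real_sequentially])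
  define r where "r n = c n / (K * ln (real n) powr (1 - \<gamma>)) * u n - 1" for n
  have "r \<longlonglongrightarrow> 1 * 1 - 1" unfolding r_def by (intro tendsto_intros c_asymp u)
  hence r0: "r \<longlonglongrightarrow> 0" by simp
  obtain S where S: "cauchy_limit_law S" "weak_conv_m (\<lambda>n. distr M borel (W n)) S" using W_limit_law by blast
  have ev: "eventually (\<lambda>n. u n > 0 \<and> n \<ge> 2) sequentially"
    by (intro eventually_conj order_tendstoD(1)[OF u] eventually_ge_at_top) auto
  have "eq_in_distr_cauchy_op M (\<lambda>n \<omega>. (sample_mean X n \<omega> - \<mu>) / Ld (real n))
             (\<lambda>n. - K * ln (real n) powr (1 - \<gamma>) * (1 + r n))"
  proof (rule eq_in_distr_of_weak_conv[OF _ S u])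
    show "eventually (\<lambda>n. \<forall>\<omega>\<in>space M. (sample_mean X n \<omega> - \<mu>) / Ld (real n) = - K * ln (real n) powr (1 - \<gamma>) * (1 + r n) + u n * W n \<omega>) sequentially"
      using ev
    proof eventually_elim
      case (elim n)
      have "Ld (real n) \<noteq> 0" using elim by (auto simp: u_def)
      moreover have "K * ln (real n) powr (1 - \<gamma>) * (1 + r n) = c n * u n" using K_pos elim by (simp add: r_def)
      ultimately have "(sample_mean X n \<omega> - \<mu>) / Ld (real n) = - (K * ln (real n) powr (1 - \<gamma>) * (1 + r n)) + u n * W n \<omega>" for \<omega>
        using elim sample_mean_W[of n "Ld (real n)" \<omega>] unfolding u_def by linarith
      thus ?case by simp
    qed
  qed measurable
  thus ?thesis using r0 by blast
qed

end

section \<open>The probability of exceeding the mean\<close>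

lemma divide_square_antimono: "0 \<le> c \<Longrightarrow> 0 < u \<Longrightarrow> u \<le> v \<Longrightarrow> c / v\<^sup>2 \<le> c / u\<^sup>2" for c u v :: real
  by (intro divide_left_mono power_mono mult_pos_pos zero_less_power) auto

context heavy_sample
begin

abbreviation prob_exceed :: "nat \<Rightarrow> real" where
  "prob_exceed n \<equiv> \<P>(\<omega> in M. (\<Sum>i<n. X i \<omega>) > n * \<mu>)"

lemma exceed_one_rest:
  assumes I: "finite I" "i \<in> I" and B: "B \<in> sets borel"
  shows "\<P>(\<omega> in M. X i \<omega> \<in> {y<..} \<and> (\<Sum>j\<in>I-{i}. min (X j \<omega>) z) \<in> B) =
    Fbar y * \<P>(\<omega> in M. (\<Sum>j\<in>I-{i}. min (X j \<omega>) z) \<in> B)"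
proof -
  define f where "f j x = (if j = i then x else min x z)" for j and x :: real
  have meas: "f j \<in> borel_measurable borel" for j unfolding f_def by (cases "j = i") auto
  have "indep_vars (\<lambda>_. borel) (\<lambda>j \<omega>. f j (X j \<omega>)) (insert i (I - {i}))"
    by (rule indep_vars_compose2[OF indep_vars_subset[OF X_indep subset_UNIV] meas])
  hence "indep_var borel (\<lambda>\<omega>. f i (X i \<omega>)) borel (\<lambda>\<omega>. \<Sum>j\<in>I-{i}. f j (X j \<omega>))"
    using I by (intro indep_vars_sum) auto
  moreover have "(\<Sum>j\<in>I-{i}. f j (X j \<omega>)) = (\<Sum>j\<in>I-{i}. min (X j \<omega>) z)" for \<omega>
    by (intro sum.cong) (auto simp: f_def)
  ultimately have "indep_var borel (X i) borel (\<lambda>\<omega>. \<Sum>j\<in>I-{i}. min (X j \<omega>) z)" by (simp add: f_def)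
  from prob_indep_random_variable[OF this, of "{y<..}" B] show ?thesis
    using B X_prob[of "{y<..}" i] by simp
qed

lemma two_exceed: "i \<noteq> j \<Longrightarrow> \<P>(\<omega> in M. X i \<omega> > y \<and> X j \<omega> > y) = (Fbar y)\<^sup>2"
proof -
  assume ij: "i \<noteq> j"
  have "prob (\<Inter>k\<in>{i, j}. X k -` {y<..} \<inter> space M) = (\<Prod>k\<in>{i, j}. prob (X k -` {y<..} \<inter> space M))"
    by (rule indep_varsD[OF X_indep]) auto
  also have "prob (X k -` {y<..} \<inter> space M) = Fbar y" for k
    using X_prob[of "{y<..}" k] by (simp add: vimage_def Int_def conj_commute)
  hence "(\<Prod>k\<in>{i, j}. prob (X k -` {y<..} \<inter> space M)) = (Fbar y)\<^sup>2" using ij by (simp add: power2_eq_square)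
  also have "(\<Inter>k\<in>{i, j}. X k -` {y<..} \<inter> space M) = {\<omega> \<in> space M. X i \<omega> > y \<and> X j \<omega> > y}" by auto
  finally show ?thesis .
qed

text \<open>If no observation exceeds \<open>y\<close>, then either all are at most \<open>z\<close>, or exactly one exceeds \<open>z\<close> and the
  others have to make up for \<open>y\<close>, or at least two exceed \<open>z\<close>. In the first two cases the sum of the truncated
  observations deviates from its mean by at least \<open>n * excess z\<close> and \<open>n * excess z - y\<close>, respectively, and the
  large observation is independent of the others.\<close>

lemma sum_excess_upper:
  assumes z: "z \<ge> 0" and d1: "real n * excess z > 0" and d2: "real n * excess z > y"
  shows "prob_exceed n \<le> real n * Fbar y + real n * trunc_square z / (real n * excess z)\<^sup>2
    + (real n * Fbar z) * (real n * trunc_square z / (real n * excess z - y)\<^sup>2) + (real n * Fbar z)\<^sup>2"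
proof -
  let ?Z = "\<lambda>I \<omega>. \<Sum>j\<in>I. min (X j \<omega>) z"
  let ?S = "{\<omega> \<in> space M. (\<Sum>i<n. X i \<omega>) > n * \<mu>}"
  let ?E1 = "{\<omega> \<in> space M. \<exists>i<n. X i \<omega> > y}"
  let ?E2 = "{\<omega> \<in> space M. ?Z {..<n} \<omega> > n * \<mu>}"
  let ?A = "\<lambda>i. {\<omega> \<in> space M. X i \<omega> \<in> {z<..} \<and> ?Z ({..<n} - {i}) \<omega> \<in> {n * \<mu> - y<..}}"
  let ?E3 = "\<Union>i<n. ?A i"
  let ?B = "\<lambda>p. {\<omega> \<in> space M. X (fst p) \<omega> > z \<and> X (snd p) \<omega> > z}"
  let ?P = "{p \<in> {..<n} \<times> {..<n}. fst p \<noteq> snd p}"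
  let ?E4 = "\<Union>p\<in>?P. ?B p"
  have finP: "finite ?P" by (rule finite_subset[of _ "{..<n} \<times> {..<n}"]) auto
  have cardP: "card ?P \<le> n * n" using card_mono[of "{..<n} \<times> {..<n}" ?P] by auto
  have "?S \<subseteq> ((?E1 \<union> ?E2) \<union> ?E3) \<union> ?E4"
  proof
    fix \<omega> assume \<omega>: "\<omega> \<in> ?S"
    show "\<omega> \<in> ((?E1 \<union> ?E2) \<union> ?E3) \<union> ?E4"
    proof (rule ccontr)
      assume nin: "\<omega> \<notin> ((?E1 \<union> ?E2) \<union> ?E3) \<union> ?E4"
      have le: "X i \<omega> \<le> y" if "i < n" for i
      proof (rule ccontr)
        assume "\<not> X i \<omega> \<le> y"
        hence "\<omega> \<in> ?E1" using that \<omega> by auto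
        thus False using nin by blast
      qed
      have uniq: "i = j" if "i < n" "j < n" "X i \<omega> > z" "X j \<omega> > z" for i j
      proof (rule ccontr)
        assume "i \<noteq> j"
        hence "(i, j) \<in> ?P" "\<omega> \<in> ?B (i, j)" using that \<omega> by auto
        thus False using nin by blast
      qed
      show False
      proof (cases "\<exists>i<n. X i \<omega> > z")
        case False
        hence "?Z {..<n} \<omega> = (\<Sum>i<n. X i \<omega>)" by (intro sum.cong) auto
        thus False using nin \<omega> by auto
      next
        case True
        then obtain i where i: "i < n" "X i \<omega> > z" by auto
        have "?Z ({..<n} - {i}) \<omega> = (\<Sum>j\<in>{..<n} - {i}. X j \<omega>)"
          using uniq i by (intro sum.cong) (auto simp: min_def not_le dest: less_imp_le)
        moreover have "(\<Sum>i<n. X i \<omega>) = X i \<omega> + (\<Sum>j\<in>{..<n} - {i}. X j \<omega>)" using i by (intro sum.remove) auto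
        ultimately have "?Z ({..<n} - {i}) \<omega> > n * \<mu> - y" using \<omega> le[of i] i by auto
        hence "\<omega> \<in> ?A i" using i \<omega> by auto
        thus False using nin i by blast
      qed
    qed
  qed
  hence "prob ?S \<le> prob (((?E1 \<union> ?E2) \<union> ?E3) \<union> ?E4)" by (intro finite_measure_mono) measurable
  also have "\<dots> \<le> prob ((?E1 \<union> ?E2) \<union> ?E3) + prob ?E4" by (intro measure_Un_le) measurable
  also have "\<dots> \<le> (prob (?E1 \<union> ?E2) + prob ?E3) + prob ?E4" by (intro add_right_mono measure_Un_le) measurable
  also have "\<dots> \<le> ((prob ?E1 + prob ?E2) + prob ?E3) + prob ?E4" by (intro add_right_mono measure_Un_le) measurable
  finally have main: "prob ?S \<le> prob ?E1 + prob ?E2 + prob ?E3 + prob ?E4" .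
  have e1: "prob ?E1 \<le> real n * Fbar y" by (rule some_exceeds)
  have cheb: "\<P>(\<omega> in M. ?Z I \<omega> \<in> {n * \<mu> - v<..}) \<le> real n * trunc_square z / (real n * excess z - v)\<^sup>2"
    if I: "I \<subseteq> {..<n}" and v: "real n * excess z > v" for I v
  proof -
    have finI: "finite I" and cI: "card I \<le> n" using finite_subset[OF I] card_mono[OF _ I] by auto
    have "\<P>(\<omega> in M. ?Z I \<omega> \<in> {n * \<mu> - v<..}) \<le> \<P>(\<omega> in M. \<bar>?Z I \<omega> - card I * trunc_mean z\<bar> \<ge> real n * excess z - v)"
    proof (rule finite_measure_mono)
      have "card I * trunc_mean z \<le> n * trunc_mean z" using cI trunc_mean_nonneg[OF z] by (intro mult_right_mono) auto
      also have "\<dots> = n * \<mu> - n * excess z" by (simp add: trunc_mean_eq algebra_simps)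
      finally show "{\<omega> \<in> space M. ?Z I \<omega> \<in> {n * \<mu> - v<..}} \<subseteq> {\<omega> \<in> space M. \<bar>?Z I \<omega> - card I * trunc_mean z\<bar> \<ge> real n * excess z - v}"
        by auto
    qed measurable
    also have "\<dots> \<le> card I * trunc_square z / (real n * excess z - v)\<^sup>2" using v by (intro truncated_chebyshev finI z) auto
    also have "\<dots> \<le> real n * trunc_square z / (real n * excess z - v)\<^sup>2" using cI trunc_square_nonneg by (intro divide_right_mono mult_right_mono) auto
    finally show ?thesis .
  qed
  have e2: "prob ?E2 \<le> real n * trunc_square z / (real n * excess z)\<^sup>2" using cheb[of "{..<n}" 0] d1 by simp
  have e3: "prob ?E3 \<le> (real n * Fbar z) * (real n * trunc_square z / (real n * excess z - y)\<^sup>2)"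
  proof -
    have "prob ?E3 \<le> (\<Sum>i<n. prob (?A i))" by (rule finite_measure_subadditive_finite) auto
    also have "\<dots> \<le> (\<Sum>i<n. Fbar z * (real n * trunc_square z / (real n * excess z - y)\<^sup>2))"
    proof (rule sum_mono)
      fix i assume "i \<in> {..<n}"
      hence "prob (?A i) = Fbar z * \<P>(\<omega> in M. ?Z ({..<n} - {i}) \<omega> \<in> {n * \<mu> - y<..})" by (intro exceed_one_rest) auto
      also have "\<dots> \<le> Fbar z * (real n * trunc_square z / (real n * excess z - y)\<^sup>2)" by (intro mult_left_mono cheb d2) auto
      finally show "prob (?A i) \<le> Fbar z * (real n * trunc_square z / (real n * excess z - y)\<^sup>2)" .
    qed
    finally show ?thesis by simp
  qed
  have e4: "prob ?E4 \<le> (real n * Fbar z)\<^sup>2"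
  proof -
    have "prob ?E4 \<le> (\<Sum>p\<in>?P. prob (?B p))" by (rule finite_measure_subadditive_finite[OF finP]) auto
    also have "\<dots> = (\<Sum>p\<in>?P. (Fbar z)\<^sup>2)" by (intro sum.cong refl two_exceed) auto
    also have "\<dots> = card ?P * (Fbar z)\<^sup>2" by simp
    also have "\<dots> \<le> real (n * n) * (Fbar z)\<^sup>2" using cardP by (intro mult_right_mono of_nat_mono) auto
    finally show ?thesis by (simp add: power2_eq_square algebra_simps)
  qed
  show ?thesis using main e1 e2 e3 e4 by linarith
qed

text \<open>One observation above \<open>y\<close> suffices unless the others fall short by more than \<open>y\<close>. Excluding a second
  large observation makes the events for different indices disjoint.\<close>

lemma sum_excess_lower:
  assumes z: "z \<ge> 0" and d: "y > real n * excess z + \<mu>"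
  shows "prob_exceed n \<ge>
    (real n * Fbar y) * (1 - real n * trunc_square z / (y - real n * excess z - \<mu>)\<^sup>2) - (real n * Fbar y)\<^sup>2"
proof -
  let ?Z = "\<lambda>I \<omega>. \<Sum>j\<in>I. min (X j \<omega>) z"
  let ?S = "{\<omega> \<in> space M. (\<Sum>i<n. X i \<omega>) > n * \<mu>}"
  let ?A = "\<lambda>i. {\<omega> \<in> space M. X i \<omega> \<in> {y<..} \<and> ?Z ({..<n} - {i}) \<omega> \<in> {n * \<mu> - y<..}}"
  let ?B = "\<lambda>i. {\<omega> \<in> space M. \<exists>j\<in>{..<n} - {i}. X i \<omega> > y \<and> X j \<omega> > y}"
  let ?q = "real n * trunc_square z / (y - real n * excess z - \<mu>)\<^sup>2"
  have disj: "disjoint_family_on (\<lambda>i. ?A i - ?B i) {..<n}" unfolding disjoint_family_on_def by auto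
  have "(\<Union>i<n. ?A i - ?B i) \<subseteq> ?S"
  proof
    fix \<omega> assume "\<omega> \<in> (\<Union>i<n. ?A i - ?B i)"
    then obtain i where i: "i < n" "\<omega> \<in> ?A i" by auto
    have "(\<Sum>i<n. X i \<omega>) = X i \<omega> + (\<Sum>j\<in>{..<n} - {i}. X j \<omega>)" using i by (intro sum.remove) auto
    moreover have "?Z ({..<n} - {i}) \<omega> \<le> (\<Sum>j\<in>{..<n} - {i}. X j \<omega>)" by (intro sum_mono) auto
    ultimately show "\<omega> \<in> ?S" using i by auto
  qed
  hence "prob (\<Union>i<n. ?A i - ?B i) \<le> prob ?S" by (intro finite_measure_mono) measurable
  moreover have "prob (\<Union>i<n. ?A i - ?B i) = (\<Sum>i<n. prob (?A i - ?B i))"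
    by (rule finite_measure_finite_Union[OF _ _ disj]) auto
  moreover have "(\<Sum>i<n. prob (?A i - ?B i)) \<ge> (\<Sum>i<n. Fbar y * (1 - ?q) - n * (Fbar y)\<^sup>2)"
  proof (rule sum_mono)
    fix i assume i: "i \<in> {..<n}"
    have "prob (?A i) = Fbar y * \<P>(\<omega> in M. ?Z ({..<n} - {i}) \<omega> \<in> {n * \<mu> - y<..})" using i by (intro exceed_one_rest) auto
    moreover have "\<P>(\<omega> in M. ?Z ({..<n} - {i}) \<omega> \<in> {n * \<mu> - y<..}) \<ge> 1 - ?q"
    proof -
      have c: "real (card ({..<n} - {i})) = real n - 1" using i by (simp add: of_nat_diff)
      have "{\<omega> \<in> space M. \<not> ?Z ({..<n} - {i}) \<omega> \<in> {n * \<mu> - y<..}} \<subseteq>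
         {\<omega> \<in> space M. \<bar>?Z ({..<n} - {i}) \<omega> - card ({..<n} - {i}) * trunc_mean z\<bar> \<ge> y - real n * excess z - \<mu>}"
      proof safe
        fix \<omega> assume "\<omega> \<in> space M" "\<not> n * \<mu> - y < ?Z ({..<n} - {i}) \<omega>"
        moreover have "card ({..<n} - {i}) * trunc_mean z = n * \<mu> - n * excess z - trunc_mean z" unfolding c by (simp add: trunc_mean_eq algebra_simps)
        moreover have "trunc_mean z \<le> \<mu>" using excess_nonneg[of z] by (simp add: trunc_mean_eq)
        ultimately show "y - real n * excess z - \<mu> \<le> \<bar>?Z ({..<n} - {i}) \<omega> - card ({..<n} - {i}) * trunc_mean z\<bar>" by linarith
      qed
      hence "\<P>(\<omega> in M. \<not> ?Z ({..<n} - {i}) \<omega> \<in> {n * \<mu> - y<..}) \<le>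
        \<P>(\<omega> in M. \<bar>?Z ({..<n} - {i}) \<omega> - card ({..<n} - {i}) * trunc_mean z\<bar> \<ge> y - real n * excess z - \<mu>)"
        by (intro finite_measure_mono) measurable
      also have "\<dots> \<le> card ({..<n} - {i}) * trunc_square z / (y - real n * excess z - \<mu>)\<^sup>2"
        using d by (intro truncated_chebyshev z) auto
      also have "\<dots> \<le> ?q" unfolding c using trunc_square_nonneg by (intro divide_right_mono mult_right_mono) auto
      finally have "\<P>(\<omega> in M. \<not> ?Z ({..<n} - {i}) \<omega> \<in> {n * \<mu> - y<..}) \<le> ?q" .
      moreover have "\<P>(\<omega> in M. \<not> ?Z ({..<n} - {i}) \<omega> \<in> {n * \<mu> - y<..}) = 1 - \<P>(\<omega> in M. ?Z ({..<n} - {i}) \<omega> \<in> {n * \<mu> - y<..})"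
        by (rule prob_neg) measurable
      ultimately show ?thesis by linarith
    qed
    ultimately have pA: "prob (?A i) \<ge> Fbar y * (1 - ?q)" by (simp add: mult_left_mono)
    have pB: "prob (?B i) \<le> n * (Fbar y)\<^sup>2"
    proof -
      have "?B i = (\<Union>j\<in>{..<n}-{i}. {\<omega> \<in> space M. X i \<omega> > y \<and> X j \<omega> > y})" by auto
      hence "prob (?B i) \<le> (\<Sum>j\<in>{..<n}-{i}. \<P>(\<omega> in M. X i \<omega> > y \<and> X j \<omega> > y))"
        by (simp only:) (intro finite_measure_subadditive_finite, auto)
      also have "\<dots> = (\<Sum>j\<in>{..<n}-{i}. (Fbar y)\<^sup>2)" by (intro sum.cong refl two_exceed) auto
      also have "\<dots> = real (card ({..<n}-{i})) * (Fbar y)\<^sup>2" by simp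
      also have "\<dots> \<le> n * (Fbar y)\<^sup>2" using card_mono[of "{..<n}" "{..<n}-{i}"] by (intro mult_right_mono) auto
      finally show ?thesis .
    qed
    have "prob (?A i) \<le> prob ((?A i - ?B i) \<union> ?B i)" by (intro finite_measure_mono) auto
    also have "\<dots> \<le> prob (?A i - ?B i) + prob (?B i)" by (intro measure_Un_le) auto
    finally show "Fbar y * (1 - ?q) - n * (Fbar y)\<^sup>2 \<le> prob (?A i - ?B i)" using pA pB by linarith
  qed
  moreover have "(\<Sum>i<n. Fbar y * (1 - ?q) - n * (Fbar y)\<^sup>2) = (real n * Fbar y) * (1 - ?q) - (real n * Fbar y)\<^sup>2"
    by (simp add: algebra_simps power2_eq_square)
  ultimately show ?thesis by linarith
qed

text \<open>The centring expressed through \<open>s n\<close>, and the deficit \<open>T n\<close> of the typical sum.\<close>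

definition q :: "nat \<Rightarrow> real" where "q n = K * ln (s n) powr (1 - \<gamma>)"
definition T :: "nat \<Rightarrow> real" where "T n = s n * q n"

lemma q_pos: "q n > 0" using K_pos s_pos[of n] by (simp add: q_def)
lemma T_pos: "T n > 0" using q_pos s_pos[of n] by (simp add: T_def)

lemma q_at_top: "filterlim q at_top sequentially"
proof -
  have "filterlim (\<lambda>x. K * ln x powr (1 - \<gamma>)) at_top at_top" using K_pos gamma by real_asymp
  from filterlim_compose[OF this s_at_top] show ?thesis unfolding q_def .
qed

lemma T_at_top: "\<theta> > 0 \<Longrightarrow> filterlim (\<lambda>n. T n * \<theta>) at_top sequentially"
proof -
  assume "\<theta> > 0"
  hence "filterlim (\<lambda>x. x * (K * ln x powr (1 - \<gamma>)) * \<theta>) at_top at_top" using K_pos gamma by real_asymp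
  from filterlim_compose[OF this s_at_top] show ?thesis unfolding q_def T_def .
qed

text \<open>The quotient of \<open>T n\<close> and \<open>s n\<close> is a power of \<open>ln (s n)\<close> up to a constant, so its logarithm is
  \<open>o ((ln (s n)) powr (1 - \<gamma>))\<close>.\<close>

lemma L_T: "\<theta> > 0 \<Longrightarrow> (\<lambda>n. L (T n * \<theta>) / L (s n)) \<longlonglongrightarrow> 1"
proof (rule L_ratio_tendsto_1[OF s_at_top T_at_top])
  assume "\<theta> > 0"
  hence "((\<lambda>x. ln (K * ln x powr (1 - \<gamma>) * \<theta>) * ln x powr (\<gamma> - 1)) \<longlongrightarrow> 0) at_top" using K_pos gamma by real_asymp
  from filterlim_compose[OF this s_at_top]
  have "(\<lambda>n. ln (q n * \<theta>) * ln (s n) powr (\<gamma> - 1)) \<longlonglongrightarrow> 0" unfolding q_def .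
  moreover have "T n * \<theta> / s n = q n * \<theta>" for n using s_pos[of n] by (simp add: T_def)
  ultimately show "(\<lambda>n. ln (T n * \<theta> / s n) * ln (s n) powr (\<gamma> - 1)) \<longlonglongrightarrow> 0" by simp
qed 

lemma ln_T: "\<theta> > 0 \<Longrightarrow> (\<lambda>n. ln (T n * \<theta>) powr (1 - \<gamma>) / ln (s n) powr (1 - \<gamma>)) \<longlonglongrightarrow> 1"
proof -
  assume t: "\<theta> > 0"
  hence "((\<lambda>x. ln (x * (K * ln x powr (1 - \<gamma>)) * \<theta>) / ln x) \<longlongrightarrow> 1) at_top" using K_pos gamma by real_asymp
  from filterlim_compose[OF this s_at_top]
  have "(\<lambda>n. (ln (T n * \<theta>) / ln (s n)) powr (1 - \<gamma>)) \<longlonglongrightarrow> 1 powr (1 - \<gamma>)"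
    unfolding q_def T_def by (intro tendsto_powr tendsto_const) auto
  moreover have "eventually (\<lambda>n. T n * \<theta> \<ge> 1) sequentially" using T_at_top[OF t] by (simp add: filterlim_at_top)
  hence "eventually (\<lambda>n. (ln (T n * \<theta>) / ln (s n)) powr (1 - \<gamma>) = ln (T n * \<theta>) powr (1 - \<gamma>) / ln (s n) powr (1 - \<gamma>)) sequentially"
    by eventually_elim (use s_pos in \<open>auto intro!: powr_divide\<close>)
  ultimately have "(\<lambda>n. ln (T n * \<theta>) powr (1 - \<gamma>) / ln (s n) powr (1 - \<gamma>)) \<longlonglongrightarrow> 1 powr (1 - \<gamma>)" by (rule Lim_transform_eventually)
  thus ?thesis by simp
qed

lemma q_n_over_g: "\<theta> > 0 \<Longrightarrow> (\<lambda>n. q n * real n / g (T n * \<theta>)) \<longlonglongrightarrow> 1 / \<theta>"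
proof -
  assume t: "\<theta> > 0"
  have "(\<lambda>n. inverse (L (T n * \<theta>) / L (s n)) * (1 / \<theta>)) \<longlonglongrightarrow> inverse 1 * (1 / \<theta>)"
    using t by (intro tendsto_intros L_T) auto
  moreover have "eventually (\<lambda>n. inverse (L (T n * \<theta>) / L (s n)) * (1 / \<theta>) = q n * real n / g (T n * \<theta>)) sequentially"
    using eventually_g_s
  proof eventually_elim
    case (elim n)
    have "real n = s n * L (s n)" using elim by (simp add: g_def)
    thus ?case using s_pos[of n] q_pos[of n] by (simp add: T_def g_def)
  qed
  ultimately have "(\<lambda>n. q n * real n / g (T n * \<theta>)) \<longlonglongrightarrow> inverse 1 * (1 / \<theta>)" by (rule Lim_transform_eventually)
  thus ?thesis by simp
qed

lemma q_n_Fbar: "\<theta> > 0 \<Longrightarrow> (\<lambda>n. q n * real n * Fbar (T n * \<theta>)) \<longlonglongrightarrow> 1 / \<theta> * (2 / pi)"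
  by (rule scaled_tail[OF T_at_top q_n_over_g])

lemma n_Fbar_T_0: "\<theta> > 0 \<Longrightarrow> (\<lambda>n. real n * Fbar (T n * \<theta>)) \<longlonglongrightarrow> 0"
proof -
  assume "\<theta> > 0"
  hence "(\<lambda>n. (q n * real n * Fbar (T n * \<theta>)) * inverse (q n)) \<longlonglongrightarrow> 1 / \<theta> * (2 / pi) * 0"
    by (intro tendsto_mult q_n_Fbar tendsto_inverse_0_at_top q_at_top)
  moreover have "(q n * real n * Fbar (T n * \<theta>)) * inverse (q n) = real n * Fbar (T n * \<theta>)" for n using q_pos[of n] by simp
  ultimately show ?thesis by simp
qed

text \<open>The deficit is self-consistent: truncating at any multiple of \<open>T n\<close> lowers the mean of the sum by
  \<open>T n\<close> asymptotically.\<close>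

lemma n_excess_T: "\<theta> > 0 \<Longrightarrow> (\<lambda>n. real n * excess (T n * \<theta>) / T n) \<longlonglongrightarrow> 1"
proof -
  assume t: "\<theta> > 0"
  have "(\<lambda>n. excess (T n * \<theta>) / tail_D (T n * \<theta>) * (ln (T n * \<theta>) powr (1 - \<gamma>) / ln (s n) powr (1 - \<gamma>)) * inverse (L (T n * \<theta>) / L (s n)) / K) \<longlonglongrightarrow> K * 1 * inverse 1 / K"
    using K_pos t by (intro tendsto_intros filterlim_compose[OF excess_asymp] T_at_top ln_T L_T) auto
  moreover have "eventually (\<lambda>n. T n * \<theta> \<ge> x0) sequentially" using T_at_top[OF t] by (simp add: filterlim_at_top)
  hence "eventually (\<lambda>n. excess (T n * \<theta>) / tail_D (T n * \<theta>) * (ln (T n * \<theta>) powr (1 - \<gamma>) / ln (s n) powr (1 - \<gamma>)) * inverse (L (T n * \<theta>) / L (s n)) / K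
     = real n * excess (T n * \<theta>) / T n) sequentially"
    using eventually_g_s
  proof eventually_elim
    case (elim n)
    have "real n = s n * L (s n)" using elim by (simp add: g_def)
    moreover have "L (T n * \<theta>) > 0" using elim by (intro L_pos)
    moreover have "ln (T n * \<theta>) > 0" using elim x0 by simp
    moreover have "ln (s n) > 0" using s_pos[of n] by simp
    ultimately show ?case using s_pos[of n] K_pos by (simp add: tail_D_def T_def q_def mult.commute)
  qed
  ultimately have "(\<lambda>n. real n * excess (T n * \<theta>) / T n) \<longlonglongrightarrow> K * 1 * inverse 1 / K" by (rule Lim_transform_eventually)
  thus ?thesis using K_pos by simp
qed

lemma q_n_trunc_square: "\<exists>C>0. \<forall>\<theta>>0. eventually (\<lambda>n. q n * (real n * trunc_square (T n * \<theta>) / (T n)\<^sup>2) \<le> C * \<theta>) sequentially"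
proof -
  have "filterlim T at_top sequentially" using T_at_top[of 1] by simp
  from scaled_trunc_square[OF this, of "\<lambda>n. q n * real n"] q_n_over_g q_pos
  show ?thesis by (simp add: mult.assoc less_imp_le)
qed

lemma n_trunc_square_T_0: "\<theta> > 0 \<Longrightarrow> (\<lambda>n. real n * trunc_square (T n * \<theta>) / (T n)\<^sup>2) \<longlonglongrightarrow> 0"
proof -
  assume t: "\<theta> > 0"
  obtain C where C: "C > 0" "eventually (\<lambda>n. q n * (real n * trunc_square (T n * \<theta>) / (T n)\<^sup>2) \<le> C * \<theta>) sequentially"
    using q_n_trunc_square t by blast
  show ?thesis
  proof (rule Lim_null_comparison)
    show "(\<lambda>n. C * \<theta> * inverse (q n)) \<longlonglongrightarrow> 0"
      using tendsto_mult[OF tendsto_const[of "C * \<theta>"] tendsto_inverse_0_at_top[OF q_at_top]] by simp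
    show "eventually (\<lambda>n. norm (real n * trunc_square (T n * \<theta>) / (T n)\<^sup>2) \<le> C * \<theta> * inverse (q n)) sequentially"
      using C(2)
    proof eventually_elim
      case (elim n)
      define v where "v = real n * trunc_square (T n * \<theta>) / (T n)\<^sup>2"
      have "v \<ge> 0" using trunc_square_nonneg by (simp add: v_def)
      moreover have "v \<le> C * \<theta> * inverse (q n)" using elim q_pos[of n] unfolding v_def[symmetric] by (simp add: field_simps)
      ultimately show ?case unfolding v_def[symmetric] by simp
    qed
  qed
qed

text \<open>Upper bound: threshold \<open>\<theta> * T n\<close> with \<open>\<theta> < 1\<close> close to 1 and truncation at \<open>\<eta> * T n\<close> with small \<open>\<eta>\<close>. Truncating at
  a small multiple of \<open>T n\<close> matters: the variance then contributes \<open>O (\<eta>)\<close> on the scale \<open>1 / q n\<close>, while all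
  remaining terms are of smaller order. Lower bound: threshold \<open>\<theta> * T n\<close> with \<open>\<theta> > 1\<close> and truncation at \<open>T n\<close>.\<close>

lemma exceed_mean_asymp: "(\<lambda>n. q n * prob_exceed n) \<longlonglongrightarrow> 2 / pi"
proof (rule order_tendstoI)
  fix u :: real assume u: "u > 2 / pi"
  obtain C where C: "C > 0" "\<And>\<theta>. \<theta> > 0 \<Longrightarrow> eventually (\<lambda>n. q n * (real n * trunc_square (T n * \<theta>) / (T n)\<^sup>2) \<le> C * \<theta>) sequentially"
    using q_n_trunc_square by blast
  define d where "d = (u - 2 / pi) / 3"
  have "3 * d = u - 2 / pi" by (simp add: d_def)
  hence d: "d > 0" "u = 2 / pi + 3 * d" using u by simp_all
  \<comment> \<open>\<open>\<theta>\<close> and \<open>\<eta>\<close> are such that the first two error terms use up at most \<open>d\<close> each of the room \<open>3 * d\<close>.\<close>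
  define \<theta> where "\<theta> = (2 / pi) / (2 / pi + d)"
  have \<theta>: "\<theta> > 0" "\<theta> < 1" "1 / \<theta> * (2 / pi) = 2 / pi + d" using d by (auto simp: \<theta>_def add_pos_pos field_simps)
  define \<eta> where "\<eta> = d / (4 * C)"
  have \<eta>: "\<eta> > 0" "4 * (C * \<eta>) = d" using d C(1) by (auto simp: \<eta>_def)
  define x1 where "x1 n = q n * real n * Fbar (T n * \<theta>)" for n
  \<comment> \<open>\<open>x3\<close> covers two cases: one observation above the truncation level that falls short of the threshold, and two such observations or more.\<close>
  define x3 where "x3 n = q n * real n * Fbar (T n * \<eta>) * (real n * trunc_square (T n * \<eta>) / (T n)\<^sup>2 * (4 / (1 - \<theta>)\<^sup>2) + real n * Fbar (T n * \<eta>))" for n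
  have x1: "x1 \<longlonglongrightarrow> 2 / pi + d" unfolding x1_def \<theta>(3)[symmetric] by (rule q_n_Fbar[OF \<theta>(1)])
  have "x3 \<longlonglongrightarrow> 1 / \<eta> * (2 / pi) * (0 * (4 / (1 - \<theta>)\<^sup>2) + 0)"
    unfolding x3_def by (intro tendsto_mult tendsto_add q_n_Fbar n_trunc_square_T_0 n_Fbar_T_0 tendsto_const \<eta>)
  hence x3: "x3 \<longlonglongrightarrow> 0" by simp
  have "(\<lambda>n. x1 n + d + x3 n) \<longlonglongrightarrow> 2 / pi + d + d + 0" by (intro tendsto_intros x1 x3)
  hence "eventually (\<lambda>n. x1 n + d + x3 n < u) sequentially" using d by (intro order_tendstoD(2)) auto
  moreover have "eventually (\<lambda>n. real n * excess (T n * \<eta>) / T n > (1 + \<theta>) / 2) sequentially"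
    using \<theta> by (intro order_tendstoD(1)[OF n_excess_T[OF \<eta>(1)]]) auto
  ultimately show "eventually (\<lambda>n. q n * prob_exceed n < u) sequentially"
    using C(2)[OF \<eta>(1)]
  proof eventually_elim
    case (elim n)
    define z where "z = T n * \<eta>"
    define w where "w = real n * excess z"
    define v where "v = real n * trunc_square z / (T n)\<^sup>2"
    have Tp: "T n > 0" and qp: "q n > 0" by (rule T_pos q_pos)+
    have z: "z \<ge> 0" using Tp \<eta> by (simp add: z_def)
    have w: "w > (1 + \<theta>) / 2 * T n" using elim(2) Tp by (simp add: w_def z_def field_simps)
    have w1: "w \<ge> T n / 2"
    proof -
      have "1 / 2 * T n \<le> (1 + \<theta>) / 2 * T n" using \<theta> Tp by (intro mult_right_mono) auto
      thus ?thesis using w by linarith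
    qed
    have w2: "w - T n * \<theta> \<ge> (1 - \<theta>) / 2 * T n"
    proof -
      have "(1 + \<theta>) / 2 * T n - T n * \<theta> = (1 - \<theta>) / 2 * T n" by (simp add: field_simps)
      thus ?thesis using w by linarith
    qed
    have p2: "(1 - \<theta>) / 2 * T n > 0" using \<theta> Tp by simp
    have nm: "real n * trunc_square z \<ge> 0" using trunc_square_nonneg by simp
    have b1: "real n * trunc_square z / w\<^sup>2 \<le> 4 * v"
    proof -
      have "real n * trunc_square z / w\<^sup>2 \<le> real n * trunc_square z / (T n / 2)\<^sup>2"
        using nm Tp w1 by (intro divide_square_antimono) auto
      also have "\<dots> = 4 * v" by (simp add: v_def power_divide)
      finally show ?thesis .
    qed
    have b2: "real n * trunc_square z / (w - T n * \<theta>)\<^sup>2 \<le> v * (4 / (1 - \<theta>)\<^sup>2)"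
    proof -
      have "real n * trunc_square z / (w - T n * \<theta>)\<^sup>2 \<le> real n * trunc_square z / ((1 - \<theta>) / 2 * T n)\<^sup>2"
        by (rule divide_square_antimono[OF nm p2 w2])
      also have "\<dots> = v * (4 / (1 - \<theta>)\<^sup>2)" by (simp add: v_def power_divide power_mult_distrib)
      finally show ?thesis .
    qed
    have "prob_exceed n \<le> real n * Fbar (T n * \<theta>) + real n * trunc_square z / w\<^sup>2
      + (real n * Fbar z) * (real n * trunc_square z / (w - T n * \<theta>)\<^sup>2) + (real n * Fbar z)\<^sup>2"
      unfolding w_def using w1 w2 p2 Tp z by (intro sum_excess_upper) (auto simp: w_def[symmetric])
    also have "\<dots> \<le> real n * Fbar (T n * \<theta>) + 4 * v + (real n * Fbar z) * (v * (4 / (1 - \<theta>)\<^sup>2)) + (real n * Fbar z)\<^sup>2"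
      by (intro add_mono mult_left_mono b1 b2) auto
    finally have "q n * prob_exceed n \<le> q n * (real n * Fbar (T n * \<theta>) + 4 * v + (real n * Fbar z) * (v * (4 / (1 - \<theta>)\<^sup>2)) + (real n * Fbar z)\<^sup>2)"
      using qp by (intro mult_left_mono) auto
    also have "\<dots> = x1 n + 4 * (q n * v) + x3 n"
      by (simp add: x1_def x3_def v_def z_def power2_eq_square algebra_simps)
    also have "\<dots> \<le> x1 n + d + x3 n" using elim(3) \<eta>(2) by (simp add: v_def z_def)
    also have "\<dots> < u" by (rule elim(1))
    finally show ?case .
  qed
next
  fix u :: real assume u: "u < 2 / pi"
  show "eventually (\<lambda>n. u < q n * prob_exceed n) sequentially"
  proof (cases "u \<ge> 0")
    case False
    have "u < q n * prob_exceed n" for n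
      by (rule less_le_trans[OF _ mult_nonneg_nonneg[OF less_imp_le[OF q_pos] measure_nonneg]]) (use False in simp)
    thus ?thesis by (intro always_eventually allI)
  next
    case True
    define d where "d = (2 / pi - u) / 2"
    have "2 * d = 2 / pi - u" by (simp add: d_def)
    hence d: "d > 0" "u = 2 / pi - 2 * d" "2 / pi - d > 0" using u True by simp_all
    define \<theta> where "\<theta> = (2 / pi) / (2 / pi - d)"
    have \<theta>: "\<theta> > 1" "1 / \<theta> * (2 / pi) = 2 / pi - d" using d by (auto simp: \<theta>_def field_simps)
    define x1 where "x1 n = q n * real n * Fbar (T n * \<theta>)" for n
    define x2 where "x2 n = real n * trunc_square (T n) / (T n)\<^sup>2 * (4 / (\<theta> - 1)\<^sup>2)" for n
    define x3 where "x3 n = real n * Fbar (T n * \<theta>)" for n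
    have x1: "x1 \<longlonglongrightarrow> 2 / pi - d" unfolding x1_def \<theta>(2)[symmetric] using \<theta> by (intro q_n_Fbar) auto
    have "(\<lambda>n. real n * trunc_square (T n * 1) / (T n)\<^sup>2 * (4 / (\<theta> - 1)\<^sup>2)) \<longlonglongrightarrow> 0 * (4 / (\<theta> - 1)\<^sup>2)"
      by (intro tendsto_mult n_trunc_square_T_0 tendsto_const) auto
    hence x2: "x2 \<longlonglongrightarrow> 0" unfolding x2_def by simp
    have x3: "x3 \<longlonglongrightarrow> 0" unfolding x3_def using \<theta> by (intro n_Fbar_T_0) auto
    have "(\<lambda>n. x1 n * (1 - x2 n - x3 n)) \<longlonglongrightarrow> (2 / pi - d) * (1 - 0 - 0)" by (intro tendsto_intros x1 x2 x3)
    hence "eventually (\<lambda>n. x1 n * (1 - x2 n - x3 n) > u) sequentially" using d by (intro order_tendstoD(1)) auto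
    moreover have "(\<lambda>n. real n * excess (T n * 1) / T n + \<mu> * inverse (T n * 1)) \<longlonglongrightarrow> 1 + \<mu> * 0"
      by (intro tendsto_intros n_excess_T tendsto_inverse_0_at_top T_at_top) auto
    hence "eventually (\<lambda>n. real n * excess (T n * 1) / T n + \<mu> * inverse (T n * 1) < (1 + \<theta>) / 2) sequentially"
      using \<theta> by (intro order_tendstoD(2)) auto
    ultimately show ?thesis
    proof eventually_elim
      case (elim n)
      have Tp: "T n > 0" and qp: "q n > 0" by (rule T_pos q_pos)+
      have w: "real n * excess (T n) + \<mu> < (1 + \<theta>) / 2 * T n" using elim(2) Tp by (simp add: field_simps)
      have w2: "T n * \<theta> - real n * excess (T n) - \<mu> \<ge> (\<theta> - 1) / 2 * T n"
      proof -
        have "T n * \<theta> - (1 + \<theta>) / 2 * T n = (\<theta> - 1) / 2 * T n" by (simp add: field_simps)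
        thus ?thesis using w by linarith
      qed
      have p2: "(\<theta> - 1) / 2 * T n > 0" using \<theta> Tp by simp
      have b: "real n * trunc_square (T n) / (T n * \<theta> - real n * excess (T n) - \<mu>)\<^sup>2 \<le> x2 n"
      proof -
        have "real n * trunc_square (T n) / (T n * \<theta> - real n * excess (T n) - \<mu>)\<^sup>2 \<le> real n * trunc_square (T n) / ((\<theta> - 1) / 2 * T n)\<^sup>2"
          using trunc_square_nonneg[of "T n"] by (intro divide_square_antimono p2 w2) auto
        also have "\<dots> = x2 n" by (simp add: x2_def power_divide power_mult_distrib)
        finally show ?thesis .
      qed
      have "x3 n * (1 - x2 n) - (x3 n)\<^sup>2 \<le> x3 n * (1 - real n * trunc_square (T n) / (T n * \<theta> - real n * excess (T n) - \<mu>)\<^sup>2) - (x3 n)\<^sup>2"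
        using b by (intro diff_right_mono mult_left_mono) (auto simp: x3_def)
      also have "\<dots> \<le> prob_exceed n"
        unfolding x3_def using Tp w2 p2 by (intro sum_excess_lower) auto
      finally have "q n * (x3 n * (1 - x2 n) - (x3 n)\<^sup>2) \<le> q n * prob_exceed n"
        using qp by (intro mult_left_mono) auto
      moreover have "q n * (x3 n * (1 - x2 n) - (x3 n)\<^sup>2) = x1 n * (1 - x2 n - x3 n)"
        by (simp add: x1_def x3_def power2_eq_square algebra_simps)
      ultimately show ?case using elim(1) by linarith
    qed
  qed
qed

lemma exceed_mean_asymp_equiv:
  "(\<lambda>n. \<P>(\<omega> in M. sample_mean X n \<omega> > \<mu>)) \<sim>[sequentially] (\<lambda>n. 2 / pi * inverse K * ln (real n) powr (\<gamma> - 1))"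
proof (rule asymp_equivI')
  have ratio: "(\<lambda>n. (ln (real n) / ln (s n)) powr (1 - \<gamma>)) \<longlonglongrightarrow> 1 powr (1 - \<gamma>)"
  proof (intro tendsto_powr tendsto_const)
    have "(\<lambda>n. inverse (ln (g_inv (real n)) / ln (real n))) \<longlonglongrightarrow> inverse 1"
      by (intro tendsto_inverse filterlim_compose[OF ln_g_inv_ratio filterlim_real_sequentially]) auto
    thus "(\<lambda>n. ln (real n) / ln (s n)) \<longlonglongrightarrow> 1" by (simp add: s_def)
  qed auto
  have "(\<lambda>n. q n * prob_exceed n * (ln (real n) / ln (s n)) powr (1 - \<gamma>) / (2 / pi)) \<longlonglongrightarrow> 2 / pi * 1 powr (1 - \<gamma>) / (2 / pi)"
    by (intro tendsto_intros exceed_mean_asymp ratio) auto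
  moreover have "eventually (\<lambda>n. q n * prob_exceed n * (ln (real n) / ln (s n)) powr (1 - \<gamma>) / (2 / pi)
     = \<P>(\<omega> in M. sample_mean X n \<omega> > \<mu>) / (2 / pi * inverse K * ln (real n) powr (\<gamma> - 1))) sequentially"
    using eventually_ge_at_top[of 2]
  proof eventually_elim
    case (elim n)
    have ln: "ln (real n) > 0" "ln (s n) > 0" using elim s_pos[of n] by auto
    have "{\<omega> \<in> space M. sample_mean X n \<omega> > \<mu>} = {\<omega> \<in> space M. (\<Sum>i<n. X i \<omega>) > n * \<mu>}"
      using elim by (auto simp: sample_mean_def field_simps)
    moreover have "(ln (real n) / ln (s n)) powr (1 - \<gamma>) = ln (real n) powr (1 - \<gamma>) / ln (s n) powr (1 - \<gamma>)"
      by (rule powr_divide)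
    moreover have "ln (real n) powr (\<gamma> - 1) = inverse (ln (real n) powr (1 - \<gamma>))" 
      using powr_minus[of "ln (real n)" "1 - \<gamma>"] by (simp only: minus_diff_eq)
    ultimately show ?case using ln K_pos by (simp add: q_def field_simps)
  qed
  ultimately have "(\<lambda>n. \<P>(\<omega> in M. sample_mean X n \<omega> > \<mu>) / (2 / pi * inverse K * ln (real n) powr (\<gamma> - 1))) \<longlonglongrightarrow> 2 / pi * 1 powr (1 - \<gamma>) / (2 / pi)"
    by (rule Lim_transform_eventually)
  thus "(\<lambda>n. \<P>(\<omega> in M. sample_mean X n \<omega> > \<mu>) / (2 / pi * inverse K * ln (real n) powr (\<gamma> - 1))) \<longlonglongrightarrow> 1" by simp
qed

end

section \<open>The tail functions of the theorem\<close>

text \<open>The logarithmic derivative \<open>x * L' x / L x\<close> for \<open>L = tail_L \<beta>0 \<beta>1 \<delta> \<gamma>\<close>.\<close>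

definition tail_e :: "real \<Rightarrow> real \<Rightarrow> real \<Rightarrow> real \<Rightarrow> real" where
  "tail_e \<beta>1 \<delta> \<gamma> x = (\<delta> + 1) / ln x + (if \<beta>1 > 0 then \<gamma> * \<beta>1 powr \<gamma> * ln x powr (\<gamma> - 1) else 0)"

lemma tail_L_slow_variation:
  assumes \<beta>0: "\<beta>0 > 0"
    and params: "(\<beta>1 > 0 \<and> 0 < \<gamma> \<and> \<gamma> < 1) \<or> (\<beta>1 = 0 \<and> \<delta> > 0 \<and> \<gamma> = 0)"
  shows "slow_variation (tail_L \<beta>0 \<beta>1 \<delta> \<gamma>) (tail_e \<beta>1 \<delta> \<gamma>) \<gamma> (if \<beta>1 > 0 then \<beta>1 powr \<gamma> * \<gamma> else \<delta>) 2"
    (is "slow_variation ?L ?e \<gamma> ?\<kappa> 2")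
proof
  show "0 \<le> \<gamma>" "\<gamma> < 1" "?\<kappa> > 0" "(2::real) > 1" using params by auto
  show "?L \<in> borel_measurable borel" unfolding tail_L_def by measurable
  show "?e \<in> borel_measurable borel" unfolding tail_e_def by measurable
next
  fix x :: real assume x: "x \<ge> 2"
  have lx: "ln x > 0" using x by simp
  show "?L x > 0" using \<beta>0 lx by (auto simp: tail_L_def)
  have d1: "((\<lambda>x. (\<beta>0 * ln x) powr (\<delta> + 1)) has_real_derivative (\<beta>0 * ln x) powr (\<delta> + 1) * ((\<delta> + 1) / ln x) / x) (at x)"
  proof -
    have "((\<lambda>x. (\<beta>0 * ln x) powr (\<delta> + 1)) has_real_derivative ((\<delta> + 1) * (\<beta>0 * ln x) powr (\<delta> + 1 - 1)) * (\<beta>0 * (1 / x))) (at x)"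
      by (rule DERIV_chain2[OF has_real_derivative_powr DERIV_cmult[OF DERIV_ln_divide]]) (use x lx \<beta>0 in auto)
    also have "((\<delta> + 1) * (\<beta>0 * ln x) powr (\<delta> + 1 - 1)) * (\<beta>0 * (1 / x)) = (\<beta>0 * ln x) powr (\<delta> + 1) * ((\<delta> + 1) / ln x) / x"
      using x lx \<beta>0 by (simp add: powr_add field_simps)
    finally show ?thesis .
  qed
  show "(?L has_real_derivative ?L x * ?e x / x) (at x)"
  proof (cases "\<beta>1 > 0")
    case False
    thus ?thesis using d1 by (simp add: tail_L_def[abs_def] tail_e_def)
  next
    case True
    have "((\<lambda>x. (\<beta>1 * ln x) powr \<gamma>) has_real_derivative (\<gamma> * (\<beta>1 * ln x) powr (\<gamma> - 1)) * (\<beta>1 * (1 / x))) (at x)"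
      by (rule DERIV_chain2[OF has_real_derivative_powr DERIV_cmult[OF DERIV_ln_divide]]) (use x lx True in auto)
    also have "(\<gamma> * (\<beta>1 * ln x) powr (\<gamma> - 1)) * (\<beta>1 * (1 / x)) = \<gamma> * \<beta>1 powr \<gamma> * ln x powr (\<gamma> - 1) / x"
      using x lx True by (simp add: powr_mult powr_diff field_simps)
    finally have "((\<lambda>x. exp ((\<beta>1 * ln x) powr \<gamma>)) has_real_derivative exp ((\<beta>1 * ln x) powr \<gamma>) * (\<gamma> * \<beta>1 powr \<gamma> * ln x powr (\<gamma> - 1) / x)) (at x)"
      by (rule DERIV_chain2[OF DERIV_exp])
    from DERIV_mult[OF d1 this]
    have "((\<lambda>x. (\<beta>0 * ln x) powr (\<delta> + 1) * exp ((\<beta>1 * ln x) powr \<gamma>)) has_real_derivative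
      ((\<beta>0 * ln x) powr (\<delta> + 1) * exp ((\<beta>1 * ln x) powr \<gamma>)) * ?e x / x) (at x)"
      by (rule DERIV_cong) (use True x in \<open>simp add: tail_e_def field_simps\<close>)
    thus ?thesis using True by (simp add: tail_L_def[abs_def])
  qed
next
  have ev: "eventually (\<lambda>x::real. ln x > 0) at_top" by real_asymp
  have eq: "eventually (\<lambda>x. (\<delta> + \<gamma>) * ln x powr (- \<gamma>) + (if \<beta>1 > 0 then \<beta>1 powr \<gamma> * \<gamma> else 0) =
      ?e x * ln x powr (1 - \<gamma>) - (1 - \<gamma>) * ln x powr (- \<gamma>)) at_top"
    using ev
  proof eventually_elim
    case (elim x)
    define u where "u = ln x powr (- \<gamma>)"
    define v where "v = ln x powr (\<gamma> - 1)"
    have p: "ln x powr (1 - \<gamma>) = ln x * u" using elim powr_add[of "ln x" 1 "- \<gamma>"] by (simp add: u_def)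
    have "v * ln x powr (1 - \<gamma>) = 1" unfolding v_def using elim by (simp flip: powr_add)
    hence vu: "v * (ln x * u) = 1" by (simp only: p)
    have "(\<delta> + 1) / ln x * (ln x * u) = (\<delta> + 1) * u" using elim by (simp only: times_divide_eq_left) simp
    hence "((\<delta> + 1) / ln x + b * v) * (ln x * u) = (\<delta> + 1) * u + b * (v * (ln x * u))" for b
      by (simp only: distrib_right mult.assoc)
    hence *: "((\<delta> + 1) / ln x + b * v) * (ln x * u) = (\<delta> + 1) * u + b" for b by (simp only: vu mult_1_right)
    show ?case
      using *[of 0] *[of "\<gamma> * \<beta>1 powr \<gamma>"] unfolding tail_e_def p u_def[symmetric] v_def[symmetric]
      by (auto simp: algebra_simps)
  qed
  have "((\<lambda>x. (\<delta> + \<gamma>) * ln x powr (- \<gamma>) + (if \<beta>1 > 0 then \<beta>1 powr \<gamma> * \<gamma> else 0)) \<longlongrightarrow> ?\<kappa>) at_top"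
  proof (cases "\<beta>1 > 0")
    case True
    hence g: "\<gamma> > 0" using params by auto
    have "((\<lambda>x::real. ln x powr (- \<gamma>)) \<longlongrightarrow> 0) at_top" using g by real_asymp
    hence "((\<lambda>x::real. (\<delta> + \<gamma>) * ln x powr (- \<gamma>) + \<beta>1 powr \<gamma> * \<gamma>) \<longlongrightarrow> (\<delta> + \<gamma>) * 0 + \<beta>1 powr \<gamma> * \<gamma>) at_top"
      by (intro tendsto_intros)
    thus ?thesis using True by simp
  next
    case False
    hence p: "\<gamma> = 0" "\<beta>1 = 0" using params by auto
    have "eventually (\<lambda>x. \<delta> = (\<delta> + \<gamma>) * ln x powr (- \<gamma>) + (if \<beta>1 > 0 then \<beta>1 powr \<gamma> * \<gamma> else 0)) at_top"
      using ev by eventually_elim (simp add: p)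
    thus ?thesis using p by (auto intro: Lim_transform_eventually[OF tendsto_const])
  qed
  thus "((\<lambda>x. ?e x * ln x powr (1 - \<gamma>) - (1 - \<gamma>) * ln x powr (- \<gamma>)) \<longlongrightarrow> ?\<kappa>) at_top"
    using eq by (rule Lim_transform_eventually)
next
  show "((\<lambda>x. ln x powr (1 - \<gamma>) / ?L x) \<longlongrightarrow> 0) at_top"
  proof (cases "\<beta>1 > 0")
    case True
    hence g: "\<gamma> > 0" "\<gamma> < 1" using params by auto
    have "((\<lambda>y. y powr (1 - \<gamma>) / ((\<beta>0 * y) powr (\<delta> + 1) * exp ((\<beta>1 * y) powr \<gamma>))) \<longlongrightarrow> 0) at_top"
      using \<beta>0 True g by real_asymp
    from filterlim_compose[OF this ln_at_top] show ?thesis using True by (simp add: tail_L_def)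
  next
    case False
    hence p: "\<gamma> = 0" "\<beta>1 = 0" "\<delta> > 0" using params by auto
    have "((\<lambda>y. y powr (1 - 0) / (\<beta>0 * y) powr (\<delta> + 1)) \<longlongrightarrow> 0) at_top"
      using \<beta>0 p by real_asymp
    from filterlim_compose[OF this ln_at_top] show ?thesis by (simp add: tail_L_def p)
  qed
qed

theorem corollary4p2:
  fixes F :: "real measure"
    and M :: "'a measure" and X :: "nat \<Rightarrow> 'a \<Rightarrow> real"
    and \<mu> \<beta>0 \<beta>1 \<delta> \<gamma> :: real
    and L :: "real \<Rightarrow> real" and K :: real
    and p :: "nat \<Rightarrow> real"
  assumes params: "\<beta>0 > 0"
      "(\<beta>1 > 0 \<and> 0 < \<gamma> \<and> \<gamma> < 1) \<or> (\<beta>1 = 0 \<and> \<delta> > 0 \<and> \<gamma> = 0)"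
    and L_eq: "L = tail_L \<beta>0 \<beta>1 \<delta> \<gamma>"
    and K_eq: "K = K_const \<delta> \<gamma> \<beta>1"
    and F_distr: "real_distribution F"
    and F_pos: "AE x in F. 0 < x"
    and F_mean: "integrable F (\<lambda>x. x)" "\<mu> = (\<integral>x. x \<partial>F)"
    and F_tail: "(\<lambda>x. 1 - cdf F x) \<sim>[at_top] (\<lambda>x. 2 * C1 / (x * L x))"
    and M_prob: "prob_space M"
    and X_indep: "prob_space.indep_vars M (\<lambda>_. borel) X UNIV"
    and X_distr: "\<And>i. distr M borel (X i) = F"
    and p_eq: "\<And>n. p n = measure M {\<omega> \<in> space M. sample_mean X n \<omega> > \<mu>}"
  shows
    "(\<exists>Ld. de_bruijn_conjugate L Ld \<and>
        eq_in_distr_cauchy_op M (\<lambda>n \<omega>. (sample_mean X n \<omega> - \<mu>) / Ld (real n))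
          (\<lambda>n. - K * ln (real n) powr (1 - \<gamma>))) \<and>
     (\<forall>Ld. de_bruijn_conjugate L Ld \<longrightarrow>
        (\<exists>r. r \<longlonglongrightarrow> 0 \<and>
           eq_in_distr_cauchy_op M (\<lambda>n \<omega>. (sample_mean X n \<omega> - \<mu>) / Ld (real n))
             (\<lambda>n. - K * ln (real n) powr (1 - \<gamma>) * (1 + r n)))) \<and>
     p \<sim>[sequentially] (\<lambda>n. 2 / pi * inverse K * ln (real n) powr (\<gamma> - 1)) \<and>
     p \<longlonglongrightarrow> 0 \<and>
     (\<beta>1 > 0 \<and> \<gamma> > 0 \<longrightarrow>
        p \<sim>[sequentially] (\<lambda>n. \<beta>1 powr \<gamma> * \<gamma> * ln (real n) powr (\<gamma> - 1))) \<and>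
     (\<beta>1 = 0 \<longrightarrow> p \<sim>[sequentially] (\<lambda>n. \<delta> / ln (real n)))"
proof -
  define \<kappa> where "\<kappa> = (if \<beta>1 > 0 then \<beta>1 powr \<gamma> * \<gamma> else \<delta>)"
  interpret SV: slow_variation L "tail_e \<beta>1 \<delta> \<gamma>" \<gamma> \<kappa> 2
    unfolding L_eq \<kappa>_def by (rule tail_L_slow_variation[OF params])
  interpret F: real_distribution F by (rule F_distr)
  interpret HT: heavy_tail L "tail_e \<beta>1 \<delta> \<gamma>" \<gamma> \<kappa> 2 F
  proof
    show "AE x in F. 0 < x" "integrable F (\<lambda>x. x)" by fact+
    have tail_compl: "1 - cdf F x = measure F {x<..}" for x
    proof -
      have "measure F (UNIV - {..x}) = 1 - measure F {..x}" using F.prob_compl[of "{..x}"] by simp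
      moreover have "UNIV - {..x} = {x<..}" by auto
      ultimately show ?thesis by (simp add: cdf_def)
    qed
    have ev: "eventually (\<lambda>x. 1 - cdf F x \<noteq> 0 \<or> 2 * C1 / (x * L x) \<noteq> 0) at_top"
      using eventually_ge_at_top[of 2] by eventually_elim (use SV.L_pos in \<open>force simp: C1_def\<close>)
    have "((\<lambda>x. (1 - cdf F x) / (2 * C1 / (x * L x)) * (2 / pi)) \<longlongrightarrow> 1 * (2 / pi)) at_top"
      by (intro tendsto_intros asymp_equivD_strong[OF F_tail ev])
    moreover have "(1 - cdf F x) / (2 * C1 / (x * L x)) * (2 / pi) = measure F {x<..} * SV.g x" for x
      by (simp add: tail_compl SV.g_def C1_def)
    ultimately show "((\<lambda>x. measure F {x<..} * SV.g x) \<longlongrightarrow> 2 / pi) at_top" by simp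
  qed
  interpret P: prob_space M by (rule M_prob)
  interpret HS: heavy_sample L "tail_e \<beta>1 \<delta> \<gamma>" \<gamma> \<kappa> 2 F M X
    by unfold_locales (fact X_indep X_distr)+
  have mu: "HS.\<mu> = \<mu>" using F_mean(2) by (simp add: HS.\<mu>_def)
  have HT_K: "HT.K = 2 / (pi * \<kappa>)" by (rule HT.K_def)
  have K: "HT.K = K"
    unfolding HT_K using params(2) by (auto simp: K_eq K_const_def \<kappa>_def C1_def)
  have K_pos: "K > 0" using HT.K_pos K by simp
  have inv_K: "2 / pi * inverse K = \<kappa>" using SV.kappa by (simp add: K[symmetric] HT_K)
  have p_fun: "p = (\<lambda>n. measure M {\<omega> \<in> space M. sample_mean X n \<omega> > \<mu>})" by (rule ext) (rule p_eq)
  have main: "p \<sim>[sequentially] (\<lambda>n. 2 / pi * inverse K * ln (real n) powr (\<gamma> - 1))"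
    using HS.exceed_mean_asymp_equiv unfolding mu K p_fun .
  hence main': "p \<sim>[sequentially] (\<lambda>n. \<kappa> * ln (real n) powr (\<gamma> - 1))" by (simp only: inv_K)
  have "(\<lambda>n. \<kappa> * ln (real n) powr (\<gamma> - 1)) \<longlonglongrightarrow> 0" using SV.gamma by real_asymp
  hence p0: "p \<longlonglongrightarrow> 0" by (simp only: tendsto_asymp_equiv_cong[OF main'])
  have c1: "p \<sim>[sequentially] (\<lambda>n. \<beta>1 powr \<gamma> * \<gamma> * ln (real n) powr (\<gamma> - 1))" if "\<beta>1 > 0"
    using main' that by (simp add: \<kappa>_def)
  have c2: "p \<sim>[sequentially] (\<lambda>n. \<delta> / ln (real n))" if "\<beta>1 = 0"
  proof -
    have g: "\<gamma> = 0" using that params by auto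
    have "eventually (\<lambda>n. \<kappa> * ln (real n) powr (\<gamma> - 1) = \<delta> / ln (real n)) sequentially"
      using eventually_ge_at_top[of 2]
      by eventually_elim (use that g in \<open>auto simp: \<kappa>_def powr_minus_divide\<close>)
    hence "p \<sim>[sequentially] (\<lambda>n. \<delta> / ln (real n)) \<longleftrightarrow> p \<sim>[sequentially] (\<lambda>n. \<kappa> * ln (real n) powr (\<gamma> - 1))"
      by (intro asymp_equiv_cong) (auto elim: eventually_mono)
    thus ?thesis using main' by blast
  qed
  show ?thesis
    using HS.exists_exact_conjugate HS.every_conjugate main p0 c1 c2 unfolding mu K by blast
qed

end
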